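(* Let $(R,\mathfrak m)$ be a Noetherian local ring of dimension $2$ and let $I,J$ be $\mathfrak m$-primary ideals of $R$. Let $(x,y;z,w)$ be a complete reduction of $(I,J)$, where $x,y\in I$ and $z,w\in J$. Let $\mathcal R=\bigoplus_{r,s\ge 0}I^rJ^st_1^rt_2^s$ be the bigraded Rees algebra and set $\mathcal R_{++}=(xzt_1t_2,\,ywt_1t_2)\mathcal R$. Then for all integers $r,s$, $$[H^2_{\mathcal R_{++}}(\mathcal R)]_{(r,s)}\cong \varinjlim_{k}\ \frac{I^{2k+r}J^{2k+s}}{(xz,yw)^{[k]}I^{k+r}J^{k+s}},$$ where the maps of the directed system (from the $k$-th to the $(k+1)$-st module) are induced by multiplication by $xzyw$.
   Context: $(x,y;z,w)$ with $x,y\in I$, $z,w\in J$ is a complete reduction of $(I,J)$ if $(xz,yw)$ is a reduction of $IJ$, i.e. $(xz,yw)(IJ)^n=(IJ)^{n+1}$ for $n\gg0$. The symbol $(xz,yw)^{[k]}$ denotes the ideal $((xz)^k,(yw)^k)$ of $R$. $t_1,t_2$ are indeterminates; $\mathcal R=R[It_1,Jt_2]\subseteq R[t_1,t_2]$ is $\mathbb N^2$-graded with $\mathcal R_{(r,s)}=I^rJ^st_1^rt_2^s$. The local cohomology modules have the natural $\mathbb Z^2$-grading inherited from $\mathcal R$, and $[\,\cdot\,]_{(r,s)}$ denotes the component of degree $(r,s)$. The direct limit is over $k$ large enough that all exponents are nonnegative. *)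

theory Defs
  imports "HOL-Algebra.UnivPoly" "HOL-Algebra.Ideal_Product" "HOL-Algebra.Ring_Divisibility"
    "HOL-Library.Extended_Nat" "HOL-Library.Product_Plus"
begin

section \<open>Commutative algebra\<close>

definition local_ring :: "('a, 'b) ring_scheme \<Rightarrow> 'a set \<Rightarrow> bool" where
  "local_ring R \<mm> \<longleftrightarrow> cring R \<and> maximalideal \<mm> R \<and> (\<forall>M. maximalideal M R \<longrightarrow> M = \<mm>)"

definition prime_chain :: "('a, 'b) ring_scheme \<Rightarrow> nat \<Rightarrow> (nat \<Rightarrow> 'a set) \<Rightarrow> bool" where
  "prime_chain R n P \<longleftrightarrow> (\<forall>i\<le>n. primeideal (P i) R) \<and> (\<forall>i<n. P i \<subset> P (Suc i))"

definition krull_dim :: "('a, 'b) ring_scheme \<Rightarrow> enat" where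
  "krull_dim R = (SUP n\<in>{n. \<exists>P. prime_chain R n P}. enat n)"

definition radical :: "('a, 'b) ring_scheme \<Rightarrow> 'a set \<Rightarrow> 'a set" where
  "radical R I = {a \<in> carrier R. \<exists>n::nat. a [^]\<^bsub>R\<^esub> n \<in> I}"

definition primary_ideal :: "('a, 'b) ring_scheme \<Rightarrow> 'a set \<Rightarrow> bool" where
  "primary_ideal R Q \<longleftrightarrow> ideal Q R \<and> Q \<noteq> carrier R \<and>
     (\<forall>a\<in>carrier R. \<forall>b\<in>carrier R. a \<otimes>\<^bsub>R\<^esub> b \<in> Q \<longrightarrow> a \<in> Q \<or> (\<exists>n::nat. b [^]\<^bsub>R\<^esub> n \<in> Q))"

definition primary_to :: "('a, 'b) ring_scheme \<Rightarrow> 'a set \<Rightarrow> 'a set \<Rightarrow> bool" where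
  "primary_to R \<mm> Q \<longleftrightarrow> primary_ideal R Q \<and> radical R Q = \<mm>"

text \<open>Powers in the monoid of ideals; in particular the zeroth power is the unit ideal.\<close>

definition ideal_pow :: "('a, 'b) ring_scheme \<Rightarrow> 'a set \<Rightarrow> nat \<Rightarrow> 'a set" where
  "ideal_pow R I n = I [^]\<^bsub>ideals_set R\<^esub> n"

definition complete_reduction ::
  "('a, 'b) ring_scheme \<Rightarrow> 'a set \<Rightarrow> 'a set \<Rightarrow> 'a \<Rightarrow> 'a \<Rightarrow> 'a \<Rightarrow> 'a \<Rightarrow> bool" where
  "complete_reduction R I J x y z w \<longleftrightarrow> x \<in> I \<and> y \<in> I \<and> z \<in> J \<and> w \<in> J \<and>
     (\<exists>N. \<forall>n\<ge>N. ideal_prod R (genideal R {x \<otimes>\<^bsub>R\<^esub> z, y \<otimes>\<^bsub>R\<^esub> w}) (ideal_pow R (ideal_prod R I J) n)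
        = ideal_pow R (ideal_prod R I J) (Suc n))"

section \<open>Modules\<close>

text \<open>Module records inherit from rings the fields \<open>mult\<close> and \<open>one\<close>, which have no meaning
  for a module; they are left undefined in the constructions below.\<close>

definition module_hom ::
  "('r, 'k) ring_scheme \<Rightarrow> ('r, 'm, 'x) module_scheme \<Rightarrow> ('r, 'n, 'y) module_scheme \<Rightarrow> ('m \<Rightarrow> 'n) set"
  where "module_hom S M N = {f \<in> carrier M \<rightarrow> carrier N.
     (\<forall>u\<in>carrier M. \<forall>v\<in>carrier M. f (u \<oplus>\<^bsub>M\<^esub> v) = f u \<oplus>\<^bsub>N\<^esub> f v) \<and>
     (\<forall>a\<in>carrier S. \<forall>v\<in>carrier M. f (a \<odot>\<^bsub>M\<^esub> v) = a \<odot>\<^bsub>N\<^esub> f v)}"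

definition module_isomorphic ::
  "('r, 'k) ring_scheme \<Rightarrow> ('r, 'm, 'x) module_scheme \<Rightarrow> ('r, 'n, 'y) module_scheme \<Rightarrow> bool"
  where "module_isomorphic S M N \<longleftrightarrow> (\<exists>f\<in>module_hom S M N. bij_betw f (carrier M) (carrier N))"

definition ideal_module :: "('a, 'b) ring_scheme \<Rightarrow> 'a set \<Rightarrow> ('a, 'a) module" where
  "ideal_module R A = \<lparr>carrier = A, monoid.mult = undefined, one = undefined, zero = \<zero>\<^bsub>R\<^esub>,
     add = add R, smult = monoid.mult R\<rparr>"

definition quot_module :: "('r, 'm, 'x) module_scheme \<Rightarrow> 'm set \<Rightarrow> ('r, 'm set) module" where
  "quot_module M N = \<lparr>carrier = a_rcosets\<^bsub>M\<^esub> N, monoid.mult = undefined, one = undefined, zero = N,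
     add = set_add M, smult = (\<lambda>a C. \<Union>c\<in>C. N +>\<^bsub>M\<^esub> (a \<odot>\<^bsub>M\<^esub> c))\<rparr>"

subsection \<open>Direct limits of sequences of modules\<close>

text \<open>A direct system \<open>M k \<rightarrow> M (Suc k)\<close> for \<open>k \<ge> k0\<close>, with maps \<open>\<phi> k\<close>.
  The composite \<open>M k \<rightarrow> M (k + n)\<close> is \<open>transition \<phi> k n\<close>.\<close>

primrec transition :: "(nat \<Rightarrow> 'm \<Rightarrow> 'm) \<Rightarrow> nat \<Rightarrow> nat \<Rightarrow> 'm \<Rightarrow> 'm" where
  "transition \<phi> k 0 = id"
| "transition \<phi> k (Suc n) = \<phi> (k + n) \<circ> transition \<phi> k n"

definition dirlim_rel ::
  "nat \<Rightarrow> (nat \<Rightarrow> ('r, 'm, 'x) module_scheme) \<Rightarrow> (nat \<Rightarrow> 'm \<Rightarrow> 'm) \<Rightarrow> ((nat \<times> 'm) \<times> (nat \<times> 'm)) set"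
  where "dirlim_rel k0 M \<phi> = {((k, u), (l, v)).
     k0 \<le> k \<and> u \<in> carrier (M k) \<and> k0 \<le> l \<and> v \<in> carrier (M l) \<and>
     (\<exists>j. k \<le> j \<and> l \<le> j \<and> transition \<phi> k (j - k) u = transition \<phi> l (j - l) v)}"

definition direct_limit ::
  "nat \<Rightarrow> (nat \<Rightarrow> ('r, 'm, 'x) module_scheme) \<Rightarrow> (nat \<Rightarrow> 'm \<Rightarrow> 'm) \<Rightarrow> ('r, (nat \<times> 'm) set) module"
  where "direct_limit k0 M \<phi> = \<lparr>
     carrier = (SIGMA k:{k0..}. carrier (M k)) // dirlim_rel k0 M \<phi>,
     monoid.mult = undefined, one = undefined,
     zero = dirlim_rel k0 M \<phi> `` {(k0, \<zero>\<^bsub>M k0\<^esub>)},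
     add = (\<lambda>X Y. \<Union>(k, u)\<in>X. \<Union>(l, v)\<in>Y. dirlim_rel k0 M \<phi> ``
       {(max k l, transition \<phi> k (max k l - k) u \<oplus>\<^bsub>M (max k l)\<^esub> transition \<phi> l (max k l - l) v)}),
     smult = (\<lambda>a X. \<Union>(k, u)\<in>X. dirlim_rel k0 M \<phi> `` {(k, a \<odot>\<^bsub>M k\<^esub> u)})\<rparr>"

section \<open>Bigraded modules and local cohomology\<close>

record ('r, 'm) gmodule = "('r, 'm) module" +
  grade :: "int \<times> int \<Rightarrow> 'm set"

text \<open>The \<open>\<int>\<^sup>2\<close>-graded ring \<open>S\<close> is given as a record of the same kind, so that it can also serve as
  a graded module over itself.\<close>

definition graded_module :: "('r, 'r) gmodule \<Rightarrow> ('r, 'm) gmodule \<Rightarrow> bool" where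
  "graded_module S M \<longleftrightarrow> module S M \<and> (\<forall>c. additive_subgroup (grade M c) M) \<and>
     (\<forall>v\<in>carrier M. \<exists>!u. (\<forall>c. u c \<in> grade M c) \<and> finite {c. u c \<noteq> \<zero>\<^bsub>M\<^esub>} \<and>
        v = finsum M u {c. u c \<noteq> \<zero>\<^bsub>M\<^esub>}) \<and>
     (\<forall>b c. \<forall>a\<in>grade S b. \<forall>v\<in>grade M c. a \<odot>\<^bsub>M\<^esub> v \<in> grade M (b + c))"

definition graded_hom :: "('r, 'r) gmodule \<Rightarrow> ('r, 'm) gmodule \<Rightarrow> ('r, 'n) gmodule \<Rightarrow> ('m \<Rightarrow> 'n) set" where
  "graded_hom S M N = {f \<in> module_hom S M N. \<forall>c. f ` grade M c \<subseteq> grade N c}"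

text \<open>Injective objects of the category of graded modules and degree-preserving homomorphisms. The
  test modules are those with elements in the type \<open>'e\<close> of the elements of \<open>E\<close>. For the members of
  a resolution of \<open>S\<close> this loses nothing: \<open>S\<close> embeds in the first member, so (up to isomorphism and
  with arbitrary shifts of the grading) the inclusions of homogeneous ideals into \<open>S\<close> are among the
  tests, and these suffice by Baer's criterion.\<close>

definition graded_injective :: "('r, 'r) gmodule \<Rightarrow> ('r, 'e) gmodule \<Rightarrow> bool" where
  "graded_injective S E \<longleftrightarrow> graded_module S E \<and>
     (\<forall>(M :: ('r, 'e) gmodule) (N :: ('r, 'e) gmodule). \<forall>i\<in>graded_hom S M N. \<forall>f\<in>graded_hom S M E.
        graded_module S M \<longrightarrow> graded_module S N \<longrightarrow> inj_on i (carrier M) \<longrightarrow>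
        (\<exists>g\<in>graded_hom S N E. \<forall>v\<in>carrier M. g (i v) = f v))"

definition graded_injective_resolution ::
  "('r, 'r) gmodule \<Rightarrow> ('r, 'm) gmodule \<Rightarrow> (nat \<Rightarrow> ('r, 'e) gmodule) \<Rightarrow> ('m \<Rightarrow> 'e) \<Rightarrow> (nat \<Rightarrow> 'e \<Rightarrow> 'e) \<Rightarrow> bool"
  where "graded_injective_resolution S M E \<epsilon> d \<longleftrightarrow>
     graded_module S M \<and> (\<forall>n. graded_injective S (E n)) \<and>
     \<epsilon> \<in> graded_hom S M (E 0) \<and> (\<forall>n. d n \<in> graded_hom S (E n) (E (Suc n))) \<and>
     inj_on \<epsilon> (carrier M) \<and> \<epsilon> ` carrier M = a_kernel (E 0) (E 1) (d 0) \<and>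
     (\<forall>n. d n ` carrier (E n) = a_kernel (E (Suc n)) (E (Suc (Suc n))) (d (Suc n)))"

definition graded_sub :: "('r, 'm) gmodule \<Rightarrow> 'm set \<Rightarrow> ('r, 'm) gmodule" where
  "graded_sub M U = M\<lparr>carrier := U, grade := \<lambda>c. grade M c \<inter> U\<rparr>"

definition graded_quot :: "('r, 'm) gmodule \<Rightarrow> 'm set \<Rightarrow> ('r, 'm set) gmodule" where
  "graded_quot M N = module.extend (quot_module M N)
     \<lparr>grade = (\<lambda>c. (\<lambda>v. N +>\<^bsub>M\<^esub> v) ` grade M c)\<rparr>"

definition torsion :: "('r, 'r) gmodule \<Rightarrow> 'r set \<Rightarrow> ('r, 'm) gmodule \<Rightarrow> ('r, 'm) gmodule" where
  "torsion S \<aa> M = graded_sub M {v \<in> carrier M. \<exists>n. \<forall>a\<in>ideal_pow S \<aa> n. a \<odot>\<^bsub>M\<^esub> v = \<zero>\<^bsub>M\<^esub>}"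

definition coboundaries :: "(nat \<Rightarrow> ('r, 'm) gmodule) \<Rightarrow> (nat \<Rightarrow> 'm \<Rightarrow> 'm) \<Rightarrow> nat \<Rightarrow> 'm set" where
  "coboundaries C d i = (case i of 0 \<Rightarrow> {\<zero>\<^bsub>C 0\<^esub>} | Suc j \<Rightarrow> d j ` carrier (C j))"

definition cohomology ::
  "(nat \<Rightarrow> ('r, 'm) gmodule) \<Rightarrow> (nat \<Rightarrow> 'm \<Rightarrow> 'm) \<Rightarrow> nat \<Rightarrow> ('r, 'm set) gmodule" where
  "cohomology C d i =
     graded_quot (graded_sub (C i) (a_kernel (C i) (C (Suc i)) (d i))) (coboundaries C d i)"

text \<open>\<open>H\<close> is the \<open>i\<close>-th right derived functor of the \<open>\<aa>\<close>-torsion functor, evaluated at \<open>M\<close> by means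
  of some injective resolution of \<open>M\<close> by graded modules with elements in \<open>'e\<close>.\<close>

definition is_local_cohomology ::
  "('r, 'r) gmodule \<Rightarrow> 'r set \<Rightarrow> nat \<Rightarrow> ('r, 'm) gmodule \<Rightarrow> ('r, 'e set) gmodule \<Rightarrow> bool" where
  "is_local_cohomology S \<aa> i M H \<longleftrightarrow> (\<exists>E \<epsilon> d. graded_injective_resolution S M E \<epsilon> d \<and>
     H = cohomology (\<lambda>n. torsion S \<aa> (E n)) d i)"

section \<open>The bigraded Rees algebra\<close>

text \<open>\<open>R[t\<^sub>1, t\<^sub>2]\<close> is \<open>UP (UP R)\<close>, with \<open>t\<^sub>1\<close> the outer and \<open>t\<^sub>2\<close> the inner indeterminate.\<close>

definition bimonom :: "('a, 'b) ring_scheme \<Rightarrow> 'a \<Rightarrow> nat \<Rightarrow> nat \<Rightarrow> (nat \<Rightarrow> nat \<Rightarrow> 'a)" where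
  "bimonom R a r s = monom (UP (UP R)) (monom (UP R) a s) r"

definition rees ::
  "('a, 'b) ring_scheme \<Rightarrow> 'a set \<Rightarrow> 'a set \<Rightarrow> (nat \<Rightarrow> nat \<Rightarrow> 'a, nat \<Rightarrow> nat \<Rightarrow> 'a) gmodule" where
  "rees R I J = \<lparr>
     carrier = {p \<in> carrier (UP (UP R)).
       \<forall>r s. coeff (UP R) (coeff (UP (UP R)) p r) s \<in> ideal_prod R (ideal_pow R I r) (ideal_pow R J s)},
     monoid.mult = monoid.mult (UP (UP R)), one = one (UP (UP R)), zero = zero (UP (UP R)), add = add (UP (UP R)),
     smult = monoid.mult (UP (UP R)),
     grade = (\<lambda>(r, s). if 0 \<le> r \<and> 0 \<le> s
       then (\<lambda>a. bimonom R a (nat r) (nat s)) `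
         ideal_prod R (ideal_pow R I (nat r)) (ideal_pow R J (nat s))
       else {\<zero>\<^bsub>UP (UP R)\<^esub>})\<rparr>"

definition rees_pp ::
  "('a, 'b) ring_scheme \<Rightarrow> 'a set \<Rightarrow> 'a set \<Rightarrow> 'a \<Rightarrow> 'a \<Rightarrow> 'a \<Rightarrow> 'a \<Rightarrow> (nat \<Rightarrow> nat \<Rightarrow> 'a) set" where
  "rees_pp R I J x y z w =
     genideal (rees R I J) {bimonom R (x \<otimes>\<^bsub>R\<^esub> z) 1 1, bimonom R (y \<otimes>\<^bsub>R\<^esub> w) 1 1}"

text \<open>The component of degree \<open>c\<close>, an \<open>R\<close>-module because \<open>R\<close> is the component of degree zero of the
  Rees algebra.\<close>

definition component ::
  "('a, 'b) ring_scheme \<Rightarrow> (nat \<Rightarrow> nat \<Rightarrow> 'a, 'm) gmodule \<Rightarrow> int \<times> int \<Rightarrow> ('a, 'm) module" where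
  "component R H c = \<lparr>carrier = grade H c, monoid.mult = undefined, one = undefined, zero = \<zero>\<^bsub>H\<^esub>,
     add = add H, smult = (\<lambda>a v. bimonom R a 0 0 \<odot>\<^bsub>H\<^esub> v)\<rparr>"

section \<open>The direct system\<close>

definition system_ideal :: "('a, 'b) ring_scheme \<Rightarrow> 'a set \<Rightarrow> 'a set \<Rightarrow> int \<Rightarrow> int \<Rightarrow> nat \<Rightarrow> 'a set" where
  "system_ideal R I J r s k = ideal_prod R
     (ideal_pow R I (nat (2 * int k + r))) (ideal_pow R J (nat (2 * int k + s)))"

definition system_subideal ::
  "('a, 'b) ring_scheme \<Rightarrow> 'a set \<Rightarrow> 'a set \<Rightarrow> 'a \<Rightarrow> 'a \<Rightarrow> int \<Rightarrow> int \<Rightarrow> nat \<Rightarrow> 'a set" where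
  "system_subideal R I J a b r s k = ideal_prod R (genideal R {a [^]\<^bsub>R\<^esub> k, b [^]\<^bsub>R\<^esub> k})
     (ideal_prod R (ideal_pow R I (nat (int k + r))) (ideal_pow R J (nat (int k + s))))"

definition system_module ::
  "('a, 'b) ring_scheme \<Rightarrow> 'a set \<Rightarrow> 'a set \<Rightarrow> 'a \<Rightarrow> 'a \<Rightarrow> int \<Rightarrow> int \<Rightarrow> nat \<Rightarrow> ('a, 'a set) module" where
  "system_module R I J a b r s k =
     quot_module (ideal_module R (system_ideal R I J r s k)) (system_subideal R I J a b r s k)"

definition system_map ::
  "('a, 'b) ring_scheme \<Rightarrow> 'a set \<Rightarrow> 'a set \<Rightarrow> 'a \<Rightarrow> 'a \<Rightarrow> int \<Rightarrow> int \<Rightarrow> nat \<Rightarrow> 'a set \<Rightarrow> 'a set" where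
  "system_map R I J a b r s k C =
     (\<Union>c\<in>C. system_subideal R I J a b r s (Suc k) +>\<^bsub>R\<^esub> (a \<otimes>\<^bsub>R\<^esub> b \<otimes>\<^bsub>R\<^esub> c))"

text \<open>The least index from which on all exponents are nonnegative.\<close>

definition system_start :: "int \<Rightarrow> int \<Rightarrow> nat" where
  "system_start r s = nat (max 0 (max (- r) (- s)))"

definition system_limit ::
  "('a, 'b) ring_scheme \<Rightarrow> 'a set \<Rightarrow> 'a set \<Rightarrow> 'a \<Rightarrow> 'a \<Rightarrow> int \<Rightarrow> int \<Rightarrow> ('a, (nat \<times> 'a set) set) module" where
  "system_limit R I J a b r s =
     direct_limit (system_start r s) (system_module R I J a b r s) (system_map R I J a b r s)"

end

theory Submission
  imports Defs "HOL-Algebra.Subrings"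
begin

text \<open>Write \<open>S\<close> for the Rees algebra, \<open>f = xz t\<^sub>1 t\<^sub>2\<close>, \<open>g = yw t\<^sub>1 t\<^sub>2\<close>, and let
  \<open>S \<rightarrow> E\<^sub>0 \<rightarrow> E\<^sub>1 \<rightarrow> E\<^sub>2 \<rightarrow> \<dots>\<close> be a graded injective resolution. Since \<open>S\<close> is Noetherian,
  for homogeneous \<open>h \<in> S\<close> and \<open>v\<close> in a graded injective module some \<open>h\<^sup>N v\<close> is divisible by
  \<open>h\<^bsup>N+1\<^esup>\<close>, and an \<open>fg\<close>-torsion element is a sum of an \<open>f\<close>-torsion and a
  \<open>g\<close>-torsion element. Hence for homogeneous \<open>u \<in> S\<close> there is \<open>\<alpha> \<in> E\<^sub>0\<close> with
  \<open>(fg)\<^sup>k \<alpha> = u\<close> up to \<open>fg\<close>-torsion; then \<open>d\<alpha>\<close> is \<open>fg\<close>-torsion, \<open>d\<alpha> = \<beta> - \<gamma>\<close> with \<open>\<beta>\<close>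
  killed by a power of \<open>f\<close> and \<open>\<gamma>\<close> by a power of \<open>g\<close>, and \<open>v = d\<beta> = d\<gamma>\<close> is a torsion cocycle,
  the class of the generalized fraction \<open>u / (fg)\<^sup>k\<close>. The relation between \<open>v\<close> and \<open>(k, u)\<close> is
  additive, is total on both sides, respects \<open>(k, u) \<mapsto> (k + 1, fg u)\<close>, and \<open>v\<close> is a coboundary
  exactly if \<open>(fg)\<^sup>j u \<in> (f\<^bsup>k+j\<^esup>, g\<^bsup>k+j\<^esup>)\<close> for some \<open>j\<close>. In degree \<open>(r, s)\<close> this relation is the
  isomorphism with the direct limit.\<close>

section \<open>Ascending chains of ideals\<close>

text \<open>The usual road is the Cech complex, with H^2 = S_fg / (S_f + S_g). Here cohomology is
  given by a resolution whose modules have elements in one fixed type \<open>'e\<close>, so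
  fractions are handled inside the resolution instead of in localizations. Divisibility up to
  torsion says that E_n maps onto its localization at a homogeneous h, and \<alpha>, \<beta>,
  \<gamma> are the zigzag through the double complex formed by the Cech complexes of the E_n. The
  zigzag involves choices at every stage, so a relation takes the place of a map.

  Divisibility and splitting come from Baer's criterion for ideals with one or two homogeneous
  generators. The chain condition enters exactly there: stabilization of annihilators or of colon
  ideals makes the map to be extended well defined.

  The exponents of the direct system are degrees. Both f and g have degree (1, 1), so u / (fg)^k has
  degree (r, s) if u has degree (2k + r, 2k + s), and the coefficients of f^k and g^k in such a u
  have degree (k + r, k + s).\<close>

definition rel_ideal :: "('a, 'b) ring_scheme \<Rightarrow> 'a set \<Rightarrow> 'a set \<Rightarrow> bool" where
  "rel_ideal S B L \<longleftrightarrow> L \<subseteq> B \<and> \<zero>\<^bsub>S\<^esub> \<in> L \<and> (\<forall>a\<in>L. \<forall>b\<in>L. a \<oplus>\<^bsub>S\<^esub> b \<in> L) \<and>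
     (\<forall>b\<in>B. \<forall>a\<in>L. b \<otimes>\<^bsub>S\<^esub> a \<in> L)"

text \<open>The subring \<open>B\<close> stays a subset of one fixed \<open>S\<close>, because
  elements of \<open>S\<close> are adjoined to it one after another. Closure under negatives is not
  a clause of \<open>rel_ideal\<close>: for a subring it follows by multiplying with -1, see
  \<open>rel_ideal_uminus\<close>.\<close>

definition acc :: "('a, 'b) ring_scheme \<Rightarrow> 'a set \<Rightarrow> bool" where
  "acc S B \<longleftrightarrow> (\<forall>A::nat \<Rightarrow> 'a set. (\<forall>n. rel_ideal S B (A n)) \<longrightarrow> (\<forall>n. A n \<subseteq> A (Suc n)) \<longrightarrow>
     (\<exists>N. \<forall>n\<ge>N. A n = A N))"

lemma chain_mono:
  assumes "\<And>n. (A :: nat \<Rightarrow> 'a set) n \<subseteq> A (Suc n)" "m \<le> n" shows "A m \<subseteq> A n"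
  using lift_Suc_mono_le[of A, OF assms] .

lemma accD:
  assumes "acc S B" "\<And>n. rel_ideal S B (A n)" "\<And>n. A n \<subseteq> A (Suc n)"
  obtains N where "\<And>n. N \<le> n \<Longrightarrow> A n = A N"
  using assms unfolding acc_def by metis

section \<open>Hilbert's basis theorem for subrings B[t] of a fixed ring\<close>

primrec poly_upto :: "('a, 'b) ring_scheme \<Rightarrow> 'a set \<Rightarrow> 'a \<Rightarrow> nat \<Rightarrow> 'a set" where
  "poly_upto S B t 0 = {\<zero>\<^bsub>S\<^esub>}"
| "poly_upto S B t (Suc n) = {b \<otimes>\<^bsub>S\<^esub> t [^]\<^bsub>S\<^esub> n \<oplus>\<^bsub>S\<^esub> p |b p. b \<in> B \<and> p \<in> poly_upto S B t n}"

definition adjoin :: "('a, 'b) ring_scheme \<Rightarrow> 'a set \<Rightarrow> 'a \<Rightarrow> 'a set" where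
  "adjoin S B t = (\<Union>n. poly_upto S B t n)"

text \<open>Coefficients of t^n in elements of \<aa> that can be written with degree at most
  \<open>n\<close>. The coefficient may be zero, which is what makes this an ideal of
  \<open>B\<close>.\<close>

definition leading :: "('a, 'b) ring_scheme \<Rightarrow> 'a set \<Rightarrow> 'a \<Rightarrow> 'a set \<Rightarrow> nat \<Rightarrow> 'a set" where
  "leading S B t \<aa> n = {b \<in> B. \<exists>p\<in>poly_upto S B t n. b \<otimes>\<^bsub>S\<^esub> t [^]\<^bsub>S\<^esub> n \<oplus>\<^bsub>S\<^esub> p \<in> \<aa>}"

context cring
begin

lemma rel_ideal_uminus:
  assumes "rel_ideal R C \<aa>" "subring C R" "a \<in> \<aa>"
  shows "\<ominus> a \<in> \<aa>"
proof -
  have "\<ominus> \<one> \<otimes> a \<in> \<aa>" using assms subringE(3,5)[OF assms(2)] by (auto simp: rel_ideal_def)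
  moreover have "a \<in> carrier R" using assms subringE(1)[OF assms(2)] by (auto simp: rel_ideal_def)
  ultimately show ?thesis by (simp add: l_minus)
qed

context
  fixes B :: "'a set" and t :: 'a
  assumes B: "subring B R" and t: "t \<in> carrier R"
begin

lemma subring_mem_carrier: "b \<in> B \<Longrightarrow> b \<in> carrier R"
  using subringE(1)[OF B] by blast

lemmas subring_closed = subringE(2,3,5,6,7)[OF B]

lemma poly_upto_carr: "p \<in> poly_upto R B t n \<Longrightarrow> p \<in> carrier R"
  by (induct n arbitrary: p) (auto simp: subring_mem_carrier t)

lemma poly_upto_zero: "\<zero> \<in> poly_upto R B t n"
proof (induct n)
  case (Suc n)
  have "\<zero> = \<zero> \<otimes> t [^] n \<oplus> \<zero>" using t by simp
  with Suc subring_closed(1) show ?case by auto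
qed simp

lemma poly_upto_add:
  "p \<in> poly_upto R B t n \<Longrightarrow> q \<in> poly_upto R B t n \<Longrightarrow> p \<oplus> q \<in> poly_upto R B t n"
proof (induct n arbitrary: p q)
  case (Suc n)
  then obtain b p' b' q' where *: "p = b \<otimes> t [^] n \<oplus> p'" "q = b' \<otimes> t [^] n \<oplus> q'" "b \<in> B" "b' \<in> B"
    "p' \<in> poly_upto R B t n" "q' \<in> poly_upto R B t n" by auto
  have "p \<oplus> q = (b \<oplus> b') \<otimes> t [^] n \<oplus> (p' \<oplus> q')"
    using * subring_mem_carrier poly_upto_carr t by (simp add: l_distr a_ac)
  with * Suc.hyps[OF *(5,6)] subring_closed(5) show ?case by auto
qed simp

lemma poly_upto_smult:
  "b \<in> B \<Longrightarrow> q \<in> poly_upto R B t n \<Longrightarrow> b \<otimes> q \<in> poly_upto R B t n"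
proof (induct n arbitrary: q)
  case (Suc n)
  then obtain b' q' where *: "q = b' \<otimes> t [^] n \<oplus> q'" "b' \<in> B"
    "q' \<in> poly_upto R B t n" by auto
  have "b \<otimes> q = (b \<otimes> b') \<otimes> t [^] n \<oplus> (b \<otimes> q')"
    using * subring_mem_carrier poly_upto_carr t Suc.prems by (simp add: r_distr m_ac)
  with * Suc.hyps[OF Suc.prems(1) *(3)] subring_closed(4) Suc.prems show ?case by auto
qed (simp add: subring_mem_carrier)

lemma poly_upto_Suc: "poly_upto R B t n \<subseteq> poly_upto R B t (Suc n)"
proof
  fix p assume p: "p \<in> poly_upto R B t n"
  then have "p = \<zero> \<otimes> t [^] n \<oplus> p" using poly_upto_carr t by simp
  with p subring_closed(1) show "p \<in> poly_upto R B t (Suc n)" by auto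
qed

lemma poly_upto_mono: "m \<le> n \<Longrightarrow> poly_upto R B t m \<subseteq> poly_upto R B t n"
  by (rule chain_mono[of "poly_upto R B t", OF poly_upto_Suc])

lemma poly_upto_shift:
  "q \<in> poly_upto R B t n \<Longrightarrow> t \<otimes> q \<in> poly_upto R B t (Suc n)"
proof (induct n arbitrary: q)
  case 0
  then show ?case using poly_upto_zero[of "Suc 0"] t by simp
next
  case (Suc n)
  then obtain b' q' where *: "q = b' \<otimes> t [^] n \<oplus> q'" "b' \<in> B"
    "q' \<in> poly_upto R B t n" by auto
  have "t \<otimes> q = b' \<otimes> t [^] (Suc n) \<oplus> (t \<otimes> q')"
    using * subring_mem_carrier poly_upto_carr t Suc.prems by (simp add: r_distr m_ac)
  with * Suc.hyps[OF *(3)] show ?case by (auto simp del: nat_pow_Suc)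
qed

lemma poly_upto_uminus: "q \<in> poly_upto R B t n \<Longrightarrow> \<ominus> q \<in> poly_upto R B t n"
  using poly_upto_smult[of "\<ominus> \<one>" q n] subring_closed poly_upto_carr by (simp add: l_minus)

lemma adjoin_mult:
  assumes "p \<in> adjoin R B t" "q \<in> adjoin R B t"
  shows "p \<otimes> q \<in> adjoin R B t"
proof -
  have shift: "x \<in> poly_upto R B t m \<Longrightarrow> t [^] n \<otimes> x \<in> poly_upto R B t (m + n)" for x m n
  proof (induct n)
    case 0 then show ?case using poly_upto_carr by simp
  next
    case (Suc n)
    then have "t \<otimes> (t [^] n \<otimes> x) \<in> poly_upto R B t (Suc (m + n))"
      using poly_upto_shift by blast
    then show ?case using Suc.prems poly_upto_carr t by (simp add: m_ac)
  qed
  obtain m where q: "q \<in> poly_upto R B t m" using assms by (auto simp: adjoin_def)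
  have "p \<in> poly_upto R B t n \<Longrightarrow> \<exists>k. p \<otimes> q \<in> poly_upto R B t k" for n p
  proof (induct n arbitrary: p)
    case 0
    then show ?case using q poly_upto_carr poly_upto_zero by auto
  next
    case (Suc n)
    then obtain b p' where *: "p = b \<otimes> t [^] n \<oplus> p'" "b \<in> B"
      "p' \<in> poly_upto R B t n" by auto
    from Suc.hyps[OF *(3)] obtain k where k: "p' \<otimes> q \<in> poly_upto R B t k" ..
    have "b \<otimes> (t [^] n \<otimes> q) \<in> poly_upto R B t (m + n)"
      using shift[OF q] poly_upto_smult *(2) by blast
    with k have "b \<otimes> (t [^] n \<otimes> q) \<oplus> p' \<otimes> q \<in> poly_upto R B t (max k (m + n))"
      by (meson max.cobounded1 max.cobounded2 poly_upto_add poly_upto_mono subsetD)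
    moreover have "b \<otimes> (t [^] n \<otimes> q) \<oplus> p' \<otimes> q = p \<otimes> q"
      using * subring_mem_carrier poly_upto_carr t q by (simp add: l_distr m_assoc)
    ultimately show ?case by auto
  qed
  with assms show ?thesis by (auto simp: adjoin_def)
qed

lemma subset_adjoin: "B \<subseteq> adjoin R B t"
proof
  fix b assume "b \<in> B"
  then have "b = b \<otimes> t [^] (0::nat) \<oplus> \<zero>" using subring_mem_carrier by simp
  then have "b \<in> poly_upto R B t (Suc 0)" using \<open>b \<in> B\<close> by auto
  then show "b \<in> adjoin R B t" unfolding adjoin_def by blast
qed

lemma mem_adjoin: "t \<in> adjoin R B t"
proof -
  have "\<one> = \<one> \<otimes> t [^] (0::nat) \<oplus> \<zero>" using t by simp
  then have "\<one> \<in> poly_upto R B t (Suc 0)" using subring_closed(2) unfolding poly_upto.simps by blast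
  then have "t \<otimes> \<one> \<in> poly_upto R B t (Suc (Suc 0))" by (rule poly_upto_shift)
  then show ?thesis unfolding adjoin_def using t by (simp del: poly_upto.simps) blast
qed

lemma subring_adjoin: "subring (adjoin R B t) R"
proof (rule subringI)
  show "adjoin R B t \<subseteq> carrier R" using poly_upto_carr by (auto simp: adjoin_def)
  show "\<one> \<in> adjoin R B t" using subset_adjoin subring_closed(2) by blast
  fix h1 h2 assume h: "h1 \<in> adjoin R B t" 
  then show "\<ominus> h1 \<in> adjoin R B t" using poly_upto_uminus by (auto simp: adjoin_def)
  assume h2: "h2 \<in> adjoin R B t"
  show "h1 \<otimes> h2 \<in> adjoin R B t" using adjoin_mult h h2 .
  from h h2 obtain m n where "h1 \<in> poly_upto R B t m" "h2 \<in> poly_upto R B t n"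
    by (auto simp: adjoin_def)
  then have "h1 \<oplus> h2 \<in> poly_upto R B t (max m n)"
    by (meson max.cobounded1 max.cobounded2 poly_upto_add poly_upto_mono subsetD)
  then show "h1 \<oplus> h2 \<in> adjoin R B t" by (auto simp: adjoin_def)
qed

lemma rel_ideal_leading:
  assumes "rel_ideal R (adjoin R B t) \<aa>"
  shows "rel_ideal R B (leading R B t \<aa> n)"
  unfolding rel_ideal_def
proof (intro conjI ballI)
  show "leading R B t \<aa> n \<subseteq> B" by (auto simp: leading_def)
  have "\<zero> \<in> \<aa>" using assms by (auto simp: rel_ideal_def)
  then have "\<zero> \<otimes> t [^] n \<oplus> \<zero> \<in> \<aa>" using t by simp
  then show "\<zero> \<in> leading R B t \<aa> n"
    using subring_closed(1) poly_upto_zero[of n] unfolding leading_def by blast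
next
  fix a b assume "a \<in> leading R B t \<aa> n" "b \<in> leading R B t \<aa> n"
  then obtain p q where *: "a \<in> B" "b \<in> B" "p \<in> poly_upto R B t n" "q \<in> poly_upto R B t n"
    "a \<otimes> t [^] n \<oplus> p \<in> \<aa>" "b \<otimes> t [^] n \<oplus> q \<in> \<aa>"
    by (auto simp: leading_def)
  then have "(a \<otimes> t [^] n \<oplus> p) \<oplus> (b \<otimes> t [^] n \<oplus> q) \<in> \<aa>" using assms by (auto simp: rel_ideal_def)
  moreover have "(a \<otimes> t [^] n \<oplus> p) \<oplus> (b \<otimes> t [^] n \<oplus> q) = (a \<oplus> b) \<otimes> t [^] n \<oplus> (p \<oplus> q)"
    using * subring_mem_carrier poly_upto_carr t by (simp add: l_distr a_ac)
  ultimately show "a \<oplus> b \<in> leading R B t \<aa> n"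
    using * poly_upto_add subring_closed(5) by (auto simp: leading_def)
next
  fix b a assume b: "b \<in> B" and "a \<in> leading R B t \<aa> n"
  then obtain p where *: "a \<in> B" "p \<in> poly_upto R B t n" "a \<otimes> t [^] n \<oplus> p \<in> \<aa>"
    by (auto simp: leading_def)
  then have "b \<otimes> (a \<otimes> t [^] n \<oplus> p) \<in> \<aa>" using assms b subset_adjoin by (auto simp: rel_ideal_def)
  moreover have "b \<otimes> (a \<otimes> t [^] n \<oplus> p) = (b \<otimes> a) \<otimes> t [^] n \<oplus> b \<otimes> p"
    using * subring_mem_carrier b poly_upto_carr t by (simp add: r_distr m_assoc)
  ultimately show "b \<otimes> a \<in> leading R B t \<aa> n"
    using * b poly_upto_smult subring_closed(4) by (auto simp: leading_def)
qed

text \<open>Multiplication by \<open>t\<close> raises the degree and keeps the coefficient.\<close>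

lemma leading_Suc:
  assumes "rel_ideal R (adjoin R B t) \<aa>"
  shows "leading R B t \<aa> n \<subseteq> leading R B t \<aa> (Suc n)"
proof
  fix a assume "a \<in> leading R B t \<aa> n"
  then obtain p where *: "a \<in> B" "p \<in> poly_upto R B t n" "a \<otimes> t [^] n \<oplus> p \<in> \<aa>"
    by (auto simp: leading_def)
  then have "t \<otimes> (a \<otimes> t [^] n \<oplus> p) \<in> \<aa>" using assms mem_adjoin by (auto simp: rel_ideal_def)
  moreover have "t \<otimes> (a \<otimes> t [^] n \<oplus> p) = a \<otimes> t [^] (Suc n) \<oplus> t \<otimes> p"
    using * subring_mem_carrier poly_upto_carr t by (simp add: r_distr m_ac)
  ultimately show "a \<in> leading R B t \<aa> (Suc n)"
    using * poly_upto_shift by (auto simp: leading_def simp del: nat_pow_Suc poly_upto.simps)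
qed

text \<open>The top coefficient of an element of \<bb> is also the top coefficient of an element of
  \<aa> of the same formal degree. Their difference is in \<bb> and has lower degree, so induction
  on the degree puts it into \<aa>.\<close>

lemma rel_ideal_eq_if_leading_eq:
  assumes \<aa>: "rel_ideal R (adjoin R B t) \<aa>" and \<bb>: "rel_ideal R (adjoin R B t) \<bb>" and "\<aa> \<subseteq> \<bb>"
    and eq: "\<And>n. leading R B t \<bb> n \<subseteq> leading R B t \<aa> n"
  shows "\<aa> = \<bb>"
proof -
  have "p \<in> poly_upto R B t n \<Longrightarrow> p \<in> \<bb> \<Longrightarrow> p \<in> \<aa>" for n p
  proof (induct n arbitrary: p)
    case 0 then show ?case using \<aa> by (auto simp: rel_ideal_def)
  next
    case (Suc n)
    then obtain b p' where *: "p = b \<otimes> t [^] n \<oplus> p'" "b \<in> B" "p' \<in> poly_upto R B t n"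
      by auto
    then have "b \<in> leading R B t \<bb> n" using Suc.prems by (auto simp: leading_def)
    then have "b \<in> leading R B t \<aa> n" using eq by blast
    then obtain q where q: "q \<in> poly_upto R B t n" "b \<otimes> t [^] n \<oplus> q \<in> \<aa>"
      by (auto simp: leading_def)
    have c: "p' \<in> carrier R" "q \<in> carrier R" "b \<otimes> t [^] n \<in> carrier R"
      using * q poly_upto_carr subring_mem_carrier t by auto
    have "p \<oplus> \<ominus> (b \<otimes> t [^] n \<oplus> q) \<in> \<bb>"
      using q \<open>\<aa> \<subseteq> \<bb>\<close> Suc.prems \<bb> rel_ideal_uminus[OF \<bb> subring_adjoin]
      unfolding rel_ideal_def by blast
    moreover have eq1: "p \<oplus> \<ominus> (b \<otimes> t [^] n \<oplus> q) = p' \<oplus> \<ominus> q"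
      using c * by (simp add: minus_add a_ac r_neg1 r_neg r_neg2)
    ultimately have "p' \<oplus> \<ominus> q \<in> \<bb>" by simp
    then have "p' \<oplus> \<ominus> q \<in> \<aa>" using Suc.hyps * q poly_upto_add poly_upto_uminus by blast
    then have "(p' \<oplus> \<ominus> q) \<oplus> (b \<otimes> t [^] n \<oplus> q) \<in> \<aa>" using q \<aa> by (auto simp: rel_ideal_def)
    also have "(p' \<oplus> \<ominus> q) \<oplus> (b \<otimes> t [^] n \<oplus> q) = p"
      using c * by (simp add: a_ac r_neg1 r_neg r_neg2)
    finally show ?case .
  qed
  moreover have "\<bb> \<subseteq> adjoin R B t" using \<bb> by (auto simp: rel_ideal_def)
  ultimately show ?thesis using \<open>\<aa> \<subseteq> \<bb>\<close> by (auto simp: adjoin_def)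
qed

text \<open>As in Hilbert's basis theorem, but the leading coefficients belong to expressions in \<open>t\<close>, which
  need not be unique.\<close>

theorem acc_adjoin:
  assumes acc: "acc R B"
  shows "acc R (adjoin R B t)"
  unfolding acc_def
proof (intro allI impI)
  fix A :: "nat \<Rightarrow> 'a set"
  assume "\<forall>n. rel_ideal R (adjoin R B t) (A n)" and "\<forall>n. A n \<subseteq> A (Suc n)"
  then have id: "\<And>n. rel_ideal R (adjoin R B t) (A n)" and up: "\<And>m n. m \<le> n \<Longrightarrow> A m \<subseteq> A n"
    using chain_mono[of A] by auto
  let ?L = "\<lambda>n k. leading R B t (A k) n"
  have mono: "?L m k \<subseteq> ?L n l" if "m \<le> n" "k \<le> l" for m n k l
  proof -
    have "?L m k \<subseteq> ?L n k" using chain_mono[of "\<lambda>n. ?L n k", OF leading_Suc[OF id]] that by blast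
    also have "\<dots> \<subseteq> ?L n l" using up[OF that(2)] by (auto simp: leading_def)
    finally show ?thesis .
  qed
  \<comment> \<open>The diagonal chain takes care of all degrees above \<open>N\<close> at once. The
    finitely many degrees up to \<open>N\<close> get their own bounds \<open>K n\<close>, and
    \<open>M\<close> is the maximum of all of these.\<close>
  obtain N where N: "\<And>n. N \<le> n \<Longrightarrow> ?L n n = ?L N N"
    by (rule accD[OF acc rel_ideal_leading[OF id], of "\<lambda>n. n" "\<lambda>n. n"]) (rule mono, simp_all, blast)
  have "\<exists>K. \<forall>k\<ge>K. ?L n k = ?L n K" for n
    by (rule accD[OF acc rel_ideal_leading[OF id], of "\<lambda>k. k" "\<lambda>_. n"]) (rule mono, simp_all, blast)
  then obtain K where K: "\<And>n k. K n \<le> k \<Longrightarrow> ?L n k = ?L n (K n)" by metis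
  define M where "M = Max (insert N (K ` {..N}))"
  have MN: "N \<le> M" and MK: "\<And>n. n \<le> N \<Longrightarrow> K n \<le> M"
    unfolding M_def by (intro Max_ge; auto)+
  have "A k = A M" if "M \<le> k" for k
  proof (rule rel_ideal_eq_if_leading_eq[symmetric, OF id id up[OF that]])
    fix n
    show "?L n k \<subseteq> ?L n M"
    proof (cases "n \<le> N")
      case True
      then show ?thesis using K[of n k] K[of n M] MK[OF True] that by simp
    next
      case False
      \<comment> \<open>In degrees above \<open>N\<close> both sides are squeezed against the stable
        value \<open>?L N N\<close> of the diagonal.\<close>
      have "?L n k \<subseteq> ?L (max n k) (max n k)" by (rule mono) auto
      also have "\<dots> = ?L N N" using False by (intro N) auto
      also have "\<dots> \<subseteq> ?L n M" using False MN by (intro mono) auto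
      finally show ?thesis .
    qed
  qed
  then show "\<exists>N. \<forall>n\<ge>N. A n = A N" by blast
qed

end

end

section \<open>Graded modules\<close>

text \<open>Degrees are pairs of integers; quantifiers over degrees are to remain quantifiers over
  one variable.\<close>

declare split_paired_All [simp del] split_paired_Ex [simp del]

lemma (in abelian_group) a_kernel_iff:
  "v \<in> a_kernel G H h \<longleftrightarrow> v \<in> carrier G \<and> h v = \<zero>\<^bsub>H\<^esub>"
  by (simp add: a_kernel_def kernel_def)

lemma additive_zero:
  assumes "abelian_group M" "abelian_group N" "h \<in> carrier M \<rightarrow> carrier N"
    and "\<And>u v. u \<in> carrier M \<Longrightarrow> v \<in> carrier M \<Longrightarrow> h (u \<oplus>\<^bsub>M\<^esub> v) = h u \<oplus>\<^bsub>N\<^esub> h v"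
  shows "h \<zero>\<^bsub>M\<^esub> = \<zero>\<^bsub>N\<^esub>"
proof -
  interpret M: abelian_group M by fact
  interpret N: abelian_group N by fact
  have c: "h \<zero>\<^bsub>M\<^esub> \<in> carrier N" using assms(3) by auto
  have "h \<zero>\<^bsub>M\<^esub> = h \<zero>\<^bsub>M\<^esub> \<oplus>\<^bsub>N\<^esub> h \<zero>\<^bsub>M\<^esub>" using assms(4)[of "\<zero>\<^bsub>M\<^esub>" "\<zero>\<^bsub>M\<^esub>"] by simp
  then show ?thesis using c N.add.r_cancel_one' by metis
qed

lemma additive_finsum:
  assumes "abelian_group M" "abelian_group N" "h \<in> carrier M \<rightarrow> carrier N"
    and "\<And>u v. u \<in> carrier M \<Longrightarrow> v \<in> carrier M \<Longrightarrow> h (u \<oplus>\<^bsub>M\<^esub> v) = h u \<oplus>\<^bsub>N\<^esub> h v"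
    and "finite A" "u \<in> A \<rightarrow> carrier M"
  shows "h (finsum M u A) = finsum N (\<lambda>c. h (u c)) A"
proof -
  interpret M: abelian_group M by fact
  interpret N: abelian_group N by fact
  show ?thesis using assms(5,6)
  proof (induct A)
    case empty
    then show ?case using additive_zero[OF assms(1-4)] by simp
  next
    case (insert c A)
    then have "(\<lambda>c. h (u c)) \<in> A \<rightarrow> carrier N" "h (u c) \<in> carrier N"
      using assms(3) by (auto simp: Pi_iff)
    with insert show ?case using assms(4) by (simp add: Pi_iff)
  qed
qed

definition homog_part :: "('r, 'm) gmodule \<Rightarrow> 'm \<Rightarrow> int \<times> int \<Rightarrow> 'm" where
  "homog_part M v = (THE u. (\<forall>c. u c \<in> grade M c) \<and> finite {c. u c \<noteq> \<zero>\<^bsub>M\<^esub>} \<and>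
        v = finsum M u {c. u c \<noteq> \<zero>\<^bsub>M\<^esub>})"

locale graded = fixes S :: "('r, 'r) gmodule" and M :: "('r, 'm) gmodule"
  assumes graded_module: "graded_module S M"

sublocale graded \<subseteq> module S M
  using graded_module by (simp add: graded_module_def)

context graded
begin

lemma grade_subgroup: "additive_subgroup (grade M c) M"
  using graded_module by (simp add: graded_module_def)

lemma grade_carrier: "v \<in> grade M c \<Longrightarrow> v \<in> carrier M"
  using additive_subgroup.a_Hcarr[OF grade_subgroup] .

lemma grade_zero [simp]: "\<zero>\<^bsub>M\<^esub> \<in> grade M c"
  using additive_subgroup.zero_closed[OF grade_subgroup] .

lemma grade_add: "u \<in> grade M c \<Longrightarrow> v \<in> grade M c \<Longrightarrow> u \<oplus>\<^bsub>M\<^esub> v \<in> grade M c"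
  using additive_subgroup.a_closed[OF grade_subgroup] .

lemma grade_uminus: "u \<in> grade M c \<Longrightarrow> \<ominus>\<^bsub>M\<^esub> u \<in> grade M c"
  by (rule additive_subgroup.a_inv_closed[OF grade_subgroup])

lemma grade_minus: "u \<in> grade M c \<Longrightarrow> v \<in> grade M c \<Longrightarrow> u \<ominus>\<^bsub>M\<^esub> v \<in> grade M c"
  by (simp add: a_minus_def grade_add grade_uminus)

lemma grade_smult: "a \<in> grade S b \<Longrightarrow> v \<in> grade M c \<Longrightarrow> a \<odot>\<^bsub>M\<^esub> v \<in> grade M (b + c)"
  using graded_module by (simp add: graded_module_def)

lemma homog_part_ex1:
  assumes "v \<in> carrier M"
  shows "\<exists>!u. (\<forall>c. u c \<in> grade M c) \<and> finite {c. u c \<noteq> \<zero>\<^bsub>M\<^esub>} \<and>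
        v = finsum M u {c. u c \<noteq> \<zero>\<^bsub>M\<^esub>}"
  using graded_module assms by (simp add: graded_module_def)

lemma homog_part_props:
  assumes "v \<in> carrier M"
  shows homog_part_grade: "homog_part M v c \<in> grade M c"
    and homog_part_finite: "finite {c. homog_part M v c \<noteq> \<zero>\<^bsub>M\<^esub>}"
    and homog_part_sum: "finsum M (homog_part M v) {c. homog_part M v c \<noteq> \<zero>\<^bsub>M\<^esub>} = v"
  using theI'[OF homog_part_ex1[OF assms]] by (auto simp: homog_part_def)

lemma homog_part_carrier [simp]: "v \<in> carrier M \<Longrightarrow> homog_part M v c \<in> carrier M"
  by (rule grade_carrier[OF homog_part_grade])

text \<open>The decomposition in \<open>graded_module\<close> is summed over the exact support of
  the family. Any finite set containing the support will do, which spares computing supports after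
  adding or reindexing families.\<close>

lemma homog_part_eqI:
  assumes "\<And>c. u c \<in> grade M c" "finite A" "\<And>c. c \<notin> A \<Longrightarrow> u c = \<zero>\<^bsub>M\<^esub>" "v = finsum M u A"
  shows "homog_part M v = u"
proof -
  have sub: "{c. u c \<noteq> \<zero>\<^bsub>M\<^esub>} \<subseteq> A" using assms(3) by auto
  have u: "u \<in> B \<rightarrow> carrier M" for B
    by (simp add: Pi_iff grade_carrier[OF assms(1)])
  have "finsum M u A = finsum M u {c. u c \<noteq> \<zero>\<^bsub>M\<^esub>}"
    by (rule M.add.finprod_mono_neutral_cong_right) (use assms sub u in auto)
  with assms sub have "(\<forall>c. u c \<in> grade M c) \<and> finite {c. u c \<noteq> \<zero>\<^bsub>M\<^esub>} \<and>
        v = finsum M u {c. u c \<noteq> \<zero>\<^bsub>M\<^esub>}" using finite_subset by metis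
  moreover have "v \<in> carrier M" using assms(4) u[of A] by simp
  ultimately show ?thesis unfolding homog_part_def
    by (intro the1_equality[OF homog_part_ex1])
qed

lemma homog_part_homog:
  assumes "v \<in> grade M c"
  shows "homog_part M v c = v"
proof -
  have "homog_part M v = (\<lambda>b. if b = c then v else \<zero>\<^bsub>M\<^esub>)"
    by (rule homog_part_eqI[where A = "{c}"]) (simp_all add: assms grade_carrier[OF assms])
  then show ?thesis by simp
qed

lemma homog_part_add:
  assumes "u \<in> carrier M" "v \<in> carrier M"
  shows "homog_part M (u \<oplus>\<^bsub>M\<^esub> v) c = homog_part M u c \<oplus>\<^bsub>M\<^esub> homog_part M v c"
proof -
  note g = homog_part_grade[OF assms(1)] homog_part_grade[OF assms(2)]
  note fin = homog_part_finite[OF assms(1)] homog_part_finite[OF assms(2)]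
  let ?A = "{c. homog_part M u c \<noteq> \<zero>\<^bsub>M\<^esub>} \<union> {c. homog_part M v c \<noteq> \<zero>\<^bsub>M\<^esub>}"
  have s: "finsum M (homog_part M x) ?A = x" if "x \<in> {u, v}" for x
  proof -
    have x: "x \<in> carrier M" using that assms by auto
    have "finsum M (homog_part M x) ?A = finsum M (homog_part M x) {c. homog_part M x c \<noteq> \<zero>\<^bsub>M\<^esub>}"
      by (rule M.add.finprod_mono_neutral_cong_right) (use that fin x in \<open>simp_all add: Pi_iff, blast+\<close>)
    then show ?thesis using homog_part_sum[OF x] by simp
  qed
  have "homog_part M (u \<oplus>\<^bsub>M\<^esub> v) = (\<lambda>c. homog_part M u c \<oplus>\<^bsub>M\<^esub> homog_part M v c)"
  proof (rule homog_part_eqI[where A = ?A])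
    show "u \<oplus>\<^bsub>M\<^esub> v = finsum M (\<lambda>c. homog_part M u c \<oplus>\<^bsub>M\<^esub> homog_part M v c) ?A"
      using assms by (subst M.finsum_addf) (simp_all add: s Pi_iff)
  qed (use fin g grade_add in simp_all)
  then show ?thesis by simp
qed

text \<open>Applying an additive map of degree \<open>b\<close> to the decomposition of
  \<open>v\<close> gives a decomposition of the image, and decompositions are unique. The cases of
  interest are \<epsilon> and the differentials, with \<open>b = 0\<close>, and multiplication by a
  homogeneous ring element.\<close>

lemma homog_part_map:
  assumes N: "graded S N" and h: "h \<in> carrier M \<rightarrow> carrier N"
    and add: "\<And>u v. u \<in> carrier M \<Longrightarrow> v \<in> carrier M \<Longrightarrow> h (u \<oplus>\<^bsub>M\<^esub> v) = h u \<oplus>\<^bsub>N\<^esub> h v"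
    and deg: "\<And>c u. u \<in> grade M c \<Longrightarrow> h u \<in> grade N (b + c)" and v: "v \<in> carrier M"
  shows "homog_part N (h v) (b + c) = h (homog_part M v c)"
proof -
  interpret N: graded S N by fact
  let ?A = "{c. homog_part M v c \<noteq> \<zero>\<^bsub>M\<^esub>}"
  let ?u = "\<lambda>c. h (homog_part M v (c - b))"
  have h0: "h \<zero>\<^bsub>M\<^esub> = \<zero>\<^bsub>N\<^esub>"
    using additive_zero[OF M.abelian_group_axioms N.M.abelian_group_axioms h add] .
  have g: "?u c \<in> grade N c" for c
    using deg[OF homog_part_grade[OF v], of "c - b"] by simp
  have "homog_part N (h v) = ?u"
  proof (rule N.homog_part_eqI[where A = "(+) b ` ?A"])
    have "h v = finsum N (\<lambda>c. h (homog_part M v c)) ?A"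
      using additive_finsum[OF M.abelian_group_axioms N.M.abelian_group_axioms h add
          homog_part_finite[OF v], of "homog_part M v"] v
      by (simp add: homog_part_sum[OF v] Pi_iff)
    also have "\<dots> = finsum N ?u ((+) b ` ?A)"
      by (subst N.M.finsum_reindex) (simp_all add: Pi_iff N.grade_carrier[OF g] funcset_mem[OF h] v)
    finally show "h v = finsum N ?u ((+) b ` ?A)" .
  next
    fix c assume "c \<notin> (+) b ` ?A"
    then have "homog_part M v (c - b) = \<zero>\<^bsub>M\<^esub>"
      by (metis (mono_tags, lifting) add_diff_cancel_left' diff_add_cancel add.commute image_eqI mem_Collect_eq)
    then show "?u c = \<zero>\<^bsub>N\<^esub>" using h0 by simp
  qed (use g homog_part_finite[OF v] in simp_all)
  then show ?thesis by simp
qed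

text \<open>The shifted graded module usually written U(s). Graded injectivity speaks of
  degree-preserving maps only, so a map of another degree has to be made degree-preserving by
  shifting its source.\<close>

definition shifted_sub :: "'m set \<Rightarrow> int \<times> int \<Rightarrow> ('r, 'm) gmodule" where
  "shifted_sub U s = M\<lparr>carrier := U, grade := \<lambda>c. grade M (c + s) \<inter> U\<rparr>"

lemma shifted_sub_simps [simp]:
  "carrier (shifted_sub U s) = U" "zero (shifted_sub U s) = zero M" "add (shifted_sub U s) = add M"
  "smult (shifted_sub U s) = smult M" "grade (shifted_sub U s) c = grade M (c + s) \<inter> U"
  by (simp_all add: shifted_sub_def)

text \<open>A submodule is graded as soon as it contains the homogeneous parts of its elements:
  existence and uniqueness of decompositions are then inherited from \<open>M\<close>, and the shift
  only reindexes them.\<close>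

lemma graded_shifted_sub:
  assumes U: "U \<subseteq> carrier M" "\<zero>\<^bsub>M\<^esub> \<in> U"
    "\<And>u v. u \<in> U \<Longrightarrow> v \<in> U \<Longrightarrow> u \<oplus>\<^bsub>M\<^esub> v \<in> U"
    "\<And>a v. a \<in> carrier S \<Longrightarrow> v \<in> U \<Longrightarrow> a \<odot>\<^bsub>M\<^esub> v \<in> U"
    and S: "\<And>a b. a \<in> grade S b \<Longrightarrow> a \<in> carrier S"
    and parts: "\<And>v c. v \<in> U \<Longrightarrow> homog_part M v c \<in> U"
  shows "graded_module S (shifted_sub U s)"
proof -
  let ?T = "shifted_sub U s"
  have neg: "\<ominus>\<^bsub>M\<^esub> v \<in> U" if "v \<in> U" for v
  proof -
    have "(\<ominus>\<^bsub>S\<^esub> \<one>\<^bsub>S\<^esub>) \<odot>\<^bsub>M\<^esub> v \<in> U" using U(4) that by simp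
    then show ?thesis using U(1) that smult_l_minus[of "\<one>\<^bsub>S\<^esub>" v] by (simp add: subset_iff)
  qed
  have mem: "u \<in> U \<Longrightarrow> u \<in> carrier M" for u using U(1) by blast
  have T: "abelian_group ?T"
  proof (rule abelian_groupI)
    fix v assume "v \<in> carrier ?T"
    then show "\<exists>y\<in>carrier ?T. y \<oplus>\<^bsub>?T\<^esub> v = \<zero>\<^bsub>?T\<^esub>"
      using neg mem M.l_neg by (intro bexI[of _ "\<ominus>\<^bsub>M\<^esub> v"]) simp_all
  qed (simp_all add: U mem M.a_assoc, simp add: mem M.a_comm)
  interpret T: abelian_group ?T by (rule T)
  have "module S ?T"
    by (rule moduleI) (use T U(4) mem in \<open>simp_all add: smult_l_distr smult_r_distr smult_assoc1 R.is_cring\<close>)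
  \<comment> \<open>The identity is an additive map from the submodule to \<open>M\<close>, hence
    finite sums agree.\<close>
  have fs: "finsum ?T u A = finsum M u A" if "finite A" "u \<in> A \<rightarrow> U" for u and A :: "(int \<times> int) set"
    using additive_finsum[OF T M.abelian_group_axioms, of id, OF _ _ that(1), of u] that(2) U(1)
    by (simp add: Pi_iff subset_iff)
  show ?thesis unfolding graded_module_def
  proof (intro conjI allI ballI)
    show "module S ?T" by fact
    show "additive_subgroup (grade ?T c) ?T" for c
    proof (rule additive_subgroup.intro, rule T.add.subgroupI)
      show "grade ?T c \<noteq> {}" using U(2) grade_zero[of "c + s"] by (simp del: grade_zero) blast
    next
      fix u assume "u \<in> grade ?T c"
      then have u: "u \<in> U" "u \<in> grade M (c + s)" by auto
      have "\<ominus>\<^bsub>?T\<^esub> u = \<ominus>\<^bsub>M\<^esub> u"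
        by (rule T.minus_equality) (use u neg mem M.l_neg in auto)
      then show "\<ominus>\<^bsub>?T\<^esub> u \<in> grade ?T c" using u neg grade_uminus by simp
    qed (simp_all add: U grade_add)
    fix v assume "v \<in> carrier ?T"
    then have v: "v \<in> U" "v \<in> carrier M" using U(1) by auto
    show "\<exists>!u. (\<forall>c. u c \<in> grade ?T c) \<and> finite {c. u c \<noteq> \<zero>\<^bsub>?T\<^esub>} \<and> v = finsum ?T u {c. u c \<noteq> \<zero>\<^bsub>?T\<^esub>}"
    proof (rule ex1I[where a = "\<lambda>c. homog_part M v (c + s)"])
      let ?A = "{c. homog_part M v c \<noteq> \<zero>\<^bsub>M\<^esub>}" and ?B = "{c. homog_part M v (c + s) \<noteq> \<zero>\<^bsub>M\<^esub>}"
      have AB: "?A = (\<lambda>c. c + s) ` ?B"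
      proof (intro equalityI subsetI)
        fix c assume "c \<in> ?A"
        then have "c - s \<in> ?B" by simp
        then show "c \<in> (\<lambda>c. c + s) ` ?B" using image_eqI[of c "\<lambda>c. c + s" "c - s" ?B] by simp
      qed (elim imageE, simp)
      then have fin: "finite ?B"
        using homog_part_finite[OF v(2)] by (simp add: finite_image_iff inj_on_def)
      have "v = finsum M (homog_part M v) ((\<lambda>c. c + s) ` ?B)"
        using homog_part_sum[OF v(2)] AB by simp
      also have "\<dots> = finsum M (\<lambda>c. homog_part M v (c + s)) ?B"
        by (subst M.finsum_reindex) (simp_all add: Pi_iff v inj_on_def)
      also have "\<dots> = finsum ?T (\<lambda>c. homog_part M v (c + s)) ?B"
        using fs[OF fin] parts[OF v(1)] by simp
      finally show "(\<forall>c. homog_part M v (c + s) \<in> grade ?T c) \<and>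
        finite {c. homog_part M v (c + s) \<noteq> \<zero>\<^bsub>?T\<^esub>} \<and>
        v = finsum ?T (\<lambda>c. homog_part M v (c + s)) {c. homog_part M v (c + s) \<noteq> \<zero>\<^bsub>?T\<^esub>}"
        using fin parts[OF v(1)] homog_part_grade[OF v(2)] by simp
    next
      fix u
      assume u: "(\<forall>c. u c \<in> grade ?T c) \<and> finite {c. u c \<noteq> \<zero>\<^bsub>?T\<^esub>} \<and> v = finsum ?T u {c. u c \<noteq> \<zero>\<^bsub>?T\<^esub>}"
      let ?B = "{c. u c \<noteq> \<zero>\<^bsub>M\<^esub>}"
      have uU: "u c \<in> U" "u c \<in> grade M (c + s)" for c using u by simp_all
      have fin: "finite ?B" using u by simp
      \<comment> \<open>Uniqueness: with the shift undone, \<open>u\<close> is a decomposition of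
        \<open>v\<close> in \<open>M\<close>.\<close>
      have "homog_part M v = (\<lambda>c. u (c - s))"
      proof (rule homog_part_eqI[where A = "(\<lambda>c. c + s) ` ?B"])
        have "v = finsum M u ?B" using u fs[OF fin, of u] uU by simp
        also have "\<dots> = finsum M (\<lambda>c. u (c - s)) ((\<lambda>c. c + s) ` ?B)"
          by (subst M.finsum_reindex) (simp_all add: Pi_iff mem[OF uU(1)] inj_on_def)
        finally show "v = \<dots>" .
        show "u (c - s) \<in> grade M c" for c using uU(2)[of "c - s"] by simp
        show "u (c - s) = \<zero>\<^bsub>M\<^esub>" if "c \<notin> (\<lambda>c. c + s) ` ?B" for c
        proof (rule ccontr)
          assume "u (c - s) \<noteq> \<zero>\<^bsub>M\<^esub>"
          then have "c - s \<in> ?B" by simp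
          then show False using that image_eqI[of c "\<lambda>c. c + s" "c - s" ?B] by simp
        qed
      qed (rule finite_imageI, rule fin)
      then show "u = (\<lambda>c. homog_part M v (c + s))" by simp
    qed
  next
    fix b c a v assume "a \<in> grade S b" "v \<in> grade ?T c"
    then show "a \<odot>\<^bsub>?T\<^esub> v \<in> grade ?T (b + c)"
      using grade_smult[of a b v "c + s"] U(4)[OF S[of a b], of v] by (simp add: add.assoc)
  qed
qed

end

section \<open>Graded injective resolutions\<close>

definition scale :: "nat \<Rightarrow> int \<times> int \<Rightarrow> int \<times> int" where
  "scale n c = (int n * fst c, int n * snd c)"

lemma scale_0 [simp]: "scale 0 c = 0" and scale_Suc: "scale (Suc n) c = scale n c + c"
  and scale_add: "scale (m + n) c = scale m c + scale n c"
  by (simp_all add: scale_def prod_eq_iff algebra_simps)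

locale graded_ring = graded S S for S :: "('r, 'r) gmodule" +
  assumes smult_eq_mult: "smult S = monoid.mult S" and one_grade: "\<one>\<^bsub>S\<^esub> \<in> grade S 0"

context graded_ring
begin

lemma mult_grade: "a \<in> grade S b \<Longrightarrow> v \<in> grade S c \<Longrightarrow> a \<otimes>\<^bsub>S\<^esub> v \<in> grade S (b + c)"
  using grade_smult by (simp add: smult_eq_mult)

lemma pow_grade: "h \<in> grade S b \<Longrightarrow> h [^]\<^bsub>S\<^esub> (n::nat) \<in> grade S (scale n b)"
  by (induct n) (simp_all add: one_grade mult_grade scale_Suc)

end

locale graded_resolution = graded_ring S for S :: "('r, 'r) gmodule" +
  fixes E :: "nat \<Rightarrow> ('r, 'e) gmodule" and \<epsilon> d
  assumes res: "graded_injective_resolution S S E \<epsilon> d"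
    and acc: "acc S (carrier S)"

sublocale graded_resolution \<subseteq> E: graded S "E n" for n
  using res by unfold_locales (simp add: graded_injective_resolution_def graded_injective_def)

context graded_resolution
begin

lemma eps_hom: "\<epsilon> \<in> graded_hom S S (E 0)"
  using res by (simp add: graded_injective_resolution_def)

lemma eps_closed [simp]: "a \<in> carrier S \<Longrightarrow> \<epsilon> a \<in> carrier (E 0)"
  and eps_add: "a \<in> carrier S \<Longrightarrow> b \<in> carrier S \<Longrightarrow> \<epsilon> (a \<oplus>\<^bsub>S\<^esub> b) = \<epsilon> a \<oplus>\<^bsub>E 0\<^esub> \<epsilon> b"
  and eps_mult: "a \<in> carrier S \<Longrightarrow> b \<in> carrier S \<Longrightarrow> \<epsilon> (a \<otimes>\<^bsub>S\<^esub> b) = a \<odot>\<^bsub>E 0\<^esub> \<epsilon> b"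
  using eps_hom by (auto simp: graded_hom_def module_hom_def smult_eq_mult)

lemma eps_grade: "a \<in> grade S c \<Longrightarrow> \<epsilon> a \<in> grade (E 0) c"
  using eps_hom unfolding graded_hom_def by blast

lemma eps_inj: "a \<in> carrier S \<Longrightarrow> b \<in> carrier S \<Longrightarrow> \<epsilon> a = \<epsilon> b \<Longrightarrow> a = b"
  using res by (simp add: graded_injective_resolution_def inj_on_def)

lemma eps_zero [simp]: "\<epsilon> \<zero>\<^bsub>S\<^esub> = \<zero>\<^bsub>E 0\<^esub>"
  by (rule additive_zero[OF R.abelian_group_axioms E.M.abelian_group_axioms])
    (simp_all add: eps_add)

lemma d_hom: "d n \<in> graded_hom S (E n) (E (Suc n))"
  using res by (simp add: graded_injective_resolution_def)

lemma d_closed [simp]: "v \<in> carrier (E n) \<Longrightarrow> d n v \<in> carrier (E (Suc n))"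
  and d_add: "u \<in> carrier (E n) \<Longrightarrow> v \<in> carrier (E n) \<Longrightarrow> d n (u \<oplus>\<^bsub>E n\<^esub> v) = d n u \<oplus>\<^bsub>E (Suc n)\<^esub> d n v"
  and d_smult: "a \<in> carrier S \<Longrightarrow> v \<in> carrier (E n) \<Longrightarrow> d n (a \<odot>\<^bsub>E n\<^esub> v) = a \<odot>\<^bsub>E (Suc n)\<^esub> d n v"
  using d_hom[of n] by (auto simp: graded_hom_def module_hom_def)

lemma d_grade: "a \<in> grade (E n) c \<Longrightarrow> d n a \<in> grade (E (Suc n)) c"
  using d_hom[of n] unfolding graded_hom_def by blast

lemma d_zero [simp]: "d n \<zero>\<^bsub>E n\<^esub> = \<zero>\<^bsub>E (Suc n)\<^esub>"
  by (rule additive_zero[OF E.M.abelian_group_axioms E.M.abelian_group_axioms])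
    (simp_all add: d_add)

lemma d_uminus: "v \<in> carrier (E n) \<Longrightarrow> d n (\<ominus>\<^bsub>E n\<^esub> v) = \<ominus>\<^bsub>E (Suc n)\<^esub> d n v"
  by (metis E.M.a_inv_closed E.M.l_neg E.M.minus_equality d_add d_closed d_zero)

lemma d_eps [simp]: "a \<in> carrier S \<Longrightarrow> d 0 (\<epsilon> a) = \<zero>\<^bsub>E (Suc 0)\<^esub>"
  using res E.M.a_kernel_iff unfolding graded_injective_resolution_def by (metis One_nat_def imageI)

lemma d_d [simp]: "v \<in> carrier (E n) \<Longrightarrow> d (Suc n) (d n v) = \<zero>\<^bsub>E (Suc (Suc n))\<^esub>"
  using res E.M.a_kernel_iff unfolding graded_injective_resolution_def by (metis imageI)

text \<open>Exactness yields a preimage without control of degrees. Its part of degree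
  \<open>c\<close> is again a preimage, because \<epsilon> commutes with taking parts.\<close>

lemma exact_0:
  assumes v: "v \<in> grade (E 0) c" and "d 0 v = \<zero>\<^bsub>E (Suc 0)\<^esub>"
  shows "\<exists>a\<in>grade S c. v = \<epsilon> a"
proof -
  have "v \<in> a_kernel (E 0) (E 1) (d 0)" using assms E.grade_carrier by (simp add: E.M.a_kernel_iff)
  then obtain a where a: "a \<in> carrier S" "v = \<epsilon> a"
    using res unfolding graded_injective_resolution_def by blast
  have "homog_part (E 0) (\<epsilon> a) (0 + c) = \<epsilon> (homog_part S a c)"
    by (rule homog_part_map) (simp_all add: a eps_add eps_grade E.graded_axioms)
  then have "v = \<epsilon> (homog_part S a c)" using E.homog_part_homog[OF v] a by simp
  then show ?thesis using homog_part_grade[OF a(1)] by blast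
qed

lemma exact_Suc:
  assumes v: "v \<in> grade (E (Suc n)) c" and "d (Suc n) v = \<zero>\<^bsub>E (Suc (Suc n))\<^esub>"
  shows "\<exists>u\<in>grade (E n) c. v = d n u"
proof -
  have "v \<in> a_kernel (E (Suc n)) (E (Suc (Suc n))) (d (Suc n))"
    using assms E.grade_carrier by (simp add: E.M.a_kernel_iff)
  then obtain a where a: "a \<in> carrier (E n)" "v = d n a"
    using res unfolding graded_injective_resolution_def by blast
  have "homog_part (E (Suc n)) (d n a) (0 + c) = d n (homog_part (E n) a c)"
    by (rule E.homog_part_map) (simp_all add: a d_add d_grade E.graded_axioms)
  then have "v = d n (homog_part (E n) a c)" using E.homog_part_homog[OF v] a by simp
  then show ?thesis using E.homog_part_grade[OF a(1)] by blast
qed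

text \<open>Baer's criterion for the homogeneous ideal \<open>(p, q)\<close>. The test modules must have elements in the
  type of the resolution, so they are the images of \<open>(p, q)\<close> and \<open>S\<close> under \<open>\<epsilon>\<close>, with the grading
  shifted by \<open>c\<close>.\<close>

lemma graded_baer:
  assumes p: "p \<in> grade S b1" and q: "q \<in> grade S b2"
    and v1: "v1 \<in> grade (E n) (b1 + c)" and v2: "v2 \<in> grade (E n) (b2 + c)"
    and rel: "\<And>a b. a \<in> carrier S \<Longrightarrow> b \<in> carrier S \<Longrightarrow> p \<otimes>\<^bsub>S\<^esub> a \<oplus>\<^bsub>S\<^esub> q \<otimes>\<^bsub>S\<^esub> b = \<zero>\<^bsub>S\<^esub> \<Longrightarrow>
      a \<odot>\<^bsub>E n\<^esub> v1 \<oplus>\<^bsub>E n\<^esub> b \<odot>\<^bsub>E n\<^esub> v2 = \<zero>\<^bsub>E n\<^esub>"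
  obtains v where "v \<in> grade (E n) c" "p \<odot>\<^bsub>E n\<^esub> v = v1" "q \<odot>\<^bsub>E n\<^esub> v = v2"
proof -
  note [simp] = grade_carrier[OF p] grade_carrier[OF q] E.grade_carrier[OF v1] E.grade_carrier[OF v2]
  define l where "l a b = p \<otimes>\<^bsub>S\<^esub> a \<oplus>\<^bsub>S\<^esub> q \<otimes>\<^bsub>S\<^esub> b" for a b
  define m where "m a b = a \<odot>\<^bsub>E n\<^esub> v1 \<oplus>\<^bsub>E n\<^esub> b \<odot>\<^bsub>E n\<^esub> v2" for a b
  let ?S = "carrier S"
  have l_cl [simp]: "a \<in> ?S \<Longrightarrow> b \<in> ?S \<Longrightarrow> l a b \<in> ?S" for a b by (simp add: l_def)
  have m_cl [simp]: "a \<in> ?S \<Longrightarrow> b \<in> ?S \<Longrightarrow> m a b \<in> carrier (E n)" for a b by (simp add: m_def)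
  have l_add: "l a b \<oplus>\<^bsub>S\<^esub> l a' b' = l (a \<oplus>\<^bsub>S\<^esub> a') (b \<oplus>\<^bsub>S\<^esub> b')"
    if "a \<in> ?S" "b \<in> ?S" "a' \<in> ?S" "b' \<in> ?S" for a b a' b'
    using that by (simp add: l_def R.r_distr R.a_ac)
  have m_add: "m a b \<oplus>\<^bsub>E n\<^esub> m a' b' = m (a \<oplus>\<^bsub>S\<^esub> a') (b \<oplus>\<^bsub>S\<^esub> b')"
    if "a \<in> ?S" "b \<in> ?S" "a' \<in> ?S" "b' \<in> ?S" for a b a' b'
    using that by (simp add: m_def E.smult_l_distr E.M.a_ac)
  have l_mult: "t \<otimes>\<^bsub>S\<^esub> l a b = l (t \<otimes>\<^bsub>S\<^esub> a) (t \<otimes>\<^bsub>S\<^esub> b)" if "a \<in> ?S" "b \<in> ?S" "t \<in> ?S" for t a b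
    using that by (simp add: l_def R.r_distr R.m_ac)
  have m_mult: "t \<odot>\<^bsub>E n\<^esub> m a b = m (t \<otimes>\<^bsub>S\<^esub> a) (t \<otimes>\<^bsub>S\<^esub> b)" if "a \<in> ?S" "b \<in> ?S" "t \<in> ?S" for t a b
    using that by (simp add: m_def E.smult_r_distr E.smult_assoc1)
  have l_part: "homog_part S (l a b) e = l (homog_part S a (e - b1)) (homog_part S b (e - b2))"
    if "a \<in> ?S" "b \<in> ?S" for a b e
  proof -
    have "homog_part S (h \<otimes>\<^bsub>S\<^esub> a) (b' + (e - b')) = h \<otimes>\<^bsub>S\<^esub> homog_part S a (e - b')"
      if "h \<in> grade S b'" "a \<in> ?S" for h a b'
      by (rule homog_part_map) (use that in \<open>simp_all add: R.r_distr mult_grade grade_carrier graded_axioms\<close>)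
    from this[OF p that(1)] this[OF q that(2)] show ?thesis
      using that by (simp add: l_def homog_part_add)
  qed
  have l_grade: "l a b \<in> grade S e" if "a \<in> grade S (e - b1)" "b \<in> grade S (e - b2)" for a b e
    using mult_grade[OF p that(1)] mult_grade[OF q that(2)] by (simp add: l_def grade_add)
  have m_grade: "m a b \<in> grade (E n) (e + c)" if "a \<in> grade S (e - b1)" "b \<in> grade S (e - b2)" for a b e
    using E.grade_smult[OF that(1) v1] E.grade_smult[OF that(2) v2]
    by (simp add: m_def E.grade_add algebra_simps)
  \<comment> \<open>Two ways of writing an element of the ideal differ by a relation between
    \<open>p\<close> and \<open>q\<close>, and \<open>rel\<close> makes the prescribed value vanish
    on relations.\<close>
  have wd: "m a b = m a' b'" if "l a b = l a' b'" "a \<in> ?S" "b \<in> ?S" "a' \<in> ?S" "b' \<in> ?S" for a b a' b'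
  proof -
    have "l (a \<oplus>\<^bsub>S\<^esub> \<ominus>\<^bsub>S\<^esub> a') (b \<oplus>\<^bsub>S\<^esub> \<ominus>\<^bsub>S\<^esub> b') \<oplus>\<^bsub>S\<^esub> l a' b' = l a b"
      using that by (subst l_add) (simp_all add: R.a_assoc R.l_neg)
    then have "l (a \<oplus>\<^bsub>S\<^esub> \<ominus>\<^bsub>S\<^esub> a') (b \<oplus>\<^bsub>S\<^esub> \<ominus>\<^bsub>S\<^esub> b') = \<zero>\<^bsub>S\<^esub>"
      using that by (metis l_cl R.a_inv_closed R.a_closed R.add.r_cancel_one)
    then have "m (a \<oplus>\<^bsub>S\<^esub> \<ominus>\<^bsub>S\<^esub> a') (b \<oplus>\<^bsub>S\<^esub> \<ominus>\<^bsub>S\<^esub> b') = \<zero>\<^bsub>E n\<^esub>"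
      using rel that unfolding l_def m_def by simp
    moreover have "m (a \<oplus>\<^bsub>S\<^esub> \<ominus>\<^bsub>S\<^esub> a') (b \<oplus>\<^bsub>S\<^esub> \<ominus>\<^bsub>S\<^esub> b') \<oplus>\<^bsub>E n\<^esub> m a' b' = m a b"
      using that by (subst m_add) (simp_all add: R.a_assoc R.l_neg)
    ultimately show ?thesis using that by simp
  qed
  define U where "U = {\<epsilon> (l a b) |a b. a \<in> ?S \<and> b \<in> ?S}"
  define \<phi> where "\<phi> u = (THE t. \<exists>a\<in>?S. \<exists>b\<in>?S. u = \<epsilon> (l a b) \<and> t = m a b)" for u
  have \<phi>: "\<phi> (\<epsilon> (l a b)) = m a b" if ab: "a \<in> ?S" "b \<in> ?S" for a b
    unfolding \<phi>_def
  proof (rule the_equality)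
    show "\<exists>a'\<in>?S. \<exists>b'\<in>?S. \<epsilon> (l a b) = \<epsilon> (l a' b') \<and> m a b = m a' b'" using ab by blast
    fix t assume "\<exists>a'\<in>?S. \<exists>b'\<in>?S. \<epsilon> (l a b) = \<epsilon> (l a' b') \<and> t = m a' b'"
    then obtain a' b' where "a' \<in> ?S" "b' \<in> ?S" "\<epsilon> (l a b) = \<epsilon> (l a' b')" "t = m a' b'" by blast
    then show "t = m a b" using wd[of a' b' a b] eps_inj[of "l a b" "l a' b'"] ab by simp
  qed
  have eps_part: "homog_part (E 0) (\<epsilon> a) e = \<epsilon> (homog_part S a e)" if "a \<in> ?S" for a e
    using homog_part_map[OF E.graded_axioms, of \<epsilon> 0 0 a e] that by (simp add: eps_add eps_grade)
  \<comment> \<open>With the shift by \<open>- c\<close> the generator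
    \<open>\<epsilon> \<one>\<close> of \<open>?N\<close> has degree \<open>c\<close>. The image of
    \<open>p\<close> then has degree \<open>b1 + c\<close>, as \<open>v1\<close> has, so that \<phi>
    preserves degrees.\<close>
  let ?M = "E.shifted_sub 0 U (- c)" and ?N = "E.shifted_sub 0 (\<epsilon> ` ?S) (- c)"
  have "graded_module S ?M"
  proof (rule E.graded_shifted_sub)
    show "U \<subseteq> carrier (E 0)" by (auto simp: U_def)
    have "\<zero>\<^bsub>E 0\<^esub> = \<epsilon> (l \<zero>\<^bsub>S\<^esub> \<zero>\<^bsub>S\<^esub>)" by (simp add: l_def)
    then show "\<zero>\<^bsub>E 0\<^esub> \<in> U" unfolding U_def by blast
    show "u \<oplus>\<^bsub>E 0\<^esub> v \<in> U" if uv: "u \<in> U" "v \<in> U" for u v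
    proof -
      obtain a b a' b' where *: "u = \<epsilon> (l a b)" "v = \<epsilon> (l a' b')" "a \<in> ?S" "b \<in> ?S" "a' \<in> ?S" "b' \<in> ?S"
        using uv unfolding U_def by blast
      then have "u \<oplus>\<^bsub>E 0\<^esub> v = \<epsilon> (l (a \<oplus>\<^bsub>S\<^esub> a') (b \<oplus>\<^bsub>S\<^esub> b'))" by (simp flip: eps_add l_add)
      then show ?thesis using * unfolding U_def by blast
    qed
    show "t \<odot>\<^bsub>E 0\<^esub> u \<in> U" if tu: "t \<in> ?S" "u \<in> U" for t u
    proof -
      obtain a b where *: "u = \<epsilon> (l a b)" "a \<in> ?S" "b \<in> ?S" using tu unfolding U_def by blast
      then have "t \<odot>\<^bsub>E 0\<^esub> u = \<epsilon> (l (t \<otimes>\<^bsub>S\<^esub> a) (t \<otimes>\<^bsub>S\<^esub> b))" using tu by (simp flip: eps_mult l_mult)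
      then show ?thesis using * tu unfolding U_def by blast
    qed
    show "homog_part (E 0) u e \<in> U" if u: "u \<in> U" for u e
    proof -
      obtain a b where *: "u = \<epsilon> (l a b)" "a \<in> ?S" "b \<in> ?S" using u unfolding U_def by blast
      then have "homog_part (E 0) u e = \<epsilon> (l (homog_part S a (e - b1)) (homog_part S b (e - b2)))"
        by (simp add: eps_part l_part)
      moreover have "homog_part S a (e - b1) \<in> ?S" "homog_part S b (e - b2) \<in> ?S" using * by simp_all
      ultimately show ?thesis unfolding U_def by blast
    qed
  qed (rule grade_carrier)
  moreover have "graded_module S ?N"
  proof (rule E.graded_shifted_sub)
    show "\<epsilon> ` ?S \<subseteq> carrier (E 0)" by auto
    show "\<zero>\<^bsub>E 0\<^esub> \<in> \<epsilon> ` ?S" using eps_zero by (metis R.zero_closed imageI)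
    show "u \<oplus>\<^bsub>E 0\<^esub> v \<in> \<epsilon> ` ?S" if "u \<in> \<epsilon> ` ?S" "v \<in> \<epsilon> ` ?S" for u v
      using that by (elim imageE) (simp flip: eps_add)
    show "t \<odot>\<^bsub>E 0\<^esub> u \<in> \<epsilon> ` ?S" if "t \<in> ?S" "u \<in> \<epsilon> ` ?S" for t u
      using that by (elim imageE) (simp flip: eps_mult)
    show "homog_part (E 0) u e \<in> \<epsilon> ` ?S" if "u \<in> \<epsilon> ` ?S" for u e
      using that by (elim imageE) (simp add: eps_part)
  qed (rule grade_carrier)
  moreover have UN: "U \<subseteq> \<epsilon> ` ?S" by (auto simp: U_def)
  then have "id \<in> graded_hom S ?M ?N" by (auto simp: graded_hom_def module_hom_def)
  moreover have "\<phi> \<in> graded_hom S ?M (E n)"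
    unfolding graded_hom_def module_hom_def
  proof (intro CollectI conjI allI ballI funcsetI subsetI)
    fix u assume "u \<in> carrier ?M"
    then show "\<phi> u \<in> carrier (E n)" by (auto simp: U_def \<phi>)
  next
    fix u v assume "u \<in> carrier ?M" "v \<in> carrier ?M"
    then obtain a b a' b' where *: "u = \<epsilon> (l a b)" "v = \<epsilon> (l a' b')" "a \<in> ?S" "b \<in> ?S" "a' \<in> ?S" "b' \<in> ?S"
      unfolding U_def by auto
    then have "u \<oplus>\<^bsub>?M\<^esub> v = \<epsilon> (l (a \<oplus>\<^bsub>S\<^esub> a') (b \<oplus>\<^bsub>S\<^esub> b'))" by (simp flip: eps_add l_add)
    then show "\<phi> (u \<oplus>\<^bsub>?M\<^esub> v) = \<phi> u \<oplus>\<^bsub>E n\<^esub> \<phi> v" using * by (simp add: \<phi> m_add)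
  next
    fix t u assume t: "t \<in> ?S" and "u \<in> carrier ?M"
    then obtain a b where *: "u = \<epsilon> (l a b)" "a \<in> ?S" "b \<in> ?S"
      unfolding U_def by auto
    then have "t \<odot>\<^bsub>?M\<^esub> u = \<epsilon> (l (t \<otimes>\<^bsub>S\<^esub> a) (t \<otimes>\<^bsub>S\<^esub> b))" using t by (simp flip: eps_mult l_mult)
    then show "\<phi> (t \<odot>\<^bsub>?M\<^esub> u) = t \<odot>\<^bsub>E n\<^esub> \<phi> u" using * t by (simp add: \<phi> m_mult)
  next
    fix e t assume "t \<in> \<phi> ` grade ?M e"
    then obtain u where u: "t = \<phi> u" "u \<in> grade (E 0) (e - c)" "u \<in> U" by auto
    then obtain a b where *: "u = \<epsilon> (l a b)" "a \<in> ?S" "b \<in> ?S"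
      unfolding U_def by auto
    \<comment> \<open>The coefficients of a homogeneous element need not be homogeneous, but they
      may be replaced by their parts of the fitting degree.\<close>
    let ?a = "homog_part S a (e - c - b1)" and ?b = "homog_part S b (e - c - b2)"
    have "u = \<epsilon> (l ?a ?b)"
      using E.homog_part_homog[OF u(2)] * by (simp add: eps_part l_part)
    then have "t = m ?a ?b" using u(1) * by (simp add: \<phi>)
    then show "t \<in> grade (E n) e"
      using m_grade[OF homog_part_grade homog_part_grade, of a b "e - c"] * by simp
  qed
  moreover have "graded_injective S (E n)"
    using res by (simp add: graded_injective_resolution_def)
  ultimately obtain \<psi> where \<psi>: "\<psi> \<in> graded_hom S ?N (E n)" "\<And>u. u \<in> U \<Longrightarrow> \<psi> u = \<phi> u"
    unfolding graded_injective_def by (metis E.shifted_sub_simps(1) id_apply inj_on_id)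
  show ?thesis
  proof
    \<comment> \<open>The extension is multiplication by its value at the unit; its values at
      \<open>p\<close> and \<open>q\<close> are the prescribed ones.\<close>
    let ?v = "\<psi> (\<epsilon> \<one>\<^bsub>S\<^esub>)"
    have "\<epsilon> \<one>\<^bsub>S\<^esub> \<in> grade ?N c" using eps_grade[OF one_grade] by simp
    then show "?v \<in> grade (E n) c" using \<psi>(1) unfolding graded_hom_def by blast
    have lin: "\<psi> (\<epsilon> t) = t \<odot>\<^bsub>E n\<^esub> ?v" if "t \<in> ?S" for t
    proof -
      have "t \<odot>\<^bsub>?N\<^esub> \<epsilon> \<one>\<^bsub>S\<^esub> = \<epsilon> t" using that eps_mult[of t "\<one>\<^bsub>S\<^esub>"] by simp
      moreover have "\<psi> (t \<odot>\<^bsub>?N\<^esub> \<epsilon> \<one>\<^bsub>S\<^esub>) = t \<odot>\<^bsub>E n\<^esub> \<psi> (\<epsilon> \<one>\<^bsub>S\<^esub>)"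
        using \<psi>(1) that unfolding graded_hom_def module_hom_def by simp
      ultimately show ?thesis by simp
    qed
    have lm: "l a b \<odot>\<^bsub>E n\<^esub> ?v = m a b" if "a \<in> ?S" "b \<in> ?S" for a b
    proof -
      have "\<epsilon> (l a b) \<in> U" using that unfolding U_def by blast
      then show ?thesis using lin[of "l a b"] \<psi>(2) \<phi> that by simp
    qed
    show "p \<odot>\<^bsub>E n\<^esub> ?v = v1" using lm[of "\<one>\<^bsub>S\<^esub>" "\<zero>\<^bsub>S\<^esub>"] by (simp add: l_def m_def)
    show "q \<odot>\<^bsub>E n\<^esub> ?v = v2" using lm[of "\<zero>\<^bsub>S\<^esub>" "\<one>\<^bsub>S\<^esub>"] by (simp add: l_def m_def)
  qed
qed

end

section \<open>Divisibility and torsion in graded injective modules\<close>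

lemma (in abelian_group) add_minus_cancel:
  assumes "u \<in> carrier G" "v \<in> carrier G" shows "u \<oplus> (v \<ominus> u) = v"
  using assms by (metis a_comm a_inv_closed minus_eq r_neg1 r_neg2)

context graded_resolution
begin

text \<open>The annihilators of the powers of \<open>h\<close> stabilize, so for large m the
  equation h^(m+1) a = 0 implies h^m a = 0. Then h^(m+1) a \<mapsto> h^m a v is well defined on a
  principal ideal, and \<open>graded_baer\<close>, with zero as second generator, extends it to the
  ring.\<close>

lemma graded_divide:
  assumes h: "h \<in> grade S b" and v: "v \<in> grade (E n) (b + c)"
  obtains m u where "u \<in> grade (E n) c" "h [^]\<^bsub>S\<^esub> Suc m \<odot>\<^bsub>E n\<^esub> u = h [^]\<^bsub>S\<^esub> m \<odot>\<^bsub>E n\<^esub> v"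
proof -
  note [simp] = grade_carrier[OF h] E.grade_carrier[OF v]
  let ?A = "\<lambda>j::nat. {s \<in> carrier S. h [^]\<^bsub>S\<^esub> j \<otimes>\<^bsub>S\<^esub> s = \<zero>\<^bsub>S\<^esub>}"
  have "rel_ideal S (carrier S) (?A j)" for j
    by (auto simp: rel_ideal_def R.r_distr R.m_lcomm)
  moreover have "?A j \<subseteq> ?A (Suc j)" for j
  proof
    fix s assume "s \<in> ?A j"
    then show "s \<in> ?A (Suc j)" by (simp add: R.m_assoc R.m_lcomm[of _ h s])
  qed
  ultimately obtain N where N: "\<And>j. N \<le> j \<Longrightarrow> ?A j = ?A N" by (rule accD[OF acc]) blast
  have v1: "h [^]\<^bsub>S\<^esub> N \<odot>\<^bsub>E n\<^esub> v \<in> grade (E n) (scale (Suc N) b + c)"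
    using E.grade_smult[OF pow_grade[OF h] v, of N] by (simp add: scale_Suc add.assoc)
  obtain u where u: "u \<in> grade (E n) c" "h [^]\<^bsub>S\<^esub> Suc N \<odot>\<^bsub>E n\<^esub> u = h [^]\<^bsub>S\<^esub> N \<odot>\<^bsub>E n\<^esub> v"
  proof (rule graded_baer[OF pow_grade[OF h] grade_zero[of 0] v1 E.grade_zero])
    fix a b assume a: "a \<in> carrier S" "b \<in> carrier S"
      and eq: "h [^]\<^bsub>S\<^esub> Suc N \<otimes>\<^bsub>S\<^esub> a \<oplus>\<^bsub>S\<^esub> \<zero>\<^bsub>S\<^esub> \<otimes>\<^bsub>S\<^esub> b = \<zero>\<^bsub>S\<^esub>"
    then have "a \<in> ?A (Suc N)" by simp
    then have "a \<in> ?A N" using N[OF le_SucI[OF le_refl]] by (simp only:)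
    then have "h [^]\<^bsub>S\<^esub> N \<otimes>\<^bsub>S\<^esub> a = \<zero>\<^bsub>S\<^esub>" by simp
    moreover have "a \<odot>\<^bsub>E n\<^esub> (h [^]\<^bsub>S\<^esub> N \<odot>\<^bsub>E n\<^esub> v) = (h [^]\<^bsub>S\<^esub> N \<otimes>\<^bsub>S\<^esub> a) \<odot>\<^bsub>E n\<^esub> v"
      using a by (simp add: R.m_comm flip: E.smult_assoc1)
    ultimately show "a \<odot>\<^bsub>E n\<^esub> (h [^]\<^bsub>S\<^esub> N \<odot>\<^bsub>E n\<^esub> v) \<oplus>\<^bsub>E n\<^esub> b \<odot>\<^bsub>E n\<^esub> \<zero>\<^bsub>E n\<^esub> = \<zero>\<^bsub>E n\<^esub>"
      using a by simp
  qed
  then show thesis by (rule that)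
qed

text \<open>Stabilization of the ideals \<open>g\<^sup>k S : f\<^sup>j\<close> replaces the Artin-Rees lemma: it makes
  \<open>f\<^sup>m a + g\<^sup>m b \<mapsto> g\<^sup>m b v\<close> well defined for large \<open>m\<close>.\<close>

lemma graded_split:
  fixes k :: nat
  assumes f: "f \<in> grade S b1" and g: "g \<in> grade S b2" and v: "v \<in> grade (E n) c"
    and tors: "f [^]\<^bsub>S\<^esub> k \<odot>\<^bsub>E n\<^esub> (g [^]\<^bsub>S\<^esub> k \<odot>\<^bsub>E n\<^esub> v) = \<zero>\<^bsub>E n\<^esub>"
  obtains m :: nat and u w where "u \<in> grade (E n) c" "w \<in> grade (E n) c" "v = u \<oplus>\<^bsub>E n\<^esub> w"
    "f [^]\<^bsub>S\<^esub> m \<odot>\<^bsub>E n\<^esub> u = \<zero>\<^bsub>E n\<^esub>" "g [^]\<^bsub>S\<^esub> m \<odot>\<^bsub>E n\<^esub> w = \<zero>\<^bsub>E n\<^esub>"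
proof -
  note [simp] = grade_carrier[OF f] grade_carrier[OF g] E.grade_carrier[OF v]
  let ?A = "\<lambda>j::nat. {s \<in> carrier S. \<exists>t\<in>carrier S. f [^]\<^bsub>S\<^esub> j \<otimes>\<^bsub>S\<^esub> s = g [^]\<^bsub>S\<^esub> k \<otimes>\<^bsub>S\<^esub> t}"
  have "rel_ideal S (carrier S) (?A j)" for j
    unfolding rel_ideal_def
  proof (intro conjI ballI)
    show "\<zero>\<^bsub>S\<^esub> \<in> ?A j" by (simp, rule bexI[of _ "\<zero>\<^bsub>S\<^esub>"]) simp_all
    fix a assume "a \<in> ?A j"
    then obtain t where t: "a \<in> carrier S" "t \<in> carrier S" "f [^]\<^bsub>S\<^esub> j \<otimes>\<^bsub>S\<^esub> a = g [^]\<^bsub>S\<^esub> k \<otimes>\<^bsub>S\<^esub> t" by blast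
    {
      fix b assume "b \<in> ?A j"
      then obtain s where s: "b \<in> carrier S" "s \<in> carrier S" "f [^]\<^bsub>S\<^esub> j \<otimes>\<^bsub>S\<^esub> b = g [^]\<^bsub>S\<^esub> k \<otimes>\<^bsub>S\<^esub> s" by blast
      then have "f [^]\<^bsub>S\<^esub> j \<otimes>\<^bsub>S\<^esub> (a \<oplus>\<^bsub>S\<^esub> b) = g [^]\<^bsub>S\<^esub> k \<otimes>\<^bsub>S\<^esub> (t \<oplus>\<^bsub>S\<^esub> s)" using t by (simp add: R.r_distr)
      then show "a \<oplus>\<^bsub>S\<^esub> b \<in> ?A j" using s t by blast
    next
      fix b assume b: "b \<in> carrier S"
      then have "f [^]\<^bsub>S\<^esub> j \<otimes>\<^bsub>S\<^esub> (b \<otimes>\<^bsub>S\<^esub> a) = g [^]\<^bsub>S\<^esub> k \<otimes>\<^bsub>S\<^esub> (b \<otimes>\<^bsub>S\<^esub> t)"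
        using t by (simp add: R.m_lcomm[of _ b])
      then show "b \<otimes>\<^bsub>S\<^esub> a \<in> ?A j" using b t by blast
    }
  qed auto
  moreover have "?A j \<subseteq> ?A (Suc j)" for j
  proof
    fix s assume "s \<in> ?A j"
    then obtain t where t: "s \<in> carrier S" "t \<in> carrier S" "f [^]\<^bsub>S\<^esub> j \<otimes>\<^bsub>S\<^esub> s = g [^]\<^bsub>S\<^esub> k \<otimes>\<^bsub>S\<^esub> t" by blast
    then have "f [^]\<^bsub>S\<^esub> Suc j \<otimes>\<^bsub>S\<^esub> s = g [^]\<^bsub>S\<^esub> k \<otimes>\<^bsub>S\<^esub> (f \<otimes>\<^bsub>S\<^esub> t)"
      by (simp add: R.m_assoc R.m_lcomm[of _ f])
    then show "s \<in> ?A (Suc j)" using t by (simp del: R.nat_pow_Suc) (metis R.m_closed grade_carrier[OF f])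
  qed
  ultimately obtain N where N: "\<And>j. N \<le> j \<Longrightarrow> ?A j = ?A N" by (rule accD[OF acc]) blast
  \<comment> \<open>\<open>N\<close> is for stabilization. The additional \<open>k\<close> leaves a
    factor f^k: from f^N a = g^k t one gets f^m a = f^k g^k t, and this element kills
    \<open>v\<close>.\<close>
  define m where "m = N + k"
  have fm: "f [^]\<^bsub>S\<^esub> m = f [^]\<^bsub>S\<^esub> k \<otimes>\<^bsub>S\<^esub> f [^]\<^bsub>S\<^esub> N" and gm: "g [^]\<^bsub>S\<^esub> m = g [^]\<^bsub>S\<^esub> k \<otimes>\<^bsub>S\<^esub> g [^]\<^bsub>S\<^esub> N"
    by (simp_all add: m_def R.nat_pow_mult add.commute)
  \<comment> \<open>The value 0 at f^m makes \<open>u\<close> torsion for \<open>f\<close>; the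
    value g^m v at g^m makes v - u torsion for \<open>g\<close>.\<close>
  obtain u where u: "u \<in> grade (E n) c" "f [^]\<^bsub>S\<^esub> m \<odot>\<^bsub>E n\<^esub> u = \<zero>\<^bsub>E n\<^esub>"
    "g [^]\<^bsub>S\<^esub> m \<odot>\<^bsub>E n\<^esub> u = g [^]\<^bsub>S\<^esub> m \<odot>\<^bsub>E n\<^esub> v"
  proof (rule graded_baer[OF pow_grade[OF f] pow_grade[OF g] E.grade_zero E.grade_smult[OF pow_grade[OF g] v]])
    fix a b assume a: "a \<in> carrier S" "b \<in> carrier S"
      and eq: "f [^]\<^bsub>S\<^esub> m \<otimes>\<^bsub>S\<^esub> a \<oplus>\<^bsub>S\<^esub> g [^]\<^bsub>S\<^esub> m \<otimes>\<^bsub>S\<^esub> b = \<zero>\<^bsub>S\<^esub>"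
    then have e1: "f [^]\<^bsub>S\<^esub> m \<otimes>\<^bsub>S\<^esub> a = \<ominus>\<^bsub>S\<^esub> (g [^]\<^bsub>S\<^esub> m \<otimes>\<^bsub>S\<^esub> b)"
      by (simp add: R.sum_zero_eq_neg)
    also have "\<dots> = g [^]\<^bsub>S\<^esub> k \<otimes>\<^bsub>S\<^esub> (\<ominus>\<^bsub>S\<^esub> (g [^]\<^bsub>S\<^esub> N \<otimes>\<^bsub>S\<^esub> b))"
      using a by (simp add: gm R.r_minus R.m_assoc)
    finally have "f [^]\<^bsub>S\<^esub> m \<otimes>\<^bsub>S\<^esub> a = g [^]\<^bsub>S\<^esub> k \<otimes>\<^bsub>S\<^esub> (\<ominus>\<^bsub>S\<^esub> (g [^]\<^bsub>S\<^esub> N \<otimes>\<^bsub>S\<^esub> b))" .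
    moreover have "\<ominus>\<^bsub>S\<^esub> (g [^]\<^bsub>S\<^esub> N \<otimes>\<^bsub>S\<^esub> b) \<in> carrier S" using a by simp
    ultimately have "a \<in> ?A m" using a(1) by blast
    then have "a \<in> ?A N" using N[of m] unfolding m_def by simp
    then obtain t where t: "t \<in> carrier S" "f [^]\<^bsub>S\<^esub> N \<otimes>\<^bsub>S\<^esub> a = g [^]\<^bsub>S\<^esub> k \<otimes>\<^bsub>S\<^esub> t" by blast
    have "g [^]\<^bsub>S\<^esub> m \<otimes>\<^bsub>S\<^esub> b = \<ominus>\<^bsub>S\<^esub> (f [^]\<^bsub>S\<^esub> m \<otimes>\<^bsub>S\<^esub> a)" using e1 a by simp
    also have "\<dots> = (\<ominus>\<^bsub>S\<^esub> t) \<otimes>\<^bsub>S\<^esub> (f [^]\<^bsub>S\<^esub> k \<otimes>\<^bsub>S\<^esub> g [^]\<^bsub>S\<^esub> k)"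
      using a t by (simp add: fm R.m_assoc R.l_minus) (simp add: R.m_ac)
    finally have "(g [^]\<^bsub>S\<^esub> m \<otimes>\<^bsub>S\<^esub> b) \<odot>\<^bsub>E n\<^esub> v = \<zero>\<^bsub>E n\<^esub>"
      using a t tors by (simp add: E.smult_assoc1)
    then show "a \<odot>\<^bsub>E n\<^esub> \<zero>\<^bsub>E n\<^esub> \<oplus>\<^bsub>E n\<^esub> b \<odot>\<^bsub>E n\<^esub> (g [^]\<^bsub>S\<^esub> m \<odot>\<^bsub>E n\<^esub> v) = \<zero>\<^bsub>E n\<^esub>"
      using a by (simp add: R.m_comm flip: E.smult_assoc1)
  qed
  show thesis
  proof (rule that[of u "v \<ominus>\<^bsub>E n\<^esub> u" m])
    have [simp]: "u \<in> carrier (E n)" using E.grade_carrier[OF u(1)] .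
    show "v \<ominus>\<^bsub>E n\<^esub> u \<in> grade (E n) c" using E.grade_minus v u by blast
    show "v = u \<oplus>\<^bsub>E n\<^esub> (v \<ominus>\<^bsub>E n\<^esub> u)" by (simp add: E.M.add_minus_cancel)
    show "g [^]\<^bsub>S\<^esub> m \<odot>\<^bsub>E n\<^esub> (v \<ominus>\<^bsub>E n\<^esub> u) = \<zero>\<^bsub>E n\<^esub>"
      using u(3) by (simp add: a_minus_def E.smult_r_distr E.smult_r_minus E.M.r_neg)
  qed (use u in auto)
qed

lemma graded_divide_pow:
  assumes h: "h \<in> grade S b" and v: "v \<in> grade (E n) (scale k b + c)"
  obtains N :: nat and u where "u \<in> grade (E n) c" "h [^]\<^bsub>S\<^esub> (N + k) \<odot>\<^bsub>E n\<^esub> u = h [^]\<^bsub>S\<^esub> N \<odot>\<^bsub>E n\<^esub> v"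
proof -
  obtain m u where "u \<in> grade (E n) c"
    "(h [^]\<^bsub>S\<^esub> k) [^]\<^bsub>S\<^esub> Suc m \<odot>\<^bsub>E n\<^esub> u = (h [^]\<^bsub>S\<^esub> k) [^]\<^bsub>S\<^esub> m \<odot>\<^bsub>E n\<^esub> v"
    by (rule graded_divide[OF pow_grade[OF h] v])
  then show thesis
    using that[of u "k * m"] grade_carrier[OF h] by (simp add: R.nat_pow_pow R.nat_pow_mult)
qed

text \<open>An equation of fractions that holds after multiplication by h^m also holds after any
  higher power, so different exponents can be replaced by their maximum.\<close>

lemma pow_smult_mono:
  assumes h: "h \<in> carrier S" and v: "v \<in> carrier (E n)" "w \<in> carrier (E n)"
    and eq: "h [^]\<^bsub>S\<^esub> (m + k :: nat) \<odot>\<^bsub>E n\<^esub> v = h [^]\<^bsub>S\<^esub> m \<odot>\<^bsub>E n\<^esub> w" and "m \<le> m'"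
  shows "h [^]\<^bsub>S\<^esub> (m' + k) \<odot>\<^bsub>E n\<^esub> v = h [^]\<^bsub>S\<^esub> m' \<odot>\<^bsub>E n\<^esub> w"
proof -
  have "h [^]\<^bsub>S\<^esub> (m' - m) \<odot>\<^bsub>E n\<^esub> (h [^]\<^bsub>S\<^esub> (m + k) \<odot>\<^bsub>E n\<^esub> v) =
      h [^]\<^bsub>S\<^esub> (m' - m) \<odot>\<^bsub>E n\<^esub> (h [^]\<^bsub>S\<^esub> m \<odot>\<^bsub>E n\<^esub> w)" using eq by simp
  then show ?thesis
    using h v \<open>m \<le> m'\<close> by (simp add: R.nat_pow_mult flip: E.smult_assoc1)
qed

lemma pow_smult_zero_mono:
  assumes h: "h \<in> carrier S" and v: "v \<in> carrier (E n)"
    and eq: "h [^]\<^bsub>S\<^esub> (m::nat) \<odot>\<^bsub>E n\<^esub> v = \<zero>\<^bsub>E n\<^esub>" and "m \<le> m'"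
  shows "h [^]\<^bsub>S\<^esub> m' \<odot>\<^bsub>E n\<^esub> v = \<zero>\<^bsub>E n\<^esub>"
  using pow_smult_mono[of h v n "\<zero>\<^bsub>E n\<^esub>" m 0 m'] assms by simp

text \<open>Second local cohomology with support in the single element \<open>h\<close> vanishes.
  Any lift \<open>u\<close> of \<open>v\<close> satisfies h^n u = d t. Dividing \<open>t\<close> by
  h^n, up to torsion, gives \<open>s\<close>, and u - d s is a lift killed by a power of
  \<open>h\<close>.\<close>

lemma lift_torsion:
  assumes h: "h \<in> grade S b" and v: "v \<in> grade (E (Suc (Suc 0))) c"
    and dv: "d (Suc (Suc 0)) v = \<zero>\<^bsub>E (Suc (Suc (Suc 0)))\<^esub>"
    and hv: "h [^]\<^bsub>S\<^esub> (n::nat) \<odot>\<^bsub>E (Suc (Suc 0))\<^esub> v = \<zero>\<^bsub>E (Suc (Suc 0))\<^esub>"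
  obtains u and m :: nat where "u \<in> grade (E (Suc 0)) c" "d (Suc 0) u = v"
    "h [^]\<^bsub>S\<^esub> m \<odot>\<^bsub>E (Suc 0)\<^esub> u = \<zero>\<^bsub>E (Suc 0)\<^esub>"
proof -
  note [simp] = grade_carrier[OF h]
  obtain u where u: "u \<in> grade (E (Suc 0)) c" "v = d (Suc 0) u" using exact_Suc[OF v dv] by blast
  note [simp] = E.grade_carrier[OF u(1)]
  have "d (Suc 0) (h [^]\<^bsub>S\<^esub> n \<odot>\<^bsub>E (Suc 0)\<^esub> u) = \<zero>\<^bsub>E (Suc (Suc 0))\<^esub>" using hv u by (simp add: d_smult)
  with exact_Suc[OF E.grade_smult[OF pow_grade[OF h] u(1)]]
  obtain t where t: "t \<in> grade (E 0) (scale n b + c)" "h [^]\<^bsub>S\<^esub> n \<odot>\<^bsub>E (Suc 0)\<^esub> u = d 0 t" by blast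
  obtain N s where s: "s \<in> grade (E 0) c" "h [^]\<^bsub>S\<^esub> (N + n) \<odot>\<^bsub>E 0\<^esub> s = h [^]\<^bsub>S\<^esub> N \<odot>\<^bsub>E 0\<^esub> t"
    by (rule graded_divide_pow[OF h t(1)])
  note [simp] = E.grade_carrier[OF t(1)] E.grade_carrier[OF s(1)]
  show thesis
  proof (rule that)
    show "u \<ominus>\<^bsub>E (Suc 0)\<^esub> d 0 s \<in> grade (E (Suc 0)) c"
      using u s by (simp add: E.grade_minus d_grade)
    show "d (Suc 0) (u \<ominus>\<^bsub>E (Suc 0)\<^esub> d 0 s) = v"
      using u by (simp add: a_minus_def d_add d_uminus)
    have "h [^]\<^bsub>S\<^esub> (N + n) \<odot>\<^bsub>E (Suc 0)\<^esub> u = h [^]\<^bsub>S\<^esub> N \<odot>\<^bsub>E (Suc 0)\<^esub> d 0 t"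
      by (simp add: E.smult_assoc1 flip: R.nat_pow_mult t(2))
    also have "\<dots> = h [^]\<^bsub>S\<^esub> (N + n) \<odot>\<^bsub>E (Suc 0)\<^esub> d 0 s" using s(2) by (simp flip: d_smult)
    finally show "h [^]\<^bsub>S\<^esub> (N + n) \<odot>\<^bsub>E (Suc 0)\<^esub> (u \<ominus>\<^bsub>E (Suc 0)\<^esub> d 0 s) = \<zero>\<^bsub>E (Suc 0)\<^esub>"
      by (simp add: a_minus_def E.smult_r_distr E.smult_r_minus E.M.r_neg)
  qed
qed

end

section \<open>Classes of numerators in the second cohomology\<close>

locale graded_resolution_pair = graded_resolution S E \<epsilon> d
  for S :: "('r, 'r) gmodule" and E :: "nat \<Rightarrow> ('r, 'e) gmodule" and \<epsilon> d +
  fixes f g :: 'r and e :: "int \<times> int"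
  assumes f: "f \<in> grade S e" and g: "g \<in> grade S e"
begin

abbreviation "E0 \<equiv> E 0"
abbreviation "E1 \<equiv> E (Suc 0)"
abbreviation "E2 \<equiv> E (Suc (Suc 0))"
abbreviation "F n \<equiv> f [^]\<^bsub>S\<^esub> (n::nat)"
abbreviation "G n \<equiv> g [^]\<^bsub>S\<^esub> (n::nat)"
abbreviation "P n \<equiv> (f \<otimes>\<^bsub>S\<^esub> g) [^]\<^bsub>S\<^esub> (n::nat)"

lemma fg_closed [simp]: "f \<in> carrier S" "g \<in> carrier S"
  using f g grade_carrier by auto

lemma fg_grade: "f \<otimes>\<^bsub>S\<^esub> g \<in> grade S (e + e)"
  using mult_grade[OF f g] .

lemma P_eq: "P n = F n \<otimes>\<^bsub>S\<^esub> G n"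
  by (simp add: R.nat_pow_distrib)

lemma P_smult: "v \<in> carrier (E i) \<Longrightarrow> P n \<odot>\<^bsub>E i\<^esub> v = F n \<odot>\<^bsub>E i\<^esub> (G n \<odot>\<^bsub>E i\<^esub> v)"
  "v \<in> carrier (E i) \<Longrightarrow> P n \<odot>\<^bsub>E i\<^esub> v = G n \<odot>\<^bsub>E i\<^esub> (F n \<odot>\<^bsub>E i\<^esub> v)"
  by (simp_all add: P_eq E.smult_assoc1) (simp add: R.m_comm flip: E.smult_assoc1)

text \<open>Torsion for the ideal generated by \<open>f\<close> and \<open>g\<close>, hence stronger
  than being killed by a power of the product of \<open>f\<close> and \<open>g\<close>.\<close>

definition fg_torsion :: "nat \<Rightarrow> 'e \<Rightarrow> bool" where
  "fg_torsion i v \<longleftrightarrow> (\<exists>n. F n \<odot>\<^bsub>E i\<^esub> v = \<zero>\<^bsub>E i\<^esub> \<and> G n \<odot>\<^bsub>E i\<^esub> v = \<zero>\<^bsub>E i\<^esub>)"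

lemma fg_torsionI:
  assumes "v \<in> carrier (E i)" "F m \<odot>\<^bsub>E i\<^esub> v = \<zero>\<^bsub>E i\<^esub>" "G n \<odot>\<^bsub>E i\<^esub> v = \<zero>\<^bsub>E i\<^esub>"
  shows "fg_torsion i v"
  unfolding fg_torsion_def using assms pow_smult_zero_mono[of _ v i]
  by (intro exI[of _ "max m n"]) (metis fg_closed max.cobounded1 max.cobounded2)

definition cocycle :: "int \<times> int \<Rightarrow> 'e \<Rightarrow> bool" where
  "cocycle c v \<longleftrightarrow> v \<in> grade E2 c \<and> d (Suc (Suc 0)) v = \<zero>\<^bsub>E (Suc (Suc (Suc 0)))\<^esub> \<and> fg_torsion (Suc (Suc 0)) v"

text \<open>The preimage \<eta> is required to be homogeneous;
  \<open>boundaries_iff_coboundary\<close> shows that this loses nothing for homogeneous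
  \<open>v\<close>.\<close>

definition coboundary :: "int \<times> int \<Rightarrow> 'e \<Rightarrow> bool" where
  "coboundary c v \<longleftrightarrow> (\<exists>\<eta>\<in>grade E1 c. fg_torsion (Suc 0) \<eta> \<and> v = d (Suc 0) \<eta>)"

text \<open>The cocycle \<open>v\<close> represents the generalized fraction \<open>u / (fg)\<^sup>k\<close>. Additive subtraction is avoided by
  writing \<open>d\<alpha> + \<gamma> = \<beta>\<close>, and fractions in \<open>E\<^sub>0\<close> by a further factor \<open>(fg)\<^sup>N\<close>.\<close>

definition represents :: "int \<times> int \<Rightarrow> 'e \<Rightarrow> nat \<Rightarrow> 'r \<Rightarrow> bool" where
  "represents c v k u \<longleftrightarrow> u \<in> grade S (scale k (e + e) + c) \<and>
     (\<exists>\<alpha>\<in>grade E0 c. \<exists>\<beta>\<in>grade E1 c. \<exists>\<gamma>\<in>grade E1 c. \<exists>N.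
        F N \<odot>\<^bsub>E1\<^esub> \<beta> = \<zero>\<^bsub>E1\<^esub> \<and> G N \<odot>\<^bsub>E1\<^esub> \<gamma> = \<zero>\<^bsub>E1\<^esub> \<and> d 0 \<alpha> \<oplus>\<^bsub>E1\<^esub> \<gamma> = \<beta> \<and>
        d (Suc 0) \<beta> = v \<and> P (N + k) \<odot>\<^bsub>E0\<^esub> \<alpha> = P N \<odot>\<^bsub>E0\<^esub> \<epsilon> u)"

text \<open>Three conditions share the exponent \<open>N\<close> in \<open>represents\<close>. Each
  of them persists for larger exponents, so they may be established with separate ones.\<close>

lemma representsI:
  assumes "u \<in> grade S (scale k (e + e) + c)" "\<alpha> \<in> grade E0 c" "\<beta> \<in> grade E1 c" "\<gamma> \<in> grade E1 c"
    and "F m \<odot>\<^bsub>E1\<^esub> \<beta> = \<zero>\<^bsub>E1\<^esub>" "G n \<odot>\<^bsub>E1\<^esub> \<gamma> = \<zero>\<^bsub>E1\<^esub>" "d 0 \<alpha> \<oplus>\<^bsub>E1\<^esub> \<gamma> = \<beta>"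
    and "d (Suc 0) \<beta> = v" "P (N + k) \<odot>\<^bsub>E0\<^esub> \<alpha> = P N \<odot>\<^bsub>E0\<^esub> \<epsilon> u"
  shows "represents c v k u"
proof -
  note c = E.grade_carrier[OF assms(2)] E.grade_carrier[OF assms(3)] E.grade_carrier[OF assms(4)]
    grade_carrier[OF assms(1)]
  let ?N = "max N (max m n)"
  have "F ?N \<odot>\<^bsub>E1\<^esub> \<beta> = \<zero>\<^bsub>E1\<^esub>" "G ?N \<odot>\<^bsub>E1\<^esub> \<gamma> = \<zero>\<^bsub>E1\<^esub>"
    using assms c by (auto intro: pow_smult_zero_mono)
  moreover have "P (?N + k) \<odot>\<^bsub>E0\<^esub> \<alpha> = P ?N \<odot>\<^bsub>E0\<^esub> \<epsilon> u"
    by (rule pow_smult_mono[OF _ _ _ assms(9)]) (use c in simp_all)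
  ultimately show ?thesis unfolding represents_def using assms by blast
qed

lemma representsE:
  assumes "represents c v k u"
  obtains \<alpha> \<beta> \<gamma> N where "u \<in> grade S (scale k (e + e) + c)"
    "\<alpha> \<in> grade E0 c" "\<beta> \<in> grade E1 c" "\<gamma> \<in> grade E1 c"
    "F N \<odot>\<^bsub>E1\<^esub> \<beta> = \<zero>\<^bsub>E1\<^esub>" "G N \<odot>\<^bsub>E1\<^esub> \<gamma> = \<zero>\<^bsub>E1\<^esub>" "d 0 \<alpha> \<oplus>\<^bsub>E1\<^esub> \<gamma> = \<beta>" "d (Suc 0) \<beta> = v"
    "P (N + k) \<odot>\<^bsub>E0\<^esub> \<alpha> = P N \<odot>\<^bsub>E0\<^esub> \<epsilon> u"
  using assms unfolding represents_def by blast

lemma represents_cocycle: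
  assumes "represents c v k u" shows "cocycle c v"
proof -
  obtain \<alpha> \<beta> \<gamma> N where *: "\<alpha> \<in> grade E0 c" "\<beta> \<in> grade E1 c" "\<gamma> \<in> grade E1 c"
    "F N \<odot>\<^bsub>E1\<^esub> \<beta> = \<zero>\<^bsub>E1\<^esub>" "G N \<odot>\<^bsub>E1\<^esub> \<gamma> = \<zero>\<^bsub>E1\<^esub>" "d 0 \<alpha> \<oplus>\<^bsub>E1\<^esub> \<gamma> = \<beta>" "d (Suc 0) \<beta> = v"
    using assms by (rule representsE)
  note [simp] = E.grade_carrier[OF *(1)] E.grade_carrier[OF *(2)] E.grade_carrier[OF *(3)]
  have v: "v \<in> grade E2 c" using * d_grade by blast
  note [simp] = E.grade_carrier[OF v]
  have "F N \<odot>\<^bsub>E2\<^esub> v = d (Suc 0) (F N \<odot>\<^bsub>E1\<^esub> \<beta>)" using *(7) by (simp add: d_smult)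
  moreover have "d (Suc 0) \<gamma> = v" using d_add[of "d 0 \<alpha>" "Suc 0" \<gamma>] *(6,7) by simp
  then have "G N \<odot>\<^bsub>E2\<^esub> v = d (Suc 0) (G N \<odot>\<^bsub>E1\<^esub> \<gamma>)" by (simp add: d_smult)
  ultimately have "fg_torsion (Suc (Suc 0)) v" using *(4,5) by (intro fg_torsionI[of v _ N N]) simp_all
  moreover have "d (Suc (Suc 0)) v = \<zero>\<^bsub>E (Suc (Suc (Suc 0)))\<^esub>" using *(7) d_d[of \<beta> "Suc 0"] by simp
  ultimately show ?thesis using v unfolding cocycle_def by simp
qed

lemma represents_ex_cocycle:
  assumes u: "u \<in> grade S (scale k (e + e) + c)"
  obtains v where "represents c v k u"
proof -
  note [simp] = grade_carrier[OF u]
  obtain N \<alpha> where \<alpha>: "\<alpha> \<in> grade E0 c" "P (N + k) \<odot>\<^bsub>E0\<^esub> \<alpha> = P N \<odot>\<^bsub>E0\<^esub> \<epsilon> u"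
    by (rule graded_divide_pow[OF fg_grade eps_grade[OF u]])
  note [simp] = E.grade_carrier[OF \<alpha>(1)]
  have "P (N + k) \<odot>\<^bsub>E1\<^esub> d 0 \<alpha> = \<zero>\<^bsub>E1\<^esub>"
    using arg_cong[OF \<alpha>(2), of "d 0"] by (simp add: d_smult)
  then have "F (N + k) \<odot>\<^bsub>E1\<^esub> (G (N + k) \<odot>\<^bsub>E1\<^esub> d 0 \<alpha>) = \<zero>\<^bsub>E1\<^esub>" by (simp add: P_smult(1))
  then obtain m \<beta> w where *: "\<beta> \<in> grade E1 c" "w \<in> grade E1 c" "d 0 \<alpha> = \<beta> \<oplus>\<^bsub>E1\<^esub> w"
    "F m \<odot>\<^bsub>E1\<^esub> \<beta> = \<zero>\<^bsub>E1\<^esub>" "G m \<odot>\<^bsub>E1\<^esub> w = \<zero>\<^bsub>E1\<^esub>"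
    by (rule graded_split[OF f g d_grade[OF \<alpha>(1)]])
  note [simp] = E.grade_carrier[OF *(1)] E.grade_carrier[OF *(2)]
  \<comment> \<open>The splitting reads d \<alpha> = \<beta> + w, so \<gamma> = -w in the form d
    \<alpha> + \<gamma> = \<beta>.\<close>
  have "represents c (d (Suc 0) \<beta>) k u"
  proof (rule representsI[OF u \<alpha>(1) *(1) E.grade_uminus[OF *(2)] *(4) _ _ refl \<alpha>(2)])
    show "G m \<odot>\<^bsub>E1\<^esub> (\<ominus>\<^bsub>E1\<^esub> w) = \<zero>\<^bsub>E1\<^esub>" using *(5) by (simp add: E.smult_r_minus)
    show "d 0 \<alpha> \<oplus>\<^bsub>E1\<^esub> \<ominus>\<^bsub>E1\<^esub> w = \<beta>" by (simp add: *(3) E.M.a_assoc E.M.r_neg)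
  qed
  then show thesis by (rule that)
qed

text \<open>Lift \<open>v\<close> twice, to \<beta> killed by a power of \<open>f\<close> and to
  \<gamma> killed by a power of \<open>g\<close>. The lifts differ by some d \<alpha>, which (fg)^k
  kills for large k, so (fg)^k \<alpha> comes from the ring and is the numerator.\<close>

lemma represents_ex_numerator:
  assumes "cocycle c v"
  obtains k u where "k0 \<le> k" "represents c v k u"
proof -
  obtain n where v: "v \<in> grade E2 c" "d (Suc (Suc 0)) v = \<zero>\<^bsub>E (Suc (Suc (Suc 0)))\<^esub>"
    "F n \<odot>\<^bsub>E2\<^esub> v = \<zero>\<^bsub>E2\<^esub>" "G n \<odot>\<^bsub>E2\<^esub> v = \<zero>\<^bsub>E2\<^esub>"
    using assms unfolding cocycle_def fg_torsion_def by blast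
  obtain \<beta> m where \<beta>: "\<beta> \<in> grade E1 c" "d (Suc 0) \<beta> = v" "F m \<odot>\<^bsub>E1\<^esub> \<beta> = \<zero>\<^bsub>E1\<^esub>"
    by (rule lift_torsion[OF f v(1-3)])
  obtain \<gamma> l where \<gamma>: "\<gamma> \<in> grade E1 c" "d (Suc 0) \<gamma> = v" "G l \<odot>\<^bsub>E1\<^esub> \<gamma> = \<zero>\<^bsub>E1\<^esub>"
    by (rule lift_torsion[OF g v(1,2,4)])
  note [simp] = E.grade_carrier[OF \<beta>(1)] E.grade_carrier[OF \<gamma>(1)] E.grade_carrier[OF v(1)]
  have "d (Suc 0) (\<beta> \<ominus>\<^bsub>E1\<^esub> \<gamma>) = \<zero>\<^bsub>E2\<^esub>"
    using \<beta>(2) \<gamma>(2) by (simp add: a_minus_def d_add d_uminus E.M.r_neg)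
  with exact_Suc[OF E.grade_minus[OF \<beta>(1) \<gamma>(1)]]
  obtain \<alpha> where \<alpha>: "\<alpha> \<in> grade E0 c" "\<beta> \<ominus>\<^bsub>E1\<^esub> \<gamma> = d 0 \<alpha>" by blast
  note [simp] = E.grade_carrier[OF \<alpha>(1)]
  \<comment> \<open>Large enough to kill both lifts; the bound \<open>k0\<close> will be the index
    at which the direct system starts.\<close>
  let ?k = "max k0 (max m l)"
  have "F ?k \<odot>\<^bsub>E1\<^esub> \<beta> = \<zero>\<^bsub>E1\<^esub>" "G ?k \<odot>\<^bsub>E1\<^esub> \<gamma> = \<zero>\<^bsub>E1\<^esub>"
    by (rule pow_smult_zero_mono[of _ _ _ m] pow_smult_zero_mono[of _ _ _ l]; simp add: \<beta> \<gamma>)+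
  then have "P ?k \<odot>\<^bsub>E1\<^esub> \<beta> = \<zero>\<^bsub>E1\<^esub>" "P ?k \<odot>\<^bsub>E1\<^esub> \<gamma> = \<zero>\<^bsub>E1\<^esub>"
    by (simp_all add: P_smult(2)[of \<beta>] P_smult(1)[of \<gamma>])
  then have "d 0 (P ?k \<odot>\<^bsub>E0\<^esub> \<alpha>) = \<zero>\<^bsub>E1\<^esub>"
    by (simp add: d_smult a_minus_def E.smult_r_distr E.smult_r_minus flip: \<alpha>(2))
  with exact_0[OF E.grade_smult[OF pow_grade[OF fg_grade] \<alpha>(1)]]
  obtain u where u: "u \<in> grade S (scale ?k (e + e) + c)" "P ?k \<odot>\<^bsub>E0\<^esub> \<alpha> = \<epsilon> u" by blast
  have "represents c v ?k u"
  proof (rule representsI[OF u(1) \<alpha>(1) \<beta>(1) \<gamma>(1) \<beta>(3) \<gamma>(3) _ \<beta>(2), where N = 0])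
    show "d 0 \<alpha> \<oplus>\<^bsub>E1\<^esub> \<gamma> = \<beta>"
      using E.M.add_minus_cancel[of \<gamma> "Suc 0" \<beta>] \<alpha>(2) by (simp add: E.M.a_comm)
    show "P (0 + ?k) \<odot>\<^bsub>E0\<^esub> \<alpha> = P 0 \<odot>\<^bsub>E0\<^esub> \<epsilon> u"
      using u(2) grade_carrier[OF u(1)] by simp
  qed
  then show thesis using that[of ?k u] by simp
qed

section \<open>Compatibility with the module operations and with expanding fractions\<close>

lemma represents_add:
  assumes "represents c v k u" "represents c v' k u'"
  shows "represents c (v \<oplus>\<^bsub>E2\<^esub> v') k (u \<oplus>\<^bsub>S\<^esub> u')"
proof -
  obtain \<alpha> \<beta> \<gamma> N where *: "u \<in> grade S (scale k (e + e) + c)"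
    "\<alpha> \<in> grade E0 c" "\<beta> \<in> grade E1 c" "\<gamma> \<in> grade E1 c"
    "F N \<odot>\<^bsub>E1\<^esub> \<beta> = \<zero>\<^bsub>E1\<^esub>" "G N \<odot>\<^bsub>E1\<^esub> \<gamma> = \<zero>\<^bsub>E1\<^esub>" "d 0 \<alpha> \<oplus>\<^bsub>E1\<^esub> \<gamma> = \<beta>" "d (Suc 0) \<beta> = v"
    "P (N + k) \<odot>\<^bsub>E0\<^esub> \<alpha> = P N \<odot>\<^bsub>E0\<^esub> \<epsilon> u"
    using assms(1) by (rule representsE)
  obtain \<alpha>' \<beta>' \<gamma>' N' where **: "u' \<in> grade S (scale k (e + e) + c)"
    "\<alpha>' \<in> grade E0 c" "\<beta>' \<in> grade E1 c" "\<gamma>' \<in> grade E1 c"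
    "F N' \<odot>\<^bsub>E1\<^esub> \<beta>' = \<zero>\<^bsub>E1\<^esub>" "G N' \<odot>\<^bsub>E1\<^esub> \<gamma>' = \<zero>\<^bsub>E1\<^esub>" "d 0 \<alpha>' \<oplus>\<^bsub>E1\<^esub> \<gamma>' = \<beta>'" "d (Suc 0) \<beta>' = v'"
    "P (N' + k) \<odot>\<^bsub>E0\<^esub> \<alpha>' = P N' \<odot>\<^bsub>E0\<^esub> \<epsilon> u'"
    using assms(2) by (rule representsE)
  note [simp] = E.grade_carrier[OF *(2)] E.grade_carrier[OF *(3)] E.grade_carrier[OF *(4)] grade_carrier[OF *(1)]
    E.grade_carrier[OF **(2)] E.grade_carrier[OF **(3)] E.grade_carrier[OF **(4)] grade_carrier[OF **(1)]
  let ?M = "max N N'"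
  have z: "F ?M \<odot>\<^bsub>E1\<^esub> \<beta> = \<zero>\<^bsub>E1\<^esub>" "G ?M \<odot>\<^bsub>E1\<^esub> \<gamma> = \<zero>\<^bsub>E1\<^esub>" "F ?M \<odot>\<^bsub>E1\<^esub> \<beta>' = \<zero>\<^bsub>E1\<^esub>" "G ?M \<odot>\<^bsub>E1\<^esub> \<gamma>' = \<zero>\<^bsub>E1\<^esub>"
    by (rule pow_smult_zero_mono[of _ _ _ N] pow_smult_zero_mono[of _ _ _ N']; simp add: * **; fail)+
  have p: "P (?M + k) \<odot>\<^bsub>E0\<^esub> \<alpha> = P ?M \<odot>\<^bsub>E0\<^esub> \<epsilon> u" "P (?M + k) \<odot>\<^bsub>E0\<^esub> \<alpha>' = P ?M \<odot>\<^bsub>E0\<^esub> \<epsilon> u'"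
    by (rule pow_smult_mono[OF _ _ _ *(9)] pow_smult_mono[OF _ _ _ **(9)]; simp; fail)+
  show ?thesis
  proof (rule representsI[where \<alpha> = "\<alpha> \<oplus>\<^bsub>E0\<^esub> \<alpha>'" and \<beta> = "\<beta> \<oplus>\<^bsub>E1\<^esub> \<beta>'" and \<gamma> = "\<gamma> \<oplus>\<^bsub>E1\<^esub> \<gamma>'" and N = ?M and m = ?M and n = ?M])
    show "d 0 (\<alpha> \<oplus>\<^bsub>E0\<^esub> \<alpha>') \<oplus>\<^bsub>E1\<^esub> (\<gamma> \<oplus>\<^bsub>E1\<^esub> \<gamma>') = \<beta> \<oplus>\<^bsub>E1\<^esub> \<beta>'"
      by (simp add: d_add E.M.a_ac flip: *(7) **(7))
    show "d (Suc 0) (\<beta> \<oplus>\<^bsub>E1\<^esub> \<beta>') = v \<oplus>\<^bsub>E2\<^esub> v'" by (simp add: d_add *(8) **(8))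
    show "P (?M + k) \<odot>\<^bsub>E0\<^esub> (\<alpha> \<oplus>\<^bsub>E0\<^esub> \<alpha>') = P ?M \<odot>\<^bsub>E0\<^esub> \<epsilon> (u \<oplus>\<^bsub>S\<^esub> u')"
      by (simp add: E.smult_r_distr eps_add p)
  qed (simp_all add: * ** grade_add E.grade_add E.smult_r_distr z)
qed

lemma represents_smult:
  assumes "represents c v k u" and a: "a \<in> grade S 0"
  shows "represents c (a \<odot>\<^bsub>E2\<^esub> v) k (a \<otimes>\<^bsub>S\<^esub> u)"
proof -
  obtain \<alpha> \<beta> \<gamma> N where *: "u \<in> grade S (scale k (e + e) + c)"
    "\<alpha> \<in> grade E0 c" "\<beta> \<in> grade E1 c" "\<gamma> \<in> grade E1 c"
    "F N \<odot>\<^bsub>E1\<^esub> \<beta> = \<zero>\<^bsub>E1\<^esub>" "G N \<odot>\<^bsub>E1\<^esub> \<gamma> = \<zero>\<^bsub>E1\<^esub>" "d 0 \<alpha> \<oplus>\<^bsub>E1\<^esub> \<gamma> = \<beta>" "d (Suc 0) \<beta> = v"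
    "P (N + k) \<odot>\<^bsub>E0\<^esub> \<alpha> = P N \<odot>\<^bsub>E0\<^esub> \<epsilon> u"
    using assms(1) by (rule representsE)
  note [simp] = E.grade_carrier[OF *(2)] E.grade_carrier[OF *(3)] E.grade_carrier[OF *(4)] grade_carrier[OF *(1)]
    grade_carrier[OF a]
  have sw: "h \<odot>\<^bsub>E i\<^esub> (a \<odot>\<^bsub>E i\<^esub> t) = a \<odot>\<^bsub>E i\<^esub> (h \<odot>\<^bsub>E i\<^esub> t)" if "h \<in> carrier S" "t \<in> carrier (E i)" for h t i
    using that by (simp add: R.m_comm flip: E.smult_assoc1)
  show ?thesis
  proof (rule representsI[where \<alpha> = "a \<odot>\<^bsub>E0\<^esub> \<alpha>" and \<beta> = "a \<odot>\<^bsub>E1\<^esub> \<beta>" and \<gamma> = "a \<odot>\<^bsub>E1\<^esub> \<gamma>" and N = N and m = N and n = N])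
    show "d 0 (a \<odot>\<^bsub>E0\<^esub> \<alpha>) \<oplus>\<^bsub>E1\<^esub> a \<odot>\<^bsub>E1\<^esub> \<gamma> = a \<odot>\<^bsub>E1\<^esub> \<beta>"
      by (simp add: d_smult E.smult_r_distr flip: *(7))
    show "d (Suc 0) (a \<odot>\<^bsub>E1\<^esub> \<beta>) = a \<odot>\<^bsub>E2\<^esub> v" by (simp add: d_smult *(8))
    show "P (N + k) \<odot>\<^bsub>E0\<^esub> (a \<odot>\<^bsub>E0\<^esub> \<alpha>) = P N \<odot>\<^bsub>E0\<^esub> \<epsilon> (a \<otimes>\<^bsub>S\<^esub> u)"
      by (simp add: sw eps_mult *(9))
  qed (use E.grade_smult[OF a *(2)] E.grade_smult[OF a *(3)] E.grade_smult[OF a *(4)] mult_grade[OF a *(1)]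
      in \<open>simp_all add: sw * \<close>)
qed

lemma represents_uminus:
  assumes "represents c v k u"
  shows "represents c (\<ominus>\<^bsub>E2\<^esub> v) k (\<ominus>\<^bsub>S\<^esub> u)"
proof -
  have "\<ominus>\<^bsub>S\<^esub> \<one>\<^bsub>S\<^esub> \<in> grade S 0" by (rule grade_uminus[OF one_grade])
  note represents_smult[OF assms this]
  moreover have "v \<in> carrier E2"
    using represents_cocycle[OF assms] E.grade_carrier unfolding cocycle_def by blast
  moreover have "u \<in> carrier S" using assms grade_carrier unfolding represents_def by blast
  ultimately show ?thesis by (simp add: E.smult_l_minus R.l_minus)
qed

text \<open>The fraction is expanded by fg, and the same \<alpha>, \<beta>, \<gamma> serve.\<close>

lemma represents_step:
  assumes "represents c v k u"
  shows "represents c v (Suc k) (f \<otimes>\<^bsub>S\<^esub> g \<otimes>\<^bsub>S\<^esub> u)"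
proof -
  obtain \<alpha> \<beta> \<gamma> N where *: "u \<in> grade S (scale k (e + e) + c)"
    "\<alpha> \<in> grade E0 c" "\<beta> \<in> grade E1 c" "\<gamma> \<in> grade E1 c"
    "F N \<odot>\<^bsub>E1\<^esub> \<beta> = \<zero>\<^bsub>E1\<^esub>" "G N \<odot>\<^bsub>E1\<^esub> \<gamma> = \<zero>\<^bsub>E1\<^esub>" "d 0 \<alpha> \<oplus>\<^bsub>E1\<^esub> \<gamma> = \<beta>" "d (Suc 0) \<beta> = v"
    "P (N + k) \<odot>\<^bsub>E0\<^esub> \<alpha> = P N \<odot>\<^bsub>E0\<^esub> \<epsilon> u"
    using assms(1) by (rule representsE)
  note [simp] = E.grade_carrier[OF *(2)] grade_carrier[OF *(1)]
  have cl: "f \<otimes>\<^bsub>S\<^esub> g \<in> carrier S" by simp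
  show ?thesis
  proof (rule representsI[OF _ *(2-8)])
    show "f \<otimes>\<^bsub>S\<^esub> g \<otimes>\<^bsub>S\<^esub> u \<in> grade S (scale (Suc k) (e + e) + c)"
      using mult_grade[OF fg_grade *(1)] by (simp add: scale_Suc algebra_simps)
    have "P (N + Suc k) \<odot>\<^bsub>E0\<^esub> \<alpha> = (f \<otimes>\<^bsub>S\<^esub> g) \<odot>\<^bsub>E0\<^esub> (P (N + k) \<odot>\<^bsub>E0\<^esub> \<alpha>)"
      by (simp add: R.m_comm[OF R.nat_pow_closed cl] flip: E.smult_assoc1)
    also have "\<dots> = P N \<odot>\<^bsub>E0\<^esub> \<epsilon> (f \<otimes>\<^bsub>S\<^esub> g \<otimes>\<^bsub>S\<^esub> u)"
      by (simp add: *(9) eps_mult[OF cl] R.m_comm[OF R.nat_pow_closed cl] flip: E.smult_assoc1)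
    finally show "P (N + Suc k) \<odot>\<^bsub>E0\<^esub> \<alpha> = P N \<odot>\<^bsub>E0\<^esub> \<epsilon> (f \<otimes>\<^bsub>S\<^esub> g \<otimes>\<^bsub>S\<^esub> u)" .
  qed
qed

text \<open>The hypothesis on \<open>u\<close> says u / (fg)^k = a / g^k + b / f^k. Elements
  \<alpha>1 and \<alpha>2 standing for the two summands have differentials killed by powers of
  \<open>g\<close> and of \<open>f\<close>, and \<alpha> is their sum up to torsion for fg.\<close>

lemma represents_coboundary:
  assumes rep: "represents c v k u" and a: "a \<in> grade S (scale k e + c)" and b: "b \<in> grade S (scale k e + c)"
    and u: "u = F k \<otimes>\<^bsub>S\<^esub> a \<oplus>\<^bsub>S\<^esub> G k \<otimes>\<^bsub>S\<^esub> b"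
  shows "coboundary c v"
proof -
  obtain \<alpha> \<beta> \<gamma> N where *:
    "\<alpha> \<in> grade E0 c" "\<beta> \<in> grade E1 c" "\<gamma> \<in> grade E1 c"
    "F N \<odot>\<^bsub>E1\<^esub> \<beta> = \<zero>\<^bsub>E1\<^esub>" "G N \<odot>\<^bsub>E1\<^esub> \<gamma> = \<zero>\<^bsub>E1\<^esub>" "d 0 \<alpha> \<oplus>\<^bsub>E1\<^esub> \<gamma> = \<beta>" "d (Suc 0) \<beta> = v"
    "P (N + k) \<odot>\<^bsub>E0\<^esub> \<alpha> = P N \<odot>\<^bsub>E0\<^esub> \<epsilon> u"
    using rep by (rule representsE)
  obtain N1 \<alpha>1 where \<alpha>1: "\<alpha>1 \<in> grade E0 c" "G (N1 + k) \<odot>\<^bsub>E0\<^esub> \<alpha>1 = G N1 \<odot>\<^bsub>E0\<^esub> \<epsilon> a"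
    by (rule graded_divide_pow[OF g eps_grade[OF a]])
  obtain N2 \<alpha>2 where \<alpha>2: "\<alpha>2 \<in> grade E0 c" "F (N2 + k) \<odot>\<^bsub>E0\<^esub> \<alpha>2 = F N2 \<odot>\<^bsub>E0\<^esub> \<epsilon> b"
    by (rule graded_divide_pow[OF f eps_grade[OF b]])
  note [simp] = E.grade_carrier[OF *(1)] E.grade_carrier[OF *(2)] E.grade_carrier[OF *(3)]
    grade_carrier[OF a] grade_carrier[OF b] E.grade_carrier[OF \<alpha>1(1)] E.grade_carrier[OF \<alpha>2(1)]
  let ?M = "max N (max N1 N2)"
  have G1: "G (?M + k) \<odot>\<^bsub>E0\<^esub> \<alpha>1 = G ?M \<odot>\<^bsub>E0\<^esub> \<epsilon> a"
    by (rule pow_smult_mono[OF _ _ _ \<alpha>1(2)]) simp_all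
  have F2: "F (?M + k) \<odot>\<^bsub>E0\<^esub> \<alpha>2 = F ?M \<odot>\<^bsub>E0\<^esub> \<epsilon> b"
    by (rule pow_smult_mono[OF _ _ _ \<alpha>2(2)]) simp_all
  have "P (?M + k) \<odot>\<^bsub>E0\<^esub> \<alpha> = P ?M \<odot>\<^bsub>E0\<^esub> \<epsilon> u"
    by (rule pow_smult_mono[OF _ _ _ *(8)]) (simp_all add: u)
  also have "\<dots> = F (?M + k) \<odot>\<^bsub>E0\<^esub> (G ?M \<odot>\<^bsub>E0\<^esub> \<epsilon> a) \<oplus>\<^bsub>E0\<^esub> G (?M + k) \<odot>\<^bsub>E0\<^esub> (F ?M \<odot>\<^bsub>E0\<^esub> \<epsilon> b)"
    by (simp add: u eps_add eps_mult E.smult_r_distr P_eq flip: E.smult_assoc1 R.nat_pow_mult)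
      (simp add: R.m_ac)
  also have "\<dots> = P (?M + k) \<odot>\<^bsub>E0\<^esub> (\<alpha>1 \<oplus>\<^bsub>E0\<^esub> \<alpha>2)"
    by (simp add: E.smult_r_distr P_smult(1)[of \<alpha>1] P_smult(2)[of \<alpha>2] G1 F2)
  finally have "P (?M + k) \<odot>\<^bsub>E0\<^esub> (\<alpha> \<ominus>\<^bsub>E0\<^esub> (\<alpha>1 \<oplus>\<^bsub>E0\<^esub> \<alpha>2)) = \<zero>\<^bsub>E0\<^esub>"
    by (simp add: a_minus_def E.smult_r_distr[of _ \<alpha>] E.smult_r_minus E.M.r_neg)
  then have "F (?M + k) \<odot>\<^bsub>E0\<^esub> (G (?M + k) \<odot>\<^bsub>E0\<^esub> (\<alpha> \<ominus>\<^bsub>E0\<^esub> (\<alpha>1 \<oplus>\<^bsub>E0\<^esub> \<alpha>2))) = \<zero>\<^bsub>E0\<^esub>"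
    by (simp add: P_smult(1))
  then obtain m \<sigma>2 \<sigma>1 where \<sigma>: "\<sigma>2 \<in> grade E0 c" "\<sigma>1 \<in> grade E0 c"
    "\<alpha> \<ominus>\<^bsub>E0\<^esub> (\<alpha>1 \<oplus>\<^bsub>E0\<^esub> \<alpha>2) = \<sigma>2 \<oplus>\<^bsub>E0\<^esub> \<sigma>1" "F m \<odot>\<^bsub>E0\<^esub> \<sigma>2 = \<zero>\<^bsub>E0\<^esub>" "G m \<odot>\<^bsub>E0\<^esub> \<sigma>1 = \<zero>\<^bsub>E0\<^esub>"
    by (rule graded_split[OF f g E.grade_minus[OF *(1) E.grade_add[OF \<alpha>1(1) \<alpha>2(1)]]])
  note [simp] = E.grade_carrier[OF \<sigma>(1)] E.grade_carrier[OF \<sigma>(2)]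
  \<comment> \<open>The torsion is split and absorbed: its \<open>g\<close>-torsion summand goes to
    \<alpha>1 and its \<open>f\<close>-torsion summand to \<alpha>2, so that the sum is exactly
    \<alpha>.\<close>
  let ?A1 = "\<alpha>1 \<oplus>\<^bsub>E0\<^esub> \<sigma>1" and ?A2 = "\<alpha>2 \<oplus>\<^bsub>E0\<^esub> \<sigma>2"
  have "\<alpha> = (\<alpha>1 \<oplus>\<^bsub>E0\<^esub> \<alpha>2) \<oplus>\<^bsub>E0\<^esub> (\<sigma>2 \<oplus>\<^bsub>E0\<^esub> \<sigma>1)"
    using E.M.add_minus_cancel[of "\<alpha>1 \<oplus>\<^bsub>E0\<^esub> \<alpha>2" 0 \<alpha>] \<sigma>(3) by simp
  then have \<alpha>: "\<alpha> = ?A1 \<oplus>\<^bsub>E0\<^esub> ?A2" by (simp add: E.M.a_ac)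
  have d1: "G (?M + k) \<odot>\<^bsub>E1\<^esub> d 0 \<alpha>1 = \<zero>\<^bsub>E1\<^esub>" and d2: "F (?M + k) \<odot>\<^bsub>E1\<^esub> d 0 \<alpha>2 = \<zero>\<^bsub>E1\<^esub>"
    using arg_cong[OF G1, of "d 0"] arg_cong[OF F2, of "d 0"] by (simp_all add: d_smult)
  have s1: "G m \<odot>\<^bsub>E1\<^esub> d 0 \<sigma>1 = \<zero>\<^bsub>E1\<^esub>" and s2: "F m \<odot>\<^bsub>E1\<^esub> d 0 \<sigma>2 = \<zero>\<^bsub>E1\<^esub>"
    using arg_cong[OF \<sigma>(4), of "d 0"] arg_cong[OF \<sigma>(5), of "d 0"] by (simp_all add: d_smult)
  let ?L = "max (?M + k) m"
  have N_le: "N \<le> ?L" by simp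
  have G0: "G ?L \<odot>\<^bsub>E1\<^esub> d 0 \<alpha>1 = \<zero>\<^bsub>E1\<^esub>" "G ?L \<odot>\<^bsub>E1\<^esub> d 0 \<sigma>1 = \<zero>\<^bsub>E1\<^esub>" "G ?L \<odot>\<^bsub>E1\<^esub> \<gamma> = \<zero>\<^bsub>E1\<^esub>"
    using pow_smult_zero_mono[OF _ _ d1, of ?L] pow_smult_zero_mono[OF _ _ s1, of ?L]
      pow_smult_zero_mono[OF _ _ *(5) N_le] by simp_all
  have F0: "F ?L \<odot>\<^bsub>E1\<^esub> d 0 \<alpha>2 = \<zero>\<^bsub>E1\<^esub>" "F ?L \<odot>\<^bsub>E1\<^esub> d 0 \<sigma>2 = \<zero>\<^bsub>E1\<^esub>" "F ?L \<odot>\<^bsub>E1\<^esub> \<beta> = \<zero>\<^bsub>E1\<^esub>"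
    using pow_smult_zero_mono[OF _ _ d2, of ?L] pow_smult_zero_mono[OF _ _ s2, of ?L]
      pow_smult_zero_mono[OF _ _ *(4) N_le] by simp_all
  have d\<alpha>: "d 0 \<alpha> = d 0 ?A1 \<oplus>\<^bsub>E1\<^esub> d 0 ?A2"
    unfolding \<alpha> by (rule d_add) simp_all
  \<comment> \<open>Written as \<beta> - d \<open>?A2\<close> it is killed by a power of
    \<open>f\<close>; written as d \<open>?A1\<close> + \<gamma> it is killed by a power of
    \<open>g\<close>.\<close>
  define \<eta> where "\<eta> = \<beta> \<ominus>\<^bsub>E1\<^esub> d 0 ?A2"
  have "\<eta> = d 0 ?A1 \<oplus>\<^bsub>E1\<^esub> \<gamma>"
  proof -
    have "\<beta> = d 0 ?A2 \<oplus>\<^bsub>E1\<^esub> (d 0 ?A1 \<oplus>\<^bsub>E1\<^esub> \<gamma>)"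
      unfolding *(6)[symmetric] d\<alpha> by (simp add: E.M.a_ac)
    then show ?thesis unfolding \<eta>_def a_minus_def
      by (simp add: E.M.a_comm[of _ _ "\<ominus>\<^bsub>E1\<^esub> d 0 ?A2"] E.M.r_neg1)
  qed
  then have "G ?L \<odot>\<^bsub>E1\<^esub> \<eta> = \<zero>\<^bsub>E1\<^esub>" by (simp add: d_add E.smult_r_distr G0)
  moreover have "F ?L \<odot>\<^bsub>E1\<^esub> \<eta> = \<zero>\<^bsub>E1\<^esub>"
    by (simp add: \<eta>_def a_minus_def d_add E.smult_r_distr E.smult_r_minus F0)
  moreover have \<eta>: "\<eta> \<in> grade E1 c"
    unfolding \<eta>_def by (intro E.grade_minus d_grade E.grade_add * \<alpha>2 \<sigma>)
  moreover have "d (Suc 0) \<eta> = v"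
    unfolding *(7)[symmetric] by (simp add: \<eta>_def a_minus_def d_add[of \<beta>] d_uminus)
  ultimately show ?thesis unfolding coboundary_def fg_torsion_def by blast
qed

text \<open>If v = d \<eta> with \<eta> torsion for both elements, then \<beta> - \<eta> = d
  \<alpha>2 and \<eta> - \<gamma> = d \<alpha>1. A power of \<open>f\<close> brings \<alpha>2 into
  the ring, a power of \<open>g\<close> brings \<alpha>1 there, and \<alpha> - \<alpha>1 - \<alpha>2
  lies in it already. Thus u / (fg)^k = b / g^n + a / f^n + p, and clearing denominators gives the
  equation.\<close>

lemma coboundary_represents:
  assumes rep: "represents c v k u" and "coboundary c v"
  obtains j a b where "a \<in> grade S (scale (k + j) e + c)" "b \<in> grade S (scale (k + j) e + c)"
    "P j \<otimes>\<^bsub>S\<^esub> u = F (k + j) \<otimes>\<^bsub>S\<^esub> a \<oplus>\<^bsub>S\<^esub> G (k + j) \<otimes>\<^bsub>S\<^esub> b"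
proof -
  obtain \<alpha> \<beta> \<gamma> N where *:
    "\<alpha> \<in> grade E0 c" "\<beta> \<in> grade E1 c" "\<gamma> \<in> grade E1 c"
    "F N \<odot>\<^bsub>E1\<^esub> \<beta> = \<zero>\<^bsub>E1\<^esub>" "G N \<odot>\<^bsub>E1\<^esub> \<gamma> = \<zero>\<^bsub>E1\<^esub>" "d 0 \<alpha> \<oplus>\<^bsub>E1\<^esub> \<gamma> = \<beta>" "d (Suc 0) \<beta> = v"
    "P (N + k) \<odot>\<^bsub>E0\<^esub> \<alpha> = P N \<odot>\<^bsub>E0\<^esub> \<epsilon> u" "u \<in> grade S (scale k (e + e) + c)"
    using rep by (rule representsE)
  obtain \<eta> n where \<eta>: "\<eta> \<in> grade E1 c" "F n \<odot>\<^bsub>E1\<^esub> \<eta> = \<zero>\<^bsub>E1\<^esub>" "G n \<odot>\<^bsub>E1\<^esub> \<eta> = \<zero>\<^bsub>E1\<^esub>" "v = d (Suc 0) \<eta>"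
    using assms(2) unfolding coboundary_def fg_torsion_def by blast
  note [simp] = E.grade_carrier[OF *(1)] E.grade_carrier[OF *(2)] E.grade_carrier[OF *(3)]
    E.grade_carrier[OF \<eta>(1)] grade_carrier[OF *(9)]
  have d\<gamma>: "d (Suc 0) \<gamma> = v" using *(7) by (simp add: d_add flip: *(6))
  have "d (Suc 0) (\<beta> \<ominus>\<^bsub>E1\<^esub> \<eta>) = \<zero>\<^bsub>E2\<^esub>" "d (Suc 0) (\<eta> \<ominus>\<^bsub>E1\<^esub> \<gamma>) = \<zero>\<^bsub>E2\<^esub>"
    using *(7) \<eta>(4) d\<gamma> by (simp_all add: a_minus_def d_add d_uminus E.M.r_neg)
  then obtain \<alpha>2 \<alpha>1 where \<alpha>2: "\<alpha>2 \<in> grade E0 c" "\<beta> \<ominus>\<^bsub>E1\<^esub> \<eta> = d 0 \<alpha>2"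
    and \<alpha>1: "\<alpha>1 \<in> grade E0 c" "\<eta> \<ominus>\<^bsub>E1\<^esub> \<gamma> = d 0 \<alpha>1"
    using exact_Suc[OF E.grade_minus[OF *(2) \<eta>(1)]] exact_Suc[OF E.grade_minus[OF \<eta>(1) *(3)]] by blast
  note [simp] = E.grade_carrier[OF \<alpha>1(1)] E.grade_carrier[OF \<alpha>2(1)]
  let ?n = "max N n"
  have le: "N \<le> ?n" "n \<le> ?n" by auto
  have "F ?n \<odot>\<^bsub>E1\<^esub> d 0 \<alpha>2 = \<zero>\<^bsub>E1\<^esub>"
    using pow_smult_zero_mono[OF _ _ *(4) le(1)] pow_smult_zero_mono[OF _ _ \<eta>(2) le(2)]
    by (simp add: a_minus_def E.smult_r_distr E.smult_r_minus flip: \<alpha>2(2))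
  then have "d 0 (F ?n \<odot>\<^bsub>E0\<^esub> \<alpha>2) = \<zero>\<^bsub>E1\<^esub>" by (simp add: d_smult)
  with exact_0[OF E.grade_smult[OF pow_grade[OF f] \<alpha>2(1)]]
  obtain a where a: "a \<in> grade S (scale ?n e + c)" "F ?n \<odot>\<^bsub>E0\<^esub> \<alpha>2 = \<epsilon> a" by blast
  have "G ?n \<odot>\<^bsub>E1\<^esub> d 0 \<alpha>1 = \<zero>\<^bsub>E1\<^esub>"
    using pow_smult_zero_mono[OF _ _ *(5) le(1)] pow_smult_zero_mono[OF _ _ \<eta>(3) le(2)]
    by (simp add: a_minus_def E.smult_r_distr E.smult_r_minus flip: \<alpha>1(2))
  then have "d 0 (G ?n \<odot>\<^bsub>E0\<^esub> \<alpha>1) = \<zero>\<^bsub>E1\<^esub>" by (simp add: d_smult)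
  with exact_0[OF E.grade_smult[OF pow_grade[OF g] \<alpha>1(1)]]
  obtain b where b: "b \<in> grade S (scale ?n e + c)" "G ?n \<odot>\<^bsub>E0\<^esub> \<alpha>1 = \<epsilon> b" by blast
  have "d 0 \<alpha> = d 0 \<alpha>1 \<oplus>\<^bsub>E1\<^esub> d 0 \<alpha>2"
  proof -
    have "\<gamma> \<oplus>\<^bsub>E1\<^esub> (d 0 \<alpha>1 \<oplus>\<^bsub>E1\<^esub> d 0 \<alpha>2) = \<beta>"
      using E.M.add_minus_cancel[of \<gamma> "Suc 0" \<eta>] E.M.add_minus_cancel[of \<eta> "Suc 0" \<beta>] \<alpha>1(2) \<alpha>2(2)
      by (simp flip: E.M.a_assoc)
    also have "\<dots> = \<gamma> \<oplus>\<^bsub>E1\<^esub> d 0 \<alpha>" using *(6) by (simp add: E.M.a_comm)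
    finally show ?thesis by simp
  qed
  then have "d 0 (\<alpha> \<ominus>\<^bsub>E0\<^esub> (\<alpha>1 \<oplus>\<^bsub>E0\<^esub> \<alpha>2)) = \<zero>\<^bsub>E1\<^esub>"
    by (simp add: a_minus_def d_add[of \<alpha>] d_uminus d_add[of \<alpha>1] E.M.r_neg)
  with exact_0[OF E.grade_minus[OF *(1) E.grade_add[OF \<alpha>1(1) \<alpha>2(1)]]]
  obtain p where p: "p \<in> grade S c" "\<alpha> \<ominus>\<^bsub>E0\<^esub> (\<alpha>1 \<oplus>\<^bsub>E0\<^esub> \<alpha>2) = \<epsilon> p" by blast
  note [simp] = grade_carrier[OF a(1)] grade_carrier[OF b(1)] grade_carrier[OF p(1)]
  have \<alpha>: "\<alpha> = (\<alpha>1 \<oplus>\<^bsub>E0\<^esub> \<alpha>2) \<oplus>\<^bsub>E0\<^esub> \<epsilon> p"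
    using E.M.add_minus_cancel[of "\<alpha>1 \<oplus>\<^bsub>E0\<^esub> \<alpha>2" 0 \<alpha>] p(2) by simp
  have "P ?n \<odot>\<^bsub>E0\<^esub> \<alpha> = \<epsilon> (F ?n \<otimes>\<^bsub>S\<^esub> b \<oplus>\<^bsub>S\<^esub> G ?n \<otimes>\<^bsub>S\<^esub> a \<oplus>\<^bsub>S\<^esub> P ?n \<otimes>\<^bsub>S\<^esub> p)"
    unfolding \<alpha> by (simp add: E.smult_r_distr P_smult(1)[of \<alpha>1] P_smult(2)[of \<alpha>2] a(2) b(2) eps_add eps_mult)
  then have "P k \<odot>\<^bsub>E0\<^esub> (P ?n \<odot>\<^bsub>E0\<^esub> \<alpha>) =
      \<epsilon> (P k \<otimes>\<^bsub>S\<^esub> (F ?n \<otimes>\<^bsub>S\<^esub> b \<oplus>\<^bsub>S\<^esub> G ?n \<otimes>\<^bsub>S\<^esub> a \<oplus>\<^bsub>S\<^esub> P ?n \<otimes>\<^bsub>S\<^esub> p))"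
    by (simp add: eps_mult[of "P k"])
  moreover have "P k \<odot>\<^bsub>E0\<^esub> (P ?n \<odot>\<^bsub>E0\<^esub> \<alpha>) = P (?n + k) \<odot>\<^bsub>E0\<^esub> \<alpha>"
    by (simp add: R.nat_pow_mult add.commute flip: E.smult_assoc1)
  moreover have "P (?n + k) \<odot>\<^bsub>E0\<^esub> \<alpha> = P ?n \<odot>\<^bsub>E0\<^esub> \<epsilon> u"
    by (rule pow_smult_mono[OF _ _ _ *(8)]) simp_all
  ultimately have "\<epsilon> (P ?n \<otimes>\<^bsub>S\<^esub> u) =
      \<epsilon> (P k \<otimes>\<^bsub>S\<^esub> (F ?n \<otimes>\<^bsub>S\<^esub> b \<oplus>\<^bsub>S\<^esub> G ?n \<otimes>\<^bsub>S\<^esub> a \<oplus>\<^bsub>S\<^esub> P ?n \<otimes>\<^bsub>S\<^esub> p))"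
    by (simp add: eps_mult[of "P ?n"])
  then have eq: "P ?n \<otimes>\<^bsub>S\<^esub> u =
      P k \<otimes>\<^bsub>S\<^esub> (F ?n \<otimes>\<^bsub>S\<^esub> b \<oplus>\<^bsub>S\<^esub> G ?n \<otimes>\<^bsub>S\<^esub> a \<oplus>\<^bsub>S\<^esub> P ?n \<otimes>\<^bsub>S\<^esub> p)"
    by (rule eps_inj[rotated 2]) simp_all
  \<comment> \<open>Expand (fg)^k (f^n b + g^n a + (fg)^n p) and collect by powers; the term with
    \<open>p\<close> may join either side and is put with f^(k+n).\<close>
  show thesis
  proof (rule that[of "G k \<otimes>\<^bsub>S\<^esub> b \<oplus>\<^bsub>S\<^esub> G (k + ?n) \<otimes>\<^bsub>S\<^esub> p" ?n "F k \<otimes>\<^bsub>S\<^esub> a"])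
    show "G k \<otimes>\<^bsub>S\<^esub> b \<oplus>\<^bsub>S\<^esub> G (k + ?n) \<otimes>\<^bsub>S\<^esub> p \<in> grade S (scale (k + ?n) e + c)"
      using mult_grade[OF pow_grade[OF g] b(1), of k] mult_grade[OF pow_grade[OF g] p(1), of "k + ?n"]
      by (intro grade_add) (simp_all add: scale_add add.assoc)
    show "F k \<otimes>\<^bsub>S\<^esub> a \<in> grade S (scale (k + ?n) e + c)"
      using mult_grade[OF pow_grade[OF f] a(1), of k] by (simp add: scale_add add.assoc)
    show "P ?n \<otimes>\<^bsub>S\<^esub> u = F (k + ?n) \<otimes>\<^bsub>S\<^esub> (G k \<otimes>\<^bsub>S\<^esub> b \<oplus>\<^bsub>S\<^esub> G (k + ?n) \<otimes>\<^bsub>S\<^esub> p) \<oplus>\<^bsub>S\<^esub>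
        G (k + ?n) \<otimes>\<^bsub>S\<^esub> (F k \<otimes>\<^bsub>S\<^esub> a)"
      unfolding eq by (simp add: P_eq R.r_distr flip: R.nat_pow_mult) (simp add: R.m_ac R.a_ac)
  qed
qed

end

section \<open>Direct limits and cohomology\<close>

lemma transition_add: "transition \<phi> k (m + n) u = transition \<phi> (k + m) n (transition \<phi> k m u)"
  by (induct n) (simp_all add: add.assoc)

lemma transition_diff:
  "k \<le> j \<Longrightarrow> transition \<phi> j n (transition \<phi> k (j - k) u) = transition \<phi> k (j + n - k) u"
  using transition_add[of \<phi> k "j - k" n u] by simp

text \<open>The isomorphism sends \<open>X\<close> to the set of all pairs \<open>(l, V)\<close>
  related to it, so no representative is ever chosen. Condition \<open>eq\<close> yields both that
  the map is well defined and that it is injective.\<close>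

lemma module_isomorphic_direct_limitI:
  fixes C :: "('r, 'm, 'x) module_scheme" and M :: "nat \<Rightarrow> ('r, 'n, 'y) module_scheme"
  assumes carr: "\<And>X k U. rel X k U \<Longrightarrow> X \<in> carrier C \<and> k0 \<le> k \<and> U \<in> carrier (M k)"
    and left: "\<And>X. X \<in> carrier C \<Longrightarrow> \<exists>k U. rel X k U"
    and right: "\<And>k U. k0 \<le> k \<Longrightarrow> U \<in> carrier (M k) \<Longrightarrow> \<exists>X. rel X k U"
    and add: "\<And>X Y k U V. rel X k U \<Longrightarrow> rel Y k V \<Longrightarrow> rel (X \<oplus>\<^bsub>C\<^esub> Y) k (U \<oplus>\<^bsub>M k\<^esub> V)"
    and smult: "\<And>a X k U. a \<in> carrier R \<Longrightarrow> rel X k U \<Longrightarrow> rel (a \<odot>\<^bsub>C\<^esub> X) k (a \<odot>\<^bsub>M k\<^esub> U)"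
    and step: "\<And>X k U. rel X k U \<Longrightarrow> rel X (Suc k) (\<phi> k U)"
    and eq: "\<And>X Y k U V. rel X k U \<Longrightarrow> rel Y k V \<Longrightarrow>
      X = Y \<longleftrightarrow> (\<exists>n. transition \<phi> k n U = transition \<phi> k n V)"
  shows "module_isomorphic R C (direct_limit k0 M \<phi>)"
proof -
  let ?r = "dirlim_rel k0 M \<phi>" and ?L = "direct_limit k0 M \<phi>"
  define F where "F X = {(l, V). rel X l V}" for X
  have steps: "rel X (k + n) (transition \<phi> k n U)" if "rel X k U" for X k n U
    using that by (induct n) (auto dest: step)
  then have steps': "rel X l (transition \<phi> k (l - k) U)" if "rel X k U" "k \<le> l" for X k l U
    using that by (metis le_add_diff_inverse)
  \<comment> \<open>The related pairs form a full class. A pair equivalent to \<open>(k, U)\<close>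
    is related to some \<open>Y\<close> by \<open>right\<close>, and comparing at a common index
    gives X = Y. Conversely, two pairs related to \<open>X\<close> become equal after finitely many
    transitions.\<close>
  have class_eq: "?r `` {(k, U)} = F X" if rel: "rel X k U" for X k U
  proof (intro equalityI subsetI)
    fix p assume "p \<in> ?r `` {(k, U)}"
    then obtain l V j where p: "p = (l, V)" and j: "k0 \<le> l" "V \<in> carrier (M l)" "k \<le> j" "l \<le> j"
      "transition \<phi> k (j - k) U = transition \<phi> l (j - l) V"
      by (auto simp: dirlim_rel_def)
    then obtain Y where Y: "rel Y l V" using right by blast
    have "X = Y"
      using eq[OF steps'[OF rel j(3)] steps'[OF Y j(4)]] j(5) by (auto intro: exI[of _ 0])
    then show "p \<in> F X" using Y p by (simp add: F_def)
  next
    fix p assume "p \<in> F X"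
    then obtain l V where p: "p = (l, V)" and V: "rel X l V" by (auto simp: F_def)
    let ?j = "max k l"
    obtain n where "transition \<phi> ?j n (transition \<phi> k (?j - k) U) = transition \<phi> ?j n (transition \<phi> l (?j - l) V)"
      using eq[OF steps'[OF rel, of ?j] steps'[OF V, of ?j]] by auto
    then have "transition \<phi> k (?j + n - k) U = transition \<phi> l (?j + n - l) V"
      by (simp only: transition_diff max.cobounded1 max.cobounded2)
    then show "p \<in> ?r `` {(k, U)}"
      using carr[OF rel] carr[OF V] p by (auto simp: dirlim_rel_def intro!: exI[of _ "?j + n"])
  qed
  have common: "\<exists>k U V. rel X k U \<and> rel Y k V" if "X \<in> carrier C" "Y \<in> carrier C" for X Y
  proof -
    obtain k U l V where "rel X k U" "rel Y l V" using left \<open>X \<in> carrier C\<close> \<open>Y \<in> carrier C\<close> by meson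
    then show ?thesis using steps'[of X k U "max k l"] steps'[of Y l V "max k l"] by auto
  qed
  have inj: "X = Y" if "X \<in> carrier C" "F X = F Y" for X Y
  proof -
    obtain k U where U: "rel X k U" using left \<open>X \<in> carrier C\<close> by blast
    then have "(k, U) \<in> F Y" using \<open>F X = F Y\<close> by (auto simp: F_def)
    then have "rel Y k U" by (simp add: F_def)
    then show ?thesis using eq[OF U] by blast
  qed
  show ?thesis
    unfolding module_isomorphic_def
  proof (rule bexI[of _ F])
    have "F X \<in> carrier ?L" if "X \<in> carrier C" for X
    proof -
      obtain k U where U: "rel X k U" using left \<open>X \<in> carrier C\<close> by blast
      then have "(k, U) \<in> (SIGMA k:{k0..}. carrier (M k))" using carr by auto
      then show ?thesis by (simp add: direct_limit_def quotientI flip: class_eq[OF U])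
    qed
    moreover have "P \<in> F ` carrier C" if Q: "P \<in> carrier ?L" for P
    proof -
      obtain k U where P: "P = ?r `` {(k, U)}" "k0 \<le> k" "U \<in> carrier (M k)"
        using Q by (auto simp: direct_limit_def elim!: quotientE)
      then obtain X where X: "rel X k U" using right by blast
      then show ?thesis using P(1) class_eq[OF X] carr[OF X] by blast
    qed
    ultimately show "bij_betw F (carrier C) (carrier ?L)"
      by (auto simp: bij_betw_def inj_on_def intro: inj)
    have "F (X \<oplus>\<^bsub>C\<^esub> Y) = F X \<oplus>\<^bsub>?L\<^esub> F Y" if XY: "X \<in> carrier C" "Y \<in> carrier C" for X Y
    proof -
      have *: "?r `` {(max k l, transition \<phi> k (max k l - k) U \<oplus>\<^bsub>M (max k l)\<^esub> transition \<phi> l (max k l - l) V)}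
          = F (X \<oplus>\<^bsub>C\<^esub> Y)" if "rel X k U" "rel Y l V" for k l U V
        by (intro class_eq add steps' that) auto
      obtain k U V where UV: "(k, U) \<in> F X" "(k, V) \<in> F Y" using common[OF XY] by (auto simp: F_def)
      \<comment> \<open>Addition in the limit is a union over all representatives. All its members
        are the same set, and there is at least one of them.\<close>
      have "F X \<oplus>\<^bsub>?L\<^esub> F Y = (\<Union>p\<in>F X. \<Union>q\<in>F Y. F (X \<oplus>\<^bsub>C\<^esub> Y))"
        unfolding direct_limit_def ring.simps case_prod_unfold
        by (intro SUP_cong refl *) (simp_all add: F_def case_prod_unfold)
      also have "\<dots> = F (X \<oplus>\<^bsub>C\<^esub> Y)" using UV by auto
      finally show ?thesis by simp
    qed
    moreover have "F (a \<odot>\<^bsub>C\<^esub> X) = a \<odot>\<^bsub>?L\<^esub> F X" if a: "a \<in> carrier R" and X: "X \<in> carrier C" for a X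
    proof -
      obtain k U where "(k, U) \<in> F X" using left[OF X] by (auto simp: F_def)
      moreover have "a \<odot>\<^bsub>?L\<^esub> F X = (\<Union>p\<in>F X. F (a \<odot>\<^bsub>C\<^esub> X))"
        unfolding direct_limit_def module.simps case_prod_unfold
        by (intro SUP_cong refl class_eq smult a) (simp add: F_def case_prod_unfold)
      ultimately show ?thesis by auto
    qed
    ultimately show "F \<in> module_hom R C ?L"
      using \<open>\<And>X. X \<in> carrier C \<Longrightarrow> F X \<in> carrier ?L\<close> by (simp add: module_hom_def)
  qed
qed

section \<open>Cosets, ideals with two generators and powers of ideals\<close>

lemma (in abelian_group) a_coset_eq_iff:
  assumes N: "additive_subgroup N G" and "u \<in> carrier G" "v \<in> carrier G"
  shows "N +> u = N +> v \<longleftrightarrow> u \<ominus> v \<in> N"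
proof -
  interpret N: additive_subgroup N G by fact
  have sub: "N \<subseteq> carrier G" by (rule N.a_subset)
  show ?thesis
  proof
    assume "N +> u = N +> v"
    then have "N +> (u \<oplus> \<ominus> v) = N" using a_coset_add_inv2[OF _ assms(2,3) sub] by blast
    then show "u \<ominus> v \<in> N"
      using a_coset_join1[OF _ _ N.a_subgroup] assms by (simp add: a_minus_def)
  next
    assume "u \<ominus> v \<in> N"
    then have "N +> (u \<oplus> \<ominus> v) = N"
      using a_coset_join2[OF _ N.a_subgroup] assms by (simp add: a_minus_def)
    then show "N +> u = N +> v" using a_coset_add_inv1[OF _ assms(2,3) sub] by blast
  qed
qed

text \<open>Scalar multiplication in \<open>quot_module\<close> and the map
  \<open>system_map\<close> are unions over the elements of a coset. The members of such a union
  coincide, so it is the coset of the image of one representative.\<close>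

lemma (in abelian_group) a_coset_map:
  assumes N: "additive_subgroup N G" "additive_subgroup N' G"
    and h: "\<And>v. v \<in> carrier G \<Longrightarrow> h v \<in> carrier G"
      "\<And>v w. v \<in> carrier G \<Longrightarrow> w \<in> carrier G \<Longrightarrow> h (v \<oplus> w) = h v \<oplus> h w"
      "\<And>v. v \<in> N \<Longrightarrow> h v \<in> N'"
    and u: "u \<in> carrier G"
  shows "(\<Union>c\<in>N +> u. N' +> h c) = N' +> h u"
proof -
  interpret N: additive_subgroup N G by fact
  have "N' +> h c = N' +> h u" if c: "c \<in> N +> u" for c
  proof -
    obtain v where v: "v \<in> N" "c = v \<oplus> u" using c by (auto simp: a_r_coset_def')
    then have "h c \<ominus> h u = h v"
      using u h N.a_subset by (auto simp: a_minus_def a_assoc r_neg)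
    then show ?thesis using v u h N.a_subset by (subst a_coset_eq_iff[OF N(2)]) auto
  qed
  moreover have "u \<in> N +> u"
    using N.zero_closed u by (force simp: a_r_coset_def')
  ultimately show ?thesis by blast
qed

lemma (in abelian_group) a_coset_add:
  assumes "additive_subgroup N G" "u \<in> carrier G" "v \<in> carrier G"
  shows "(N +> u) <+> (N +> v) = N +> (u \<oplus> v)"
  using abelian_subgroup.a_rcos_sum[OF abelian_subgroupI3[OF assms(1) abelian_group_axioms]] assms by blast

lemma (in cring) genideal_pair:
  assumes "a \<in> carrier R" "b \<in> carrier R"
  shows "genideal R {a, b} = {s \<otimes> a \<oplus> t \<otimes> b |s t. s \<in> carrier R \<and> t \<in> carrier R}" (is "_ = ?K")
proof
  have "ideal ?K R"
  proof (rule idealI[OF ring_axioms])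
    show "subgroup ?K (add_monoid R)"
    proof (rule add.subgroupI)
      show "?K \<subseteq> carrier R" using assms by auto
      show "?K \<noteq> {}" by blast
      fix u assume "u \<in> ?K"
      then obtain s t where u: "u = s \<otimes> a \<oplus> t \<otimes> b" "s \<in> carrier R" "t \<in> carrier R" by blast
      have "\<ominus> u = (\<ominus> s) \<otimes> a \<oplus> (\<ominus> t) \<otimes> b" using u assms by (simp add: minus_add l_minus)
      then show "\<ominus> u \<in> ?K" using u a_inv_closed by blast
      fix v assume "v \<in> ?K"
      then obtain s' t' where v: "v = s' \<otimes> a \<oplus> t' \<otimes> b" "s' \<in> carrier R" "t' \<in> carrier R" by blast
      have "u \<oplus> v = (s \<oplus> s') \<otimes> a \<oplus> (t \<oplus> t') \<otimes> b" using u v assms by (simp add: l_distr a_ac)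
      then show "u \<oplus> v \<in> ?K" using u v a_closed by blast
    qed
    fix u w assume "u \<in> ?K" and w: "w \<in> carrier R"
    then obtain s t where u: "u = s \<otimes> a \<oplus> t \<otimes> b" "s \<in> carrier R" "t \<in> carrier R" by blast
    have "w \<otimes> u = (w \<otimes> s) \<otimes> a \<oplus> (w \<otimes> t) \<otimes> b" using u w assms by (simp add: r_distr m_assoc)
    then show "w \<otimes> u \<in> ?K" using u w m_closed by blast
    then show "u \<otimes> w \<in> ?K" using u w assms by (simp add: m_comm)
  qed
  moreover have "a = \<one> \<otimes> a \<oplus> \<zero> \<otimes> b" "b = \<zero> \<otimes> a \<oplus> \<one> \<otimes> b" using assms by simp_all
  then have "{a, b} \<subseteq> ?K" by blast
  ultimately show "genideal R {a, b} \<subseteq> ?K" by (rule genideal_minimal)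
  interpret K: ideal "genideal R {a, b}" R by (rule genideal_ideal) (use assms in auto)
  have "a \<in> genideal R {a, b}" "b \<in> genideal R {a, b}" using genideal_self[of "{a, b}"] assms by auto
  then show "?K \<subseteq> genideal R {a, b}" using K.I_l_closed K.a_closed by blast
qed

lemma ideal_pow_0 [simp]: "ideal_pow R I 0 = carrier R"
  by (simp add: ideal_pow_def ideals_set_def)

lemma ideal_pow_Suc: "ideal_pow R I (Suc n) = ideal_prod R (ideal_pow R I n) I"
  by (simp add: ideal_pow_def ideals_set_def)

lemma (in ring) ideal_pow_ideal: "ideal I R \<Longrightarrow> ideal (ideal_pow R I n) R"
  by (induct n) (simp_all add: oneideal ideal_pow_Suc ideal_prod_is_ideal)

lemma (in cring) ideal_pow_1: "ideal I R \<Longrightarrow> ideal_pow R I (Suc 0) = I"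
  by (simp add: ideal_pow_Suc ideal_prod_commute[OF oneideal] ideal_prod_one)

section \<open>Second cohomology of the torsion subcomplex\<close>

context graded_resolution_pair
begin

text \<open>If f^p and g^q kill \<open>v\<close>, then so does the ideal power with exponent p + q.
  By induction: f v is killed by f^(p-1) and g^q, g v by f^p and g^(q-1), and one factor of the
  ideal power is a combination of \<open>f\<close> and \<open>g\<close>.\<close>

lemma torsion_iff:
  assumes v: "v \<in> carrier (E i)"
  shows "(\<exists>n. \<forall>a\<in>ideal_pow S (genideal S {f, g}) n. a \<odot>\<^bsub>E i\<^esub> v = \<zero>\<^bsub>E i\<^esub>) \<longleftrightarrow> fg_torsion i v"
proof
  let ?A = "genideal S {f, g}"
  have A: "ideal ?A S" by (rule R.genideal_ideal) simp
  have mem: "h [^]\<^bsub>S\<^esub> n \<in> ideal_pow S ?A n" if "h \<in> {f, g}" for h and n :: nat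
  proof (induct n)
    case (Suc n)
    have "h \<in> ?A" using that R.genideal_self[of "{f, g}"] by auto
    with Suc show ?case by (simp add: ideal_pow_Suc ideal_prod.prod)
  qed simp
  show "fg_torsion i v" if "\<exists>n. \<forall>a\<in>ideal_pow S ?A n. a \<odot>\<^bsub>E i\<^esub> v = \<zero>\<^bsub>E i\<^esub>"
    using that mem unfolding fg_torsion_def by blast
  have "a \<odot>\<^bsub>E i\<^esub> v = \<zero>\<^bsub>E i\<^esub>"
    if "p + q = n" "F p \<odot>\<^bsub>E i\<^esub> v = \<zero>\<^bsub>E i\<^esub>" "G q \<odot>\<^bsub>E i\<^esub> v = \<zero>\<^bsub>E i\<^esub>" "v \<in> carrier (E i)" "a \<in> ideal_pow S ?A n"
    for n p q a v
    using that
  proof (induct n arbitrary: p q a v)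
    case 0
    then show ?case by simp
  next
    case (Suc n)
    note [simp] = \<open>v \<in> carrier (E i)\<close>
    show ?case
    proof (cases "p = 0 \<or> q = 0")
      case True
      then have "v = \<zero>\<^bsub>E i\<^esub>" using Suc.prems(2,3) by auto
      moreover have "a \<in> carrier S"
        using Suc.prems(5) ideal.Icarr[OF R.ideal_pow_ideal[OF A]] by blast
      ultimately show ?thesis by simp
    next
      case False
      then obtain p' q' where pq: "p = Suc p'" "q = Suc q'" by (metis not0_implies_Suc)
      have sw: "h \<odot>\<^bsub>E i\<^esub> (t \<odot>\<^bsub>E i\<^esub> v) = t \<odot>\<^bsub>E i\<^esub> (h \<odot>\<^bsub>E i\<^esub> v)" if "h \<in> carrier S" "t \<in> carrier S" for h t
        using that by (simp add: R.m_comm flip: E.smult_assoc1)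
      have IH: "b \<odot>\<^bsub>E i\<^esub> (f \<odot>\<^bsub>E i\<^esub> v) = \<zero>\<^bsub>E i\<^esub>" "b \<odot>\<^bsub>E i\<^esub> (g \<odot>\<^bsub>E i\<^esub> v) = \<zero>\<^bsub>E i\<^esub>" if "b \<in> ideal_pow S ?A n" for b
      proof -
        have "F p' \<odot>\<^bsub>E i\<^esub> (f \<odot>\<^bsub>E i\<^esub> v) = \<zero>\<^bsub>E i\<^esub>" "G q' \<odot>\<^bsub>E i\<^esub> (g \<odot>\<^bsub>E i\<^esub> v) = \<zero>\<^bsub>E i\<^esub>"
          using Suc.prems(2,3) pq by (simp_all flip: E.smult_assoc1)
        moreover have "G q \<odot>\<^bsub>E i\<^esub> (f \<odot>\<^bsub>E i\<^esub> v) = \<zero>\<^bsub>E i\<^esub>" "F p \<odot>\<^bsub>E i\<^esub> (g \<odot>\<^bsub>E i\<^esub> v) = \<zero>\<^bsub>E i\<^esub>"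
          using Suc.prems(2,3) by (simp_all add: sw)
        ultimately show "b \<odot>\<^bsub>E i\<^esub> (f \<odot>\<^bsub>E i\<^esub> v) = \<zero>\<^bsub>E i\<^esub>" "b \<odot>\<^bsub>E i\<^esub> (g \<odot>\<^bsub>E i\<^esub> v) = \<zero>\<^bsub>E i\<^esub>"
          using Suc.hyps[of p' q "f \<odot>\<^bsub>E i\<^esub> v" b] Suc.hyps[of p q' "g \<odot>\<^bsub>E i\<^esub> v" b] Suc.prems(1) pq that
          by simp_all
      qed
      have "a \<in> ideal_prod S (ideal_pow S ?A n) ?A" using Suc.prems(5) by (simp add: ideal_pow_Suc)
      then have "a \<in> carrier S \<and> a \<odot>\<^bsub>E i\<^esub> v = \<zero>\<^bsub>E i\<^esub>"
      proof (induct rule: ideal_prod.induct)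
        case (prod b c)
        obtain s t where c: "c = s \<otimes>\<^bsub>S\<^esub> f \<oplus>\<^bsub>S\<^esub> t \<otimes>\<^bsub>S\<^esub> g" "s \<in> carrier S" "t \<in> carrier S"
          using prod(2) R.genideal_pair[of f g] by auto
        have [simp]: "b \<in> carrier S" using prod(1) ideal.Icarr[OF R.ideal_pow_ideal[OF A]] by blast
        have "(b \<otimes>\<^bsub>S\<^esub> c) \<odot>\<^bsub>E i\<^esub> v =
            s \<odot>\<^bsub>E i\<^esub> (b \<odot>\<^bsub>E i\<^esub> (f \<odot>\<^bsub>E i\<^esub> v)) \<oplus>\<^bsub>E i\<^esub> t \<odot>\<^bsub>E i\<^esub> (b \<odot>\<^bsub>E i\<^esub> (g \<odot>\<^bsub>E i\<^esub> v))"
          using c(2,3) unfolding c(1)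
          by (simp add: R.r_distr E.smult_l_distr R.m_lcomm[of b] flip: E.smult_assoc1)
        then show ?case using IH[OF prod(1)] c by simp
      next
        case (sum b c)
        then show ?case by (simp add: E.smult_l_distr)
      qed
      then show ?thesis by simp
    qed
  qed
  then show "\<exists>n. \<forall>a\<in>ideal_pow S ?A n. a \<odot>\<^bsub>E i\<^esub> v = \<zero>\<^bsub>E i\<^esub>" if "fg_torsion i v"
    using that v unfolding fg_torsion_def by blast
qed

definition boundaries :: "'e set" where
  "boundaries = d (Suc 0) ` {u \<in> carrier E1. fg_torsion (Suc 0) u}"

lemma fg_torsion_add:
  assumes "u \<in> carrier (E i)" "v \<in> carrier (E i)" "fg_torsion i u" "fg_torsion i v"
  shows "fg_torsion i (u \<oplus>\<^bsub>E i\<^esub> v)"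
proof -
  obtain m n where *: "F m \<odot>\<^bsub>E i\<^esub> u = \<zero>\<^bsub>E i\<^esub>" "G m \<odot>\<^bsub>E i\<^esub> u = \<zero>\<^bsub>E i\<^esub>" "F n \<odot>\<^bsub>E i\<^esub> v = \<zero>\<^bsub>E i\<^esub>" "G n \<odot>\<^bsub>E i\<^esub> v = \<zero>\<^bsub>E i\<^esub>"
    using assms unfolding fg_torsion_def by blast
  have le: "m \<le> max m n" "n \<le> max m n" by auto
  have "F (max m n) \<odot>\<^bsub>E i\<^esub> u = \<zero>\<^bsub>E i\<^esub>" "G (max m n) \<odot>\<^bsub>E i\<^esub> u = \<zero>\<^bsub>E i\<^esub>"
    "F (max m n) \<odot>\<^bsub>E i\<^esub> v = \<zero>\<^bsub>E i\<^esub>" "G (max m n) \<odot>\<^bsub>E i\<^esub> v = \<zero>\<^bsub>E i\<^esub>"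
    using * pow_smult_zero_mono[OF _ _ _ le(1)] pow_smult_zero_mono[OF _ _ _ le(2)] assms by simp_all
  then show ?thesis
    using assms unfolding fg_torsion_def by (intro exI[of _ "max m n"]) (simp add: E.smult_r_distr)
qed

lemma fg_torsion_smult:
  assumes "a \<in> carrier S" "v \<in> carrier (E i)" "fg_torsion i v"
  shows "fg_torsion i (a \<odot>\<^bsub>E i\<^esub> v)"
proof -
  have "h \<odot>\<^bsub>E i\<^esub> (a \<odot>\<^bsub>E i\<^esub> v) = a \<odot>\<^bsub>E i\<^esub> (h \<odot>\<^bsub>E i\<^esub> v)" if "h \<in> carrier S" for h
    using that assms by (simp add: R.m_comm flip: E.smult_assoc1)
  moreover obtain n where "F n \<odot>\<^bsub>E i\<^esub> v = \<zero>\<^bsub>E i\<^esub>" "G n \<odot>\<^bsub>E i\<^esub> v = \<zero>\<^bsub>E i\<^esub>"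
    using assms unfolding fg_torsion_def by blast
  ultimately show ?thesis using assms unfolding fg_torsion_def by (intro exI[of _ n]) simp
qed

lemma boundaries_subset: "boundaries \<subseteq> carrier E2"
  by (auto simp: boundaries_def)

lemma boundaries_smult: "a \<in> carrier S \<Longrightarrow> v \<in> boundaries \<Longrightarrow> a \<odot>\<^bsub>E2\<^esub> v \<in> boundaries"
  unfolding boundaries_def by (auto simp flip: d_smult intro!: imageI fg_torsion_smult)

lemma boundaries_subgroup: "additive_subgroup boundaries E2"
proof (rule additive_subgroup.intro, rule E.M.add.subgroupI)
  show "boundaries \<noteq> {}" unfolding boundaries_def fg_torsion_def by (auto intro!: exI[of _ "\<zero>\<^bsub>E1\<^esub>"])
  fix u assume u: "u \<in> boundaries"
  then show "\<ominus>\<^bsub>E2\<^esub> u \<in> boundaries"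
    using boundaries_smult[OF _ u, of "\<ominus>\<^bsub>S\<^esub> \<one>\<^bsub>S\<^esub>"] boundaries_subset by (auto simp: E.smult_l_minus)
  fix v assume "v \<in> boundaries"
  with u show "u \<oplus>\<^bsub>E2\<^esub> v \<in> boundaries"
    unfolding boundaries_def by (auto simp flip: d_add intro!: imageI fg_torsion_add)
qed (rule boundaries_subset)

text \<open>The part of degree \<open>c\<close> of a torsion preimage is a preimage of
  \<open>v\<close>, and it is still torsion because multiplication by the homogeneous powers of
  \<open>f\<close> and \<open>g\<close> commutes with taking parts.\<close>

lemma boundaries_iff_coboundary:
  assumes v: "v \<in> grade E2 c"
  shows "v \<in> boundaries \<longleftrightarrow> coboundary c v"
proof
  assume "v \<in> boundaries"
  then obtain u n where u: "u \<in> carrier E1" "v = d (Suc 0) u" "F n \<odot>\<^bsub>E1\<^esub> u = \<zero>\<^bsub>E1\<^esub>" "G n \<odot>\<^bsub>E1\<^esub> u = \<zero>\<^bsub>E1\<^esub>"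
    unfolding boundaries_def fg_torsion_def by blast
  let ?u = "homog_part E1 u c"
  have "homog_part E2 (d (Suc 0) u) (0 + c) = d (Suc 0) ?u"
    by (rule E.homog_part_map) (simp_all add: u d_add d_grade E.graded_axioms)
  then have "v = d (Suc 0) ?u" using E.homog_part_homog[OF v] u by simp
  moreover have "h [^]\<^bsub>S\<^esub> n \<odot>\<^bsub>E1\<^esub> ?u = \<zero>\<^bsub>E1\<^esub>"
    if h: "h \<in> grade S e" "h [^]\<^bsub>S\<^esub> n \<odot>\<^bsub>E1\<^esub> u = \<zero>\<^bsub>E1\<^esub>" for h
  proof -
    note [simp] = grade_carrier[OF h(1)]
    have "homog_part E1 (h [^]\<^bsub>S\<^esub> n \<odot>\<^bsub>E1\<^esub> u) (scale n e + c) = h [^]\<^bsub>S\<^esub> n \<odot>\<^bsub>E1\<^esub> ?u"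
      by (rule E.homog_part_map)
        (simp_all add: u E.smult_r_distr E.graded_axioms E.grade_smult[OF pow_grade[OF h(1)]])
    then show ?thesis using h(2) E.homog_part_homog[OF E.grade_zero] by simp
  qed
  ultimately show "coboundary c v"
    unfolding coboundary_def fg_torsion_def using f g u E.homog_part_grade by blast
next
  assume "coboundary c v"
  then show "v \<in> boundaries" unfolding coboundary_def boundaries_def using E.grade_carrier by blast
qed

lemma torsion_carrier: "carrier (torsion S (genideal S {f, g}) (E i)) = {v \<in> carrier (E i). fg_torsion i v}"
  unfolding torsion_def graded_sub_def using torsion_iff by auto

text \<open>Passing to torsion elements and then to the kernel changes neither the operations nor
  the cosets, so the cohomology can be computed with cosets in \<open>E2\<close> itself.\<close>

lemma cohomology_2:
  assumes "H = cohomology (\<lambda>n. torsion S (genideal S {f, g}) (E n)) d 2"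
  shows cohomology_grade: "grade H c = (\<lambda>v. boundaries +>\<^bsub>E2\<^esub> v) ` {v. cocycle c v}"
    and cohomology_add: "X \<oplus>\<^bsub>H\<^esub> Y = X <+>\<^bsub>E2\<^esub> Y"
    and cohomology_smult: "a \<odot>\<^bsub>H\<^esub> X = (\<Union>v\<in>X. boundaries +>\<^bsub>E2\<^esub> (a \<odot>\<^bsub>E2\<^esub> v))"
proof -
  let ?T = "\<lambda>n. torsion S (genideal S {f, g}) (E n)"
  have T: "grade (?T n) c = grade (E n) c \<inter> {v \<in> carrier (E n). fg_torsion n v}"
    "zero (?T n) = zero (E n)" "add (?T n) = add (E n)" "smult (?T n) = smult (E n)" for n
    using torsion_carrier[of n] by (simp_all add: torsion_def graded_sub_def)
  have two: "(2::nat) = Suc (Suc 0)" by simp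
  have co: "coboundaries ?T d (Suc (Suc 0)) = boundaries"
    by (simp add: coboundaries_def torsion_carrier boundaries_def)
  have coset: "N +>\<^bsub>graded_sub (?T n) U\<^esub> v = N +>\<^bsub>E n\<^esub> v" for N n U v
    by (simp add: a_r_coset_def r_coset_def graded_sub_def T)
  have ker: "grade (?T (Suc (Suc 0))) c \<inter> a_kernel (?T (Suc (Suc 0))) (?T (Suc (Suc (Suc 0)))) (d (Suc (Suc 0))) =
      {v. cocycle c v}"
    using E.grade_carrier[of _ "Suc (Suc 0)" c] by (auto simp: T a_kernel_def kernel_def torsion_carrier cocycle_def)
  show "grade H c = (\<lambda>v. boundaries +>\<^bsub>E2\<^esub> v) ` {v. cocycle c v}"
    unfolding assms two cohomology_def graded_quot_def
    by (simp add: module.defs co coset) (simp add: graded_sub_def ker)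
  show "X \<oplus>\<^bsub>H\<^esub> Y = X <+>\<^bsub>E2\<^esub> Y"
    unfolding assms two cohomology_def graded_quot_def
    by (simp add: module.defs quot_module_def set_add_def set_mult_def) (simp add: graded_sub_def T)
  show "a \<odot>\<^bsub>H\<^esub> X = (\<Union>v\<in>X. boundaries +>\<^bsub>E2\<^esub> (a \<odot>\<^bsub>E2\<^esub> v))"
    unfolding assms two cohomology_def graded_quot_def
    by (simp add: module.defs quot_module_def co coset) (simp add: graded_sub_def T)
qed

end

section \<open>The bigraded Rees algebra\<close>

lemma (in noetherian_ring) ideal_chain_stabilizes:
  assumes id: "\<And>n. ideal (A n) R" and up: "\<And>n. (A :: nat \<Rightarrow> 'a set) n \<subseteq> A (Suc n)"
  obtains N where "\<And>n. N \<le> n \<Longrightarrow> A n = A N"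
proof -
  have "subset.chain {I. ideal I R} (range A)"
    unfolding pred_on.chain_def
  proof (intro conjI ballI)
    show "range A \<subseteq> {I. ideal I R}" using id by auto
    fix X Y assume "X \<in> range A" "Y \<in> range A"
    then obtain m n where "X = A m" "Y = A n" by auto
    then show "(\<subset>)\<^sup>=\<^sup>= X Y \<or> (\<subset>)\<^sup>=\<^sup>= Y X"
      using chain_mono[of A m n, OF up] chain_mono[of A n m, OF up] by (cases "m \<le> n") auto
  qed
  then have "\<Union>(range A) \<in> range A" by (intro ideal_chain_is_trivial) auto
  then obtain N where "\<Union>(range A) = A N" by auto
  then have "A n = A N" if "N \<le> n" for n
    using chain_mono[of A N n, OF up that] by blast
  then show thesis by (rule that)
qed

section \<open>Monomials in two indeterminates\<close>

context cring
begin

interpretation P: UP_cring R "UP R" by unfold_locales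
interpretation Q: UP_cring "UP R" "UP (UP R)" by unfold_locales

lemma bimonom_carrier [simp]: "a \<in> carrier R \<Longrightarrow> bimonom R a r s \<in> carrier (UP (UP R))"
  by (simp add: bimonom_def)

lemma bimonom_mult:
  "a \<in> carrier R \<Longrightarrow> b \<in> carrier R \<Longrightarrow>
    bimonom R a r s \<otimes>\<^bsub>UP (UP R)\<^esub> bimonom R b r' s' = bimonom R (a \<otimes> b) (r + r') (s + s')"
  by (simp add: bimonom_def)

lemma bimonom_add:
  "a \<in> carrier R \<Longrightarrow> b \<in> carrier R \<Longrightarrow>
    bimonom R a r s \<oplus>\<^bsub>UP (UP R)\<^esub> bimonom R b r s = bimonom R (a \<oplus> b) r s"
  by (simp add: bimonom_def)

lemma bimonom_one: "bimonom R \<one> 0 0 = \<one>\<^bsub>UP (UP R)\<^esub>"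
  by (simp add: bimonom_def)

lemma bimonom_zero: "bimonom R \<zero> r s = \<zero>\<^bsub>UP (UP R)\<^esub>"
  by (simp add: bimonom_def)

lemma bimonom_inj: "a \<in> carrier R \<Longrightarrow> b \<in> carrier R \<Longrightarrow> bimonom R a r s = bimonom R b r s \<longleftrightarrow> a = b"
  using P.monom_inj[of s] Q.monom_inj[of r] by (auto simp: bimonom_def inj_on_def)

lemma bimonom_pow:
  "a \<in> carrier R \<Longrightarrow> bimonom R a r s [^]\<^bsub>UP (UP R)\<^esub> (n::nat) = bimonom R (a [^] n) (n * r) (n * s)"
  by (induct n) (simp_all add: bimonom_one bimonom_mult add.commute)

end

lemma rees_simps [simp]:
  "monoid.mult (rees R I J) = monoid.mult (UP (UP R))" "one (rees R I J) = one (UP (UP R))"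
  "zero (rees R I J) = zero (UP (UP R))" "add (rees R I J) = add (UP (UP R))"
  "smult (rees R I J) = monoid.mult (UP (UP R))"
  by (simp_all add: rees_def)

lemma rees_pow [simp]: "v [^]\<^bsub>rees R I J\<^esub> (n::nat) = v [^]\<^bsub>UP (UP R)\<^esub> n"
  by (simp add: nat_pow_def)

text \<open>That the Rees algebra is graded is an assumption here because it is part of the data of
  a graded injective resolution of it, from which the theorem supplies it.\<close>

locale bigraded_rees = cring R for R (structure) +
  fixes I J :: "'a set"
  assumes I: "ideal I R" and J: "ideal J R"
    and graded_module_rees: "graded_module (rees R I J) (rees R I J)"
begin

abbreviation "S \<equiv> rees R I J"
abbreviation "IJ r s \<equiv> ideal_prod R (ideal_pow R I r) (ideal_pow R J s)"

lemma ideal_IJ: "ideal (IJ r s) R"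
  by (intro ideal_prod_is_ideal ideal_pow_ideal I J)

lemma IJ_carrier: "a \<in> IJ r s \<Longrightarrow> a \<in> carrier R"
  using ideal.Icarr[OF ideal_IJ] .

lemma grade_rees: "0 \<le> r \<Longrightarrow> 0 \<le> s \<Longrightarrow>
    grade S (r, s) = (\<lambda>a. bimonom R a (nat r) (nat s)) ` IJ (nat r) (nat s)"
  by (simp add: rees_def)

lemma bimonom_grade: "a \<in> IJ r s \<Longrightarrow> bimonom R a r s \<in> grade S (int r, int s)"
  by (simp add: grade_rees)

lemma ideal_prod_carrier: "ideal_prod R (carrier R) (carrier R) = carrier R"
  by (simp add: ideal_prod_one oneideal)

end

sublocale bigraded_rees \<subseteq> S: graded_ring S
proof (unfold_locales)
  show "graded_module S S" by (rule graded_module_rees)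
  show "smult S = monoid.mult S" by simp
  show "\<one>\<^bsub>S\<^esub> \<in> grade S 0"
    using bimonom_grade[of \<one> 0 0] by (simp add: ideal_prod_carrier bimonom_one zero_prod_def)
qed

context bigraded_rees
begin

lemma bimonom_rees: "a \<in> IJ r s \<Longrightarrow> bimonom R a r s \<in> carrier S"
  using bimonom_grade S.grade_carrier by blast

lemma IJ_prod: "ideal_prod R (IJ r s) (IJ r' s') = IJ (r + r') (s + s')"
proof -
  interpret M: comm_monoid "ideals_set R" by (rule ideals_set_is_comm_monoid)
  have [simp]: "I \<in> carrier (ideals_set R)" "J \<in> carrier (ideals_set R)"
    using I J by (simp_all add: ideals_set_def)
  have mult: "ideal_prod R K L = K \<otimes>\<^bsub>ideals_set R\<^esub> L" for K L by (simp add: ideals_set_def)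
  show ?thesis by (simp add: mult ideal_pow_def M.m_ac flip: M.nat_pow_mult)
qed

lemma IJ_mult: "a \<in> IJ r s \<Longrightarrow> b \<in> IJ r' s' \<Longrightarrow> a \<otimes> b \<in> IJ (r + r') (s + s')"
  by (rule ideal_prod.prod[of a "IJ r s" b "IJ r' s'" R, unfolded IJ_prod])

text \<open>Degree zero together with the components \<open>I\<close> in degree (1, 0) and
  \<open>J\<close> in degree (0, 1) generates the Rees algebra: products and sums of these give
  every homogeneous component, and each element is the sum of its homogeneous parts.\<close>

lemma subring_contains_rees:
  assumes B: "subring B S" and const: "\<And>a. a \<in> carrier R \<Longrightarrow> bimonom R a 0 0 \<in> B"
    and gen1: "\<And>a. a \<in> I \<Longrightarrow> bimonom R a (Suc 0) 0 \<in> B"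
    and gen2: "\<And>a. a \<in> J \<Longrightarrow> bimonom R a 0 (Suc 0) \<in> B"
  shows "carrier S \<subseteq> B"
proof -
  have prod_mem: "bimonom R a (r + r') (s + s') \<in> B"
    if K: "ideal K R" "ideal L R" and "\<And>a. a \<in> K \<Longrightarrow> bimonom R a r s \<in> B"
      "\<And>a. a \<in> L \<Longrightarrow> bimonom R a r' s' \<in> B" and a: "a \<in> ideal_prod R K L"
    for K L r s r' s' a
    using a
  proof (induct rule: ideal_prod.induct)
    case (prod i j)
    then have "bimonom R i r s \<otimes>\<^bsub>S\<^esub> bimonom R j r' s' \<in> B"
      using that subringE(6)[OF B] by blast
    then show ?case using ideal.Icarr[OF K(1) prod(1)] ideal.Icarr[OF K(2) prod(2)] by (simp add: bimonom_mult)
  next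
    case (sum u v)
    moreover have "u \<in> carrier R" "v \<in> carrier R" using ideal_prod_in_carrier[OF K] sum by auto
    ultimately show ?case using subringE(7)[OF B, of "bimonom R u (r + r') (s + s')" "bimonom R v (r + r') (s + s')"]
      by (simp add: bimonom_add)
  qed
  have pow1: "bimonom R a n 0 \<in> B" if "a \<in> ideal_pow R I n" for a n
    using that
  proof (induct n arbitrary: a)
    case (Suc n)
    then show ?case using prod_mem[OF ideal_pow_ideal[OF I] I, of n n 0 "Suc 0" 0 a] gen1 by (simp add: ideal_pow_Suc)
  qed (simp add: const)
  have pow2: "bimonom R a 0 n \<in> B" if "a \<in> ideal_pow R J n" for a n
    using that
  proof (induct n arbitrary: a)
    case (Suc n)
    then show ?case using prod_mem[OF ideal_pow_ideal[OF J] J, of n 0 n 0 "Suc 0" a] gen2 by (simp add: ideal_pow_Suc)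
  qed (simp add: const)
  have homog: "bimonom R a r s \<in> B" if "a \<in> IJ r s" for a r s
    using prod_mem[OF ideal_pow_ideal[OF I] ideal_pow_ideal[OF J] pow1 pow2 that] by simp
  have grade_B: "grade S c \<subseteq> B" for c
  proof (cases "0 \<le> fst c \<and> 0 \<le> snd c")
    case True
    then show ?thesis using grade_rees[of "fst c" "snd c"] homog by auto
  next
    case False
    then show ?thesis using subringE(2)[OF B] by (auto simp: rees_def split: prod.splits)
  qed
  show ?thesis
  proof
    fix v assume v: "v \<in> carrier S"
    have "finsum S (homog_part S v) A \<in> B" if "finite A" for A
      using that
    proof (induct A)
      case empty
      then show ?case using subringE(2)[OF B] by simp
    next
      case (insert c A)
      then show ?case
        using subringE(7)[OF B] grade_B S.homog_part_grade[OF v, of c] v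
        by (simp add: Pi_iff subset_iff)
    qed
    from this[OF S.homog_part_finite[OF v]] show "v \<in> B" using S.homog_part_sum[OF v] by simp
  qed
qed

section \<open>The Rees algebra is Noetherian\<close>

lemma subring_const: "subring ((\<lambda>a. bimonom R a 0 0) ` carrier R) S" (is "subring ?B S")
proof (rule S.R.subringI)
  show "?B \<subseteq> carrier S" using bimonom_rees[of _ 0 0] by (auto simp: ideal_prod_carrier)
  show "\<one>\<^bsub>S\<^esub> \<in> ?B" using imageI[OF one_closed, of "\<lambda>a. bimonom R a 0 0"] by (simp add: bimonom_one)
  fix u assume "u \<in> ?B"
  then obtain a where a: "a \<in> carrier R" "u = bimonom R a 0 0" by auto
  have "\<ominus>\<^bsub>S\<^esub> u = bimonom R (\<ominus> a) 0 0"
    by (rule S.R.minus_equality) (use a bimonom_rees[of _ 0 0] in \<open>simp_all add: ideal_prod_carrier bimonom_add l_neg bimonom_zero\<close>)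
  then show "\<ominus>\<^bsub>S\<^esub> u \<in> ?B" using a by simp
  fix v assume "v \<in> ?B"
  then obtain b where b: "b \<in> carrier R" "v = bimonom R b 0 0" by auto
  show "u \<otimes>\<^bsub>S\<^esub> v \<in> ?B" "u \<oplus>\<^bsub>S\<^esub> v \<in> ?B" using a b by (simp_all add: bimonom_mult bimonom_add)
qed

text \<open>Degree zero is a copy of \<open>R\<close>, so a chain of ideals there pulls back to a
  chain of ideals of \<open>R\<close>.\<close>

lemma acc_const:
  assumes "noetherian_ring R"
  shows "acc S ((\<lambda>a. bimonom R a 0 0) ` carrier R)" (is "acc S ?B")
  unfolding acc_def
proof (intro allI impI)
  interpret noetherian_ring R by fact
  fix A :: "nat \<Rightarrow> _ set"
  assume id: "\<forall>n. rel_ideal S ?B (A n)" and up: "\<forall>n. A n \<subseteq> A (Suc n)"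
  let ?A = "\<lambda>n. {a \<in> carrier R. bimonom R a 0 0 \<in> A n}"
  have A_eq: "A n = (\<lambda>a. bimonom R a 0 0) ` ?A n" for n
    using id unfolding rel_ideal_def by blast
  have mult_mem: "bimonom R (b \<otimes> a) 0 0 \<in> A n" if "bimonom R a 0 0 \<in> A n" "b \<in> carrier R" "a \<in> carrier R" for a b n
  proof -
    have "bimonom R b 0 0 \<otimes>\<^bsub>S\<^esub> bimonom R a 0 0 \<in> A n" using id that unfolding rel_ideal_def by blast
    then show ?thesis using that by (simp add: bimonom_mult)
  qed
  have "ideal (?A n) R" for n
  proof (rule idealI[OF ring_axioms])
    show "subgroup (?A n) (add_monoid R)"
    proof (rule add.subgroupI)
      have "\<zero> \<in> ?A n" using id bimonom_zero by (auto simp: rel_ideal_def)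
      then show "?A n \<noteq> {}" by blast
      fix a assume a: "a \<in> ?A n"
      then show "\<ominus> a \<in> ?A n" using mult_mem[of a n "\<ominus> \<one>"] by (simp add: l_minus)
      fix b assume b: "b \<in> ?A n"
      have "bimonom R a 0 0 \<oplus>\<^bsub>S\<^esub> bimonom R b 0 0 \<in> A n" using id a b unfolding rel_ideal_def by blast
      then show "a \<oplus> b \<in> ?A n" using a b by (simp add: bimonom_add)
    qed auto
    fix a b assume "a \<in> ?A n" "b \<in> carrier R"
    then show "b \<otimes> a \<in> ?A n" using mult_mem by simp
    then show "a \<otimes> b \<in> ?A n" using \<open>a \<in> ?A n\<close> \<open>b \<in> carrier R\<close> by (simp add: m_comm)
  qed
  moreover have "?A n \<subseteq> ?A (Suc n)" for n using up by blast
  ultimately obtain N where N: "\<And>n. N \<le> n \<Longrightarrow> ?A n = ?A N" by (rule ideal_chain_stabilizes) blast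
  have "A n = A N" if "N \<le> n" for n
  proof -
    have "A n = (\<lambda>a. bimonom R a 0 0) ` ?A n" by (rule A_eq)
    also have "?A n = ?A N" by (rule N[OF that])
    also have "(\<lambda>a. bimonom R a 0 0) ` ?A N = A N" by (rule A_eq[symmetric])
    finally show ?thesis .
  qed
  then show "\<exists>N. \<forall>n\<ge>N. A n = A N" by blast
qed

text \<open>Starting from the copy of \<open>R\<close> in degree zero, adjoin one by one the
  monomials in degrees (1, 0) and (0, 1) whose coefficients run through finite generating sets of
  \<open>I\<close> and \<open>J\<close>. By \<open>acc_adjoin\<close> the chain condition survives
  each step, and the final subring is the whole algebra.\<close>

lemma acc_rees:
  assumes "noetherian_ring R"
  shows "acc S (carrier S)"
proof -
  interpret noetherian_ring R by fact
  obtain X Y where X: "X \<subseteq> carrier R" "finite X" "I = Idl X" and Y: "Y \<subseteq> carrier R" "finite Y" "J = Idl Y"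
    using finetely_gen[OF I] finetely_gen[OF J] by blast
  have XI: "X \<subseteq> I" and YJ: "Y \<subseteq> J" using genideal_self X Y by auto
  have IJ_10: "IJ (Suc 0) 0 = I" and IJ_01: "IJ 0 (Suc 0) = J"
    using ideal_prod_one I J ideal_prod_commute[OF oneideal J] by (simp_all add: ideal_pow_1)
  let ?gens = "(\<lambda>a. bimonom R a (Suc 0) 0) ` X \<union> (\<lambda>a. bimonom R a 0 (Suc 0)) ` Y"
  have "bimonom R a (Suc 0) 0 \<in> carrier S" if "a \<in> X" for a
    by (rule bimonom_rees) (unfold IJ_10, use that XI in blast)
  moreover have "bimonom R a 0 (Suc 0) \<in> carrier S" if "a \<in> Y" for a
    by (rule bimonom_rees) (unfold IJ_01, use that YJ in blast)
  ultimately have gens: "finite ?gens" "?gens \<subseteq> carrier S" using X(2) Y(2) by blast+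
  let ?B0 = "(\<lambda>a. bimonom R a 0 0) ` carrier R"
  have "\<exists>B. subring B S \<and> acc S B \<and> ?B0 \<subseteq> B \<and> T \<subseteq> B" if "finite T" "T \<subseteq> carrier S" for T
    using that
  proof (induct T)
    case empty
    then show ?case using subring_const acc_const[OF assms] by blast
  next
    case (insert t T)
    then obtain B where B: "subring B S" "acc S B" "?B0 \<subseteq> B" "T \<subseteq> B" by auto
    have t: "t \<in> carrier S" using insert by simp
    show ?case
      using S.R.subring_adjoin[OF B(1) t] S.R.acc_adjoin[OF B(1) t B(2)] S.R.subset_adjoin[OF B(1) t]
        S.R.mem_adjoin[OF B(1) t] B(3,4) by (intro exI[of _ "adjoin S B t"]) blast
  qed
  from this[OF gens] obtain B where B: "subring B S" "acc S B" "?B0 \<subseteq> B" "?gens \<subseteq> B" by blast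
  have const: "bimonom R a 0 0 \<in> B" if "a \<in> carrier R" for a using B(3) that by blast
  \<comment> \<open>Only finitely many monomials were adjoined. The coefficients whose monomial of a
    given degree lies in \<open>B\<close> form an ideal, so monomials with coefficients anywhere in
    the generated ideal are in \<open>B\<close> too.\<close>
  have ideal_gen: "bimonom R a r s \<in> B"
    if K: "K \<subseteq> carrier R" "a \<in> Idl K" and gen: "\<And>a. a \<in> K \<Longrightarrow> bimonom R a r s \<in> B" for K a r s
  proof -
    let ?L = "{a \<in> carrier R. bimonom R a r s \<in> B}"
    have mult_mem: "b \<otimes> a \<in> ?L" if "a \<in> ?L" "b \<in> carrier R" for a b
      using subringE(6)[OF B(1) const[OF that(2)], of "bimonom R a r s"] that by (simp add: bimonom_mult)
    have "ideal ?L R"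
    proof (rule idealI[OF ring_axioms])
      show "subgroup ?L (add_monoid R)"
      proof (rule add.subgroupI)
        have "\<zero> \<in> ?L" using subringE(2)[OF B(1)] bimonom_zero by simp
        then show "?L \<noteq> {}" by blast
        fix a assume a: "a \<in> ?L"
        then show "\<ominus> a \<in> ?L" using mult_mem[of a "\<ominus> \<one>"] by (simp add: l_minus)
        fix b assume b: "b \<in> ?L"
        show "a \<oplus> b \<in> ?L"
          using a b subringE(7)[OF B(1), of "bimonom R a r s" "bimonom R b r s"] by (simp add: bimonom_add)
      qed auto
      fix a b assume "a \<in> ?L" "b \<in> carrier R"
      then show "b \<otimes> a \<in> ?L" by (rule mult_mem)
      then show "a \<otimes> b \<in> ?L" using \<open>a \<in> ?L\<close> \<open>b \<in> carrier R\<close> by (simp add: m_comm)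
    qed
    moreover have "K \<subseteq> ?L" using K(1) gen by blast
    ultimately have "Idl K \<subseteq> ?L" by (rule genideal_minimal)
    then show ?thesis using K(2) by blast
  qed
  have "carrier S \<subseteq> B"
  proof (rule subring_contains_rees[OF B(1) const])
    show "bimonom R a (Suc 0) 0 \<in> B" if "a \<in> I" for a
      using ideal_gen[OF X(1)] that B(4) unfolding X(3) by blast
    show "bimonom R a 0 (Suc 0) \<in> B" if "a \<in> J" for a
      using ideal_gen[OF Y(1)] that B(4) unfolding Y(3) by blast
  qed
  then have "B = carrier S" using subringE(1)[OF B(1)] by blast
  then show ?thesis using B(2) by simp
qed

end

section \<open>The direct system\<close>

text \<open>\<open>a\<close> and \<open>b\<close> will be xz and yw; as elements of the product
  ideal they give homogeneous elements of degree (1, 1).\<close>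

locale rees_resolution = bigraded_rees R I J for R (structure) and I J +
  fixes E :: "nat \<Rightarrow> (nat \<Rightarrow> nat \<Rightarrow> 'a, 'e) gmodule" and \<epsilon> d and a b :: 'a
  assumes noetherian: "noetherian_ring R"
    and res_rees: "graded_injective_resolution (rees R I J) (rees R I J) E \<epsilon> d"
    and a: "a \<in> ideal_prod R I J" and b: "b \<in> ideal_prod R I J"
begin

lemma ab_IJ: "a \<in> IJ (Suc 0) (Suc 0)" "b \<in> IJ (Suc 0) (Suc 0)"
  using a b I J by (simp_all add: ideal_pow_1)

lemma ab_carrier [simp]: "a \<in> carrier R" "b \<in> carrier R"
  using ab_IJ IJ_carrier by blast+

end

sublocale rees_resolution \<subseteq> graded_resolution_pair S E \<epsilon> d "bimonom R a (Suc 0) (Suc 0)" "bimonom R b (Suc 0) (Suc 0)" "(1, 1)"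
proof unfold_locales
  show "graded_injective_resolution S S E \<epsilon> d" by (rule res_rees)
  show "acc S (carrier S)" by (rule acc_rees[OF noetherian])
  show "bimonom R a (Suc 0) (Suc 0) \<in> grade S (1, 1)" "bimonom R b (Suc 0) (Suc 0) \<in> grade S (1, 1)"
    using bimonom_grade[OF ab_IJ(1)] bimonom_grade[OF ab_IJ(2)] by simp_all
qed

context rees_resolution
begin

section \<open>The direct system in a fixed degree (r, s)\<close>

context
  fixes r s :: int and k0
  defines "k0 \<equiv> system_start r s"
begin

text \<open>\<open>num\<close> embeds the numerators of fractions over (fg)^k. \<open>den\<close>
  embeds the coefficients of f^k and g^k in such numerators, that is, numerators over a power of
  \<open>g\<close> alone or of \<open>f\<close> alone.\<close>

abbreviation "num k u \<equiv> bimonom R u (nat (2 * int k + r)) (nat (2 * int k + s))"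
abbreviation "den k u \<equiv> bimonom R u (nat (int k + r)) (nat (int k + s))"
abbreviation "A k \<equiv> system_ideal R I J r s k"
abbreviation "D k \<equiv> IJ (nat (int k + r)) (nat (int k + s))"
abbreviation "N k \<equiv> system_subideal R I J a b r s k"

lemma k0_le: "k0 \<le> k \<Longrightarrow> 0 \<le> int k + r \<and> 0 \<le> int k + s"
  by (auto simp: k0_def system_start_def)

lemma A_carrier: "u \<in> A k \<Longrightarrow> u \<in> carrier R"
  unfolding system_ideal_def by (rule IJ_carrier)

lemma grade_num:
  assumes "k0 \<le> k"
  shows "grade S (scale k ((1, 1) + (1, 1)) + (r, s)) = num k ` A k"
  using k0_le[OF assms] by (simp add: scale_def grade_rees system_ideal_def mult.commute)

lemma grade_den:
  assumes "k0 \<le> k"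
  shows "grade S (scale k (1, 1) + (r, s)) = den k ` D k"
  using k0_le[OF assms] by (simp add: scale_def grade_rees)

lemma pow_den:
  assumes "k0 \<le> k" "h \<in> carrier R" "p \<in> carrier R"
  shows "bimonom R h (Suc 0) (Suc 0) [^]\<^bsub>S\<^esub> k \<otimes>\<^bsub>S\<^esub> den k p = num k (h [^] k \<otimes> p)"
proof -
  have "k + nat (int k + r) = nat (2 * int k + r)" "k + nat (int k + s) = nat (2 * int k + s)"
    using k0_le[OF assms(1)] by auto
  then show ?thesis using assms(2,3) by (simp add: bimonom_pow bimonom_mult)
qed

lemma pow_num:
  assumes "k0 \<le> k" "u \<in> carrier R"
  shows "(bimonom R a (Suc 0) (Suc 0) \<otimes>\<^bsub>S\<^esub> bimonom R b (Suc 0) (Suc 0)) [^]\<^bsub>S\<^esub> n \<otimes>\<^bsub>S\<^esub> num k u = num (k + n) ((a \<otimes> b) [^] n \<otimes> u)"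
proof -
  have "n * 2 + nat (2 * int k + r) = nat (2 * int (k + n) + r)" "n * 2 + nat (2 * int k + s) = nat (2 * int (k + n) + s)"
    using k0_le[OF assms(1)] by auto
  then show ?thesis using assms(2) by (simp add: bimonom_pow bimonom_mult numeral_2_eq_2)
qed

lemma ideal_N: "ideal (N k) R"
  unfolding system_subideal_def by (intro ideal_prod_is_ideal genideal_ideal ideal_IJ) simp

lemma subgroup_N: "additive_subgroup (N k) R"
  using ideal_N by (rule ideal.axioms)

text \<open>The ideal \<open>D k\<close> absorbs all coefficients of a^k and b^k, so a sum of
  arbitrarily many products collapses to two terms.\<close>

lemma N_eq: "N k = {a [^] k \<otimes> p \<oplus> b [^] k \<otimes> q |p q. p \<in> D k \<and> q \<in> D k}"
proof (intro equalityI subsetI)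
  interpret D: ideal "D k" R by (rule ideal_IJ)
  fix u assume "u \<in> N k"
  then show "u \<in> {a [^] k \<otimes> p \<oplus> b [^] k \<otimes> q |p q. p \<in> D k \<and> q \<in> D k}"
    unfolding system_subideal_def
  proof (induct rule: ideal_prod.induct)
    case (prod i j)
    then obtain t t' where t: "i = t \<otimes> a [^] k \<oplus> t' \<otimes> b [^] k" "t \<in> carrier R" "t' \<in> carrier R"
      using genideal_pair[of "a [^] k" "b [^] k"] by auto
    then have "i \<otimes> j = a [^] k \<otimes> (t \<otimes> j) \<oplus> b [^] k \<otimes> (t' \<otimes> j)"
      using D.Icarr[OF prod(2)] by (simp add: l_distr) (simp add: m_ac)
    then show ?case using D.I_l_closed[OF prod(2)] t by blast
  next
    case (sum u v)
    then obtain p q p' q' where *: "u = a [^] k \<otimes> p \<oplus> b [^] k \<otimes> q" "v = a [^] k \<otimes> p' \<oplus> b [^] k \<otimes> q'"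
      "p \<in> D k" "q \<in> D k" "p' \<in> D k" "q' \<in> D k" by blast
    then have "u \<oplus> v = a [^] k \<otimes> (p \<oplus> p') \<oplus> b [^] k \<otimes> (q \<oplus> q')"
      using D.Icarr by (simp add: r_distr a_ac)
    then show ?case using * D.a_closed by blast
  qed
next
  fix u assume "u \<in> {a [^] k \<otimes> p \<oplus> b [^] k \<otimes> q |p q. p \<in> D k \<and> q \<in> D k}"
  moreover have "a [^] k \<in> Idl {a [^] k, b [^] k}" "b [^] k \<in> Idl {a [^] k, b [^] k}"
    using genideal_self[of "{a [^] k, b [^] k}"] by auto
  ultimately show "u \<in> N k"
    unfolding system_subideal_def by (blast intro: ideal_prod.intros)
qed

text \<open>The map is well defined because ab (a^k p + b^k q) = a^(k+1) (b p) + b^(k+1) (a q),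
  where the extra factors \<open>b\<close> and \<open>a\<close> move \<open>p\<close> and
  \<open>q\<close> from \<open>D k\<close> into \<open>D (Suc k)\<close>.\<close>

lemma system_map_coset:
  assumes k: "k0 \<le> k" and u: "u \<in> carrier R"
  shows "system_map R I J a b r s k (N k +> u) = N (Suc k) +> (a \<otimes> b \<otimes> u)"
  unfolding system_map_def
proof (rule a_coset_map[OF subgroup_N subgroup_N _ _ _ u])
  have eq: "Suc 0 + nat (int k + r) = nat (int (Suc k) + r)" "Suc 0 + nat (int k + s) = nat (int (Suc k) + s)"
    using k0_le[OF k] by auto
  fix v assume "v \<in> N k"
  then obtain p q where v: "v = a [^] k \<otimes> p \<oplus> b [^] k \<otimes> q" "p \<in> D k" "q \<in> D k"
    unfolding N_eq by blast
  have [simp]: "p \<in> carrier R" "q \<in> carrier R" using v IJ_carrier by blast+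
  have "a \<otimes> b \<otimes> v = a [^] Suc k \<otimes> (b \<otimes> p) \<oplus> b [^] Suc k \<otimes> (a \<otimes> q)"
    unfolding v(1) by (simp add: r_distr m_ac)
  moreover have "b \<otimes> p \<in> D (Suc k)" "a \<otimes> q \<in> D (Suc k)"
    using IJ_mult[OF ab_IJ(2) v(2)] IJ_mult[OF ab_IJ(1) v(3)] by (simp_all only: eq)
  ultimately show "a \<otimes> b \<otimes> v \<in> N (Suc k)" unfolding N_eq by blast
qed (simp_all add: r_distr)

lemma transition_coset:
  assumes k: "k0 \<le> k" and u: "u \<in> carrier R"
  shows "transition (system_map R I J a b r s) k n (N k +> u) = N (k + n) +> ((a \<otimes> b) [^] n \<otimes> u)"
proof (induct n)
  case (Suc n)
  have "a \<otimes> b \<otimes> ((a \<otimes> b) [^] n \<otimes> u) = (a \<otimes> b) [^] Suc n \<otimes> u"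
    using u by (simp add: m_ac)
  then show ?case using Suc k u system_map_coset[of "k + n" "(a \<otimes> b) [^] n \<otimes> u"] by simp
qed (use u in simp)

lemma system_module_carrier: "carrier (system_module R I J a b r s k) = {N k +> u |u. u \<in> A k}"
  by (auto simp: system_module_def quot_module_def ideal_module_def A_RCOSETS_def RCOSETS_def
      a_r_coset_def r_coset_def)

lemma system_module_add: "U \<oplus>\<^bsub>system_module R I J a b r s k\<^esub> V = U <+> V"
  by (simp add: system_module_def quot_module_def ideal_module_def set_add_def set_mult_def)

lemma system_module_smult:
  assumes "t \<in> carrier R" "u \<in> carrier R"
  shows "t \<odot>\<^bsub>system_module R I J a b r s k\<^esub> (N k +> u) = N k +> (t \<otimes> u)"
proof -
  have "t \<odot>\<^bsub>system_module R I J a b r s k\<^esub> (N k +> u) = (\<Union>c\<in>N k +> u. N k +> (t \<otimes> c))"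
    by (simp add: system_module_def quot_module_def ideal_module_def a_r_coset_def r_coset_def)
  also have "\<dots> = N k +> (t \<otimes> u)"
    by (rule a_coset_map[OF subgroup_N subgroup_N])
      (use assms ideal.I_l_closed[OF ideal_N] in \<open>simp_all add: r_distr\<close>)
  finally show ?thesis .
qed

lemma mult_num:
  assumes "k0 \<le> k" "u \<in> carrier R"
  shows "bimonom R a (Suc 0) (Suc 0) \<otimes>\<^bsub>S\<^esub> bimonom R b (Suc 0) (Suc 0) \<otimes>\<^bsub>S\<^esub> num k u = num (Suc k) (a \<otimes> b \<otimes> u)"
proof -
  have "Suc (Suc (nat (2 * int k + r))) = nat (2 * int (Suc k) + r)" "Suc (Suc (nat (2 * int k + s))) = nat (2 * int (Suc k) + s)"
    using k0_le[OF assms(1)] by auto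
  then show ?thesis using assms(2) by (simp add: bimonom_mult)
qed

lemma represents_steps:
  assumes "represents (r, s) v k (num k u)" "k0 \<le> k" "u \<in> carrier R"
  shows "represents (r, s) v (k + n) (num (k + n) ((a \<otimes> b) [^] n \<otimes> u))"
proof (induct n)
  case (Suc n)
  have "a \<otimes> b \<otimes> ((a \<otimes> b) [^] n \<otimes> u) = (a \<otimes> b) [^] Suc n \<otimes> u"
    using assms(3) by (simp add: m_ac)
  then show ?case
    using represents_step[OF Suc] mult_num[of "k + n" "(a \<otimes> b) [^] n \<otimes> u"] assms by simp
qed (use assms in simp)

text \<open>Translates \<open>represents\<close> into a relation between cosets and feeds it to
  \<open>module_isomorphic_direct_limitI\<close>. Condition \<open>eq\<close> there combines
  \<open>represents_coboundary\<close> and \<open>coboundary_represents\<close>.\<close>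

lemma component_isomorphic_system_limit:
  assumes H: "H = cohomology (\<lambda>n. torsion S (rees_pp R I J x y z w) (E n)) d 2"
    and ab: "a = x \<otimes> z" "b = y \<otimes> w"
  shows "module_isomorphic R (component R H (r, s)) (system_limit R I J a b r s)"
proof -
  note H' = H[unfolded rees_pp_def One_nat_def, folded ab]
  have carrier_C: "carrier (component R H (r, s)) = (\<lambda>v. boundaries +>\<^bsub>E2\<^esub> v) ` {v. cocycle (r, s) v}"
    by (simp add: component_def cohomology_grade[OF H'])
  have add_C: "X \<oplus>\<^bsub>component R H (r, s)\<^esub> Y = X <+>\<^bsub>E2\<^esub> Y" for X Y
    by (simp add: component_def cohomology_add[OF H'])
  have smult_C: "t \<odot>\<^bsub>component R H (r, s)\<^esub> (boundaries +>\<^bsub>E2\<^esub> v) =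
      boundaries +>\<^bsub>E2\<^esub> (bimonom R t 0 0 \<odot>\<^bsub>E2\<^esub> v)" if "t \<in> carrier R" "v \<in> carrier E2" for t v
  proof -
    have t: "bimonom R t 0 0 \<in> carrier S" using that(1) bimonom_rees[of t 0 0] by (simp add: ideal_prod_carrier)
    show ?thesis
      unfolding component_def module.simps cohomology_smult[OF H']
      by (rule E.M.a_coset_map[OF boundaries_subgroup boundaries_subgroup])
        (use t that in \<open>simp_all add: E.smult_r_distr boundaries_smult\<close>)
  qed
  have cocycle_carrier: "v \<in> carrier E2" if "cocycle (r, s) v" for v
    using that E.grade_carrier unfolding cocycle_def by blast
  \<comment> \<open>It is enough that some representatives of the two cosets are related;
    independence of the choice is part of condition \<open>eq\<close>.\<close>
  define rel where "rel X k U \<longleftrightarrow> k0 \<le> k \<and> (\<exists>v u. u \<in> A k \<and> represents (r, s) v k (num k u) \<and>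
      X = boundaries +>\<^bsub>E2\<^esub> v \<and> U = N k +> u)" for X k U
  show ?thesis
    unfolding system_limit_def k0_def[symmetric]
  proof (rule module_isomorphic_direct_limitI[of rel])
    fix X k U assume "rel X k U"
    then show "X \<in> carrier (component R H (r, s)) \<and> k0 \<le> k \<and> U \<in> carrier (system_module R I J a b r s k)"
      unfolding rel_def carrier_C system_module_carrier using represents_cocycle by blast
  next
    fix X assume "X \<in> carrier (component R H (r, s))"
    then obtain v where v: "X = boundaries +>\<^bsub>E2\<^esub> v" "cocycle (r, s) v" unfolding carrier_C by blast
    obtain k q where k: "k0 \<le> k" "represents (r, s) v k q" by (rule represents_ex_numerator[OF v(2)])
    then have "q \<in> num k ` A k" unfolding represents_def grade_num[OF k(1)] by blast
    then show "\<exists>k U. rel X k U" unfolding rel_def using k v by blast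
  next
    fix k U assume k: "k0 \<le> k" and "U \<in> carrier (system_module R I J a b r s k)"
    then obtain u where u: "u \<in> A k" "U = N k +> u" unfolding system_module_carrier by blast
    then have "num k u \<in> grade S (scale k ((1, 1) + (1, 1)) + (r, s))" unfolding grade_num[OF k] by blast
    then obtain v where "represents (r, s) v k (num k u)" by (rule represents_ex_cocycle)
    then show "\<exists>X. rel X k U" unfolding rel_def using k u by blast
  next
    fix X Y k U V assume "rel X k U" "rel Y k V"
    then obtain v u v' u' where *: "k0 \<le> k" "u \<in> A k" "u' \<in> A k"
      "represents (r, s) v k (num k u)" "represents (r, s) v' k (num k u')"
      "X = boundaries +>\<^bsub>E2\<^esub> v" "U = N k +> u" "Y = boundaries +>\<^bsub>E2\<^esub> v'" "V = N k +> u'"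
      unfolding rel_def by blast
    have [simp]: "v \<in> carrier E2" "v' \<in> carrier E2" "u \<in> carrier R" "u' \<in> carrier R"
      using * cocycle_carrier represents_cocycle A_carrier by blast+
    have "X \<oplus>\<^bsub>component R H (r, s)\<^esub> Y = boundaries +>\<^bsub>E2\<^esub> (v \<oplus>\<^bsub>E2\<^esub> v')"
      using E.M.a_coset_add[OF boundaries_subgroup] by (simp add: add_C *)
    moreover have "U \<oplus>\<^bsub>system_module R I J a b r s k\<^esub> V = N k +> (u \<oplus> u')"
      using a_coset_add[OF subgroup_N] by (simp add: system_module_add *)
    moreover have "represents (r, s) (v \<oplus>\<^bsub>E2\<^esub> v') k (num k (u \<oplus> u'))"
      using represents_add[OF *(4,5)] by (simp add: bimonom_add)
    moreover have "u \<oplus> u' \<in> A k"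
      using *(2,3) ideal_IJ unfolding system_ideal_def by (meson additive_subgroup.a_closed ideal.axioms(1))
    ultimately show "rel (X \<oplus>\<^bsub>component R H (r, s)\<^esub> Y) k (U \<oplus>\<^bsub>system_module R I J a b r s k\<^esub> V)"
      unfolding rel_def using *(1) by blast
    \<comment> \<open>By additivity v - v' represents u - u', which reduces the comparison of two
      classes to the question when a class vanishes.\<close>
    have "represents (r, s) (\<ominus>\<^bsub>E2\<^esub> v') k (\<ominus>\<^bsub>S\<^esub> num k u')" by (rule represents_uminus[OF *(5)])
    moreover have "\<ominus>\<^bsub>S\<^esub> num k u' = num k (\<ominus> u')"
    proof (rule S.R.minus_equality)
      show "num k (\<ominus> u') \<oplus>\<^bsub>S\<^esub> num k u' = \<zero>\<^bsub>S\<^esub>" by (simp add: bimonom_add l_neg bimonom_zero)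
      show "num k u' \<in> carrier S" "num k (\<ominus> u') \<in> carrier S"
        using *(3) ideal_IJ unfolding system_ideal_def
        by (auto intro!: bimonom_rees additive_subgroup.a_inv_closed ideal.axioms)
    qed
    ultimately have rep: "represents (r, s) (v \<ominus>\<^bsub>E2\<^esub> v') k (num k (u \<ominus> u'))"
      using represents_add[OF *(4), of "\<ominus>\<^bsub>E2\<^esub> v'" "num k (\<ominus> u')"] by (simp add: a_minus_def bimonom_add)
    have grade_v: "v \<ominus>\<^bsub>E2\<^esub> v' \<in> grade E2 (r, s)"
      using represents_cocycle[OF rep] by (simp add: cocycle_def)
    have XY: "X = Y \<longleftrightarrow> coboundary (r, s) (v \<ominus>\<^bsub>E2\<^esub> v')"
      by (simp add: * E.M.a_coset_eq_iff[OF boundaries_subgroup] boundaries_iff_coboundary[OF grade_v])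
    have UV: "transition (system_map R I J a b r s) k n U = transition (system_map R I J a b r s) k n V \<longleftrightarrow>
        (a \<otimes> b) [^] n \<otimes> (u \<ominus> u') \<in> N (k + n)" for n
      by (simp add: * transition_coset a_coset_eq_iff[OF subgroup_N] a_minus_def r_distr r_minus)
    show "X = Y \<longleftrightarrow> (\<exists>n. transition (system_map R I J a b r s) k n U = transition (system_map R I J a b r s) k n V)"
      unfolding XY UV
    proof
      assume "coboundary (r, s) (v \<ominus>\<^bsub>E2\<^esub> v')"
      then obtain j p q where pq: "p \<in> grade S (scale (k + j) (1, 1) + (r, s))" "q \<in> grade S (scale (k + j) (1, 1) + (r, s))"
        "P j \<otimes>\<^bsub>S\<^esub> num k (u \<ominus> u') = F (k + j) \<otimes>\<^bsub>S\<^esub> p \<oplus>\<^bsub>S\<^esub> G (k + j) \<otimes>\<^bsub>S\<^esub> q"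
        by (rule coboundary_represents[OF rep])
      have kj: "k0 \<le> k + j" using *(1) by simp
      obtain p' q' where pq': "p' \<in> D (k + j)" "q' \<in> D (k + j)" "p = den (k + j) p'" "q = den (k + j) q'"
        using pq(1,2) unfolding grade_den[OF kj] by blast
      have [simp]: "p' \<in> carrier R" "q' \<in> carrier R" using pq' IJ_carrier by blast+
      \<comment> \<open>The equation in the Rees algebra has all its terms in one degree, where it
        can be compared coefficient by coefficient in \<open>R\<close>.\<close>
      have "num (k + j) ((a \<otimes> b) [^] j \<otimes> (u \<ominus> u')) = P j \<otimes>\<^bsub>S\<^esub> num k (u \<ominus> u')"
        by (rule pow_num[symmetric]) (simp_all add: *)
      also have "\<dots> = num (k + j) (a [^] (k + j) \<otimes> p') \<oplus>\<^bsub>S\<^esub> num (k + j) (b [^] (k + j) \<otimes> q')"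
        unfolding pq(3) pq'(3,4) by (simp only: pow_den[OF kj] ab_carrier \<open>p' \<in> carrier R\<close> \<open>q' \<in> carrier R\<close>)
      also have "\<dots> = num (k + j) (a [^] (k + j) \<otimes> p' \<oplus> b [^] (k + j) \<otimes> q')"
        by (simp add: bimonom_add)
      finally have "(a \<otimes> b) [^] j \<otimes> (u \<ominus> u') = a [^] (k + j) \<otimes> p' \<oplus> b [^] (k + j) \<otimes> q'"
        by (subst (asm) bimonom_inj) simp_all
      then show "\<exists>n. (a \<otimes> b) [^] n \<otimes> (u \<ominus> u') \<in> N (k + n)"
        unfolding N_eq using pq' by blast
    next
      assume "\<exists>n. (a \<otimes> b) [^] n \<otimes> (u \<ominus> u') \<in> N (k + n)"
      then obtain n p q where n: "(a \<otimes> b) [^] n \<otimes> (u \<ominus> u') = a [^] (k + n) \<otimes> p \<oplus> b [^] (k + n) \<otimes> q"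
        "p \<in> D (k + n)" "q \<in> D (k + n)" unfolding N_eq by blast
      have kn: "k0 \<le> k + n" using *(1) by simp
      have [simp]: "p \<in> carrier R" "q \<in> carrier R" using n IJ_carrier by blast+
      have "den (k + n) p \<in> grade S (scale (k + n) (1, 1) + (r, s))" "den (k + n) q \<in> grade S (scale (k + n) (1, 1) + (r, s))"
        unfolding grade_den[OF kn] using n by blast+
      moreover have "num (k + n) ((a \<otimes> b) [^] n \<otimes> (u \<ominus> u')) =
          F (k + n) \<otimes>\<^bsub>S\<^esub> den (k + n) p \<oplus>\<^bsub>S\<^esub> G (k + n) \<otimes>\<^bsub>S\<^esub> den (k + n) q"
        by (simp only: pow_den[OF kn] ab_carrier \<open>p \<in> carrier R\<close> \<open>q \<in> carrier R\<close> n(1)) (simp add: bimonom_add)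
      \<comment> \<open>The fraction is first expanded to denominator (fg)^(k+n); its new numerator
        is then a combination of f^(k+n) and g^(k+n), as \<open>represents_coboundary\<close>
        requires.\<close>
      ultimately show "coboundary (r, s) (v \<ominus>\<^bsub>E2\<^esub> v')"
        by (intro represents_coboundary[OF represents_steps[OF rep *(1)]]) simp_all
    qed
  next
    fix t X k U assume t: "t \<in> carrier R" and "rel X k U"
    then obtain v u where *: "k0 \<le> k" "u \<in> A k" "represents (r, s) v k (num k u)"
      "X = boundaries +>\<^bsub>E2\<^esub> v" "U = N k +> u"
      unfolding rel_def by blast
    have [simp]: "v \<in> carrier E2" "u \<in> carrier R"
      using * cocycle_carrier represents_cocycle A_carrier by blast+
    have "t \<odot>\<^bsub>component R H (r, s)\<^esub> X = boundaries +>\<^bsub>E2\<^esub> (bimonom R t 0 0 \<odot>\<^bsub>E2\<^esub> v)"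
      using t by (simp add: smult_C *)
    moreover have "t \<odot>\<^bsub>system_module R I J a b r s k\<^esub> U = N k +> (t \<otimes> u)"
      using t by (simp add: system_module_smult *)
    moreover have "bimonom R t 0 0 \<in> grade S 0"
      using bimonom_grade[of t 0 0] t by (simp add: ideal_prod_carrier zero_prod_def)
    then have "represents (r, s) (bimonom R t 0 0 \<odot>\<^bsub>E2\<^esub> v) k (num k (t \<otimes> u))"
      using represents_smult[OF *(3), of "bimonom R t 0 0"] t by (simp add: bimonom_mult)
    moreover have "t \<otimes> u \<in> A k"
      using *(2) t ideal_IJ unfolding system_ideal_def by (meson ideal.I_l_closed)
    ultimately show "rel (t \<odot>\<^bsub>component R H (r, s)\<^esub> X) k (t \<odot>\<^bsub>system_module R I J a b r s k\<^esub> U)"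
      unfolding rel_def using *(1) by blast
  next
    fix X k U assume "rel X k U"
    then obtain v u where *: "k0 \<le> k" "u \<in> A k" "represents (r, s) v k (num k u)"
      "X = boundaries +>\<^bsub>E2\<^esub> v" "U = N k +> u"
      unfolding rel_def by blast
    have u: "u \<in> carrier R" using * A_carrier by blast
    have rep: "represents (r, s) v (Suc k) (num (Suc k) (a \<otimes> b \<otimes> u))"
      using represents_steps[OF *(3,1) u, of 1] u by simp
    \<comment> \<open>That the product lies in \<open>A (Suc k)\<close> is read off from the degree
      of the numerator recorded in \<open>represents\<close>.\<close>
    then have "num (Suc k) (a \<otimes> b \<otimes> u) \<in> num (Suc k) ` A (Suc k)"
      using grade_num[of "Suc k"] *(1) unfolding represents_def by simp
    then obtain u' where "u' \<in> A (Suc k)" "num (Suc k) (a \<otimes> b \<otimes> u) = num (Suc k) u'" by blast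
    then have "a \<otimes> b \<otimes> u \<in> A (Suc k)"
      using A_carrier[of u'] u by (subst (asm) bimonom_inj) simp_all
    then show "rel X (Suc k) (system_map R I J a b r s k U)"
      unfolding rel_def using rep *(1,4,5) system_map_coset[OF *(1) u] by auto
  qed
qed

end

end

theorem proposition4p2:
  fixes R :: "('a, 'b) ring_scheme" (structure)
    and \<mm> I J :: "'a set" and x y z w :: 'a
    and H :: "(nat \<Rightarrow> nat \<Rightarrow> 'a, 'e set) gmodule"
  assumes "noetherian_ring R" and "local_ring R \<mm>" and "krull_dim R = 2"
    and "primary_to R \<mm> I" and "primary_to R \<mm> J"
    and "complete_reduction R I J x y z w"
    and "is_local_cohomology (rees R I J) (rees_pp R I J x y z w) 2 (rees R I J) H"
  shows "\<forall>r s :: int. module_isomorphic R (component R H (r, s))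
           (system_limit R I J (x \<otimes> z) (y \<otimes> w) r s)"
proof (intro allI)
  fix r s :: int
  obtain E :: "nat \<Rightarrow> (nat \<Rightarrow> nat \<Rightarrow> 'a, 'e) gmodule" and \<epsilon> d where
    res: "graded_injective_resolution (rees R I J) (rees R I J) E \<epsilon> d" and
    H: "H = cohomology (\<lambda>n. torsion (rees R I J) (rees_pp R I J x y z w) (E n)) d 2"
    using assms(7) unfolding is_local_cohomology_def by blast
  interpret cring R using assms(2) by (simp add: local_ring_def)
  interpret rees_resolution R I J E \<epsilon> d "x \<otimes> z" "y \<otimes> w"
  proof (intro rees_resolution.intro bigraded_rees.intro bigraded_rees_axioms.intro
      rees_resolution_axioms.intro)
    show "cring R" by (rule cring_axioms)
    show "ideal I R" "ideal J R" using assms(4,5) by (simp_all add: primary_to_def primary_ideal_def)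
    show "graded_module (rees R I J) (rees R I J)" using res by (simp add: graded_injective_resolution_def)
    show "x \<otimes> z \<in> ideal_prod R I J" "y \<otimes> w \<in> ideal_prod R I J"
      using assms(6) by (simp_all add: complete_reduction_def ideal_prod.prod)
  qed (rule assms(1) res)+
  show "module_isomorphic R (component R H (r, s)) (system_limit R I J (x \<otimes> z) (y \<otimes> w) r s)"
    by (rule component_isomorphic_system_limit[OF H refl refl])
qed

end
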